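(* For each realtime deterministic context-free language $L$ and each $\epsilon>0$, there is a dynamic constant-time parallel algorithm on a (common) CRCW PRAM for $\mathrm{CFL}(L)$ with $\mathcal{O}(n^{3+\epsilon})$ work per operation.
   Context: A deterministic pushdown automaton (DPDA) $(Q,\Sigma,\Gamma,q_0,\tau_0,\delta,F)$ has finite state set $Q$, input alphabet $\Sigma$, stack alphabet $\Gamma$, initial state $q_0$, initial stack symbol $\tau_0$, partial transition function $\delta:Q\times(\Sigma\cup\{\lambda\})\times\Gamma\to Q\times\Gamma^*$ (where $\delta(p,\lambda,\tau)$ may be defined only if $\delta(p,\sigma,\tau)$ is undefined for all $\sigma\in\Sigma$), and final states $F$; it accepts $w$ if its unique maximal run from $(q_0,w,\tau_0)$ reads all of $w$ and ends in a state of $F$. A DPDA is realtime if it has no $\lambda$-transitions; a language is realtime deterministic context-free if it is accepted by a realtime DPDA. $\mathrm{CFL}(L)$ maintains a string $w$ under: $\mathrm{Init}(w)$ (empty string), $\mathrm{Relabel}(w,i,\sigma)$ (set the symbol at position $i$ to $\sigma$), $\mathrm{InsertPositionBefore}(w,i,\sigma)$ and $\mathrm{InsertPositionAfter}(w,i,\sigma)$ (insert a new position with symbol $\sigma$ before/after position $i$), and $\mathrm{Query}(w,i,j)$ (true iff the substring $w[i,j]\in L$). $n$ is a size parameter with $|w|$ kept between $\frac14 n$ and $n$ (doubled when the length exceeds $\frac12 n$). A common CRCW PRAM allows concurrent reads and concurrent writes to a cell only if all writers write the same value; work is the total number of steps of all processors; constant-time means $\mathcal{O}(1)$ parallel time per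 operation. *)

theory Defs
  imports Complex_Main "HOL-Library.Landau_Symbols"
begin

record ('q, 'a, 'g) dpda =
  states :: "'q set"
  alphabet :: "'a set"
  stack_alphabet :: "'g set"
  start_state :: 'q
  start_symbol :: 'g
  delta :: "'q \<Rightarrow> 'a option \<Rightarrow> 'g \<Rightarrow> ('q \<times> 'g list) option"
  final_states :: "'q set"

text \<open>The letter argument \<open>None\<close> of \<open>delta\<close> stands for \<open>\<lambda>\<close>; an undefined
  transition has the value \<open>None\<close>.\<close>

definition wf_dpda :: "('q, 'a, 'g) dpda \<Rightarrow> bool" where
  "wf_dpda M \<longleftrightarrow>
     finite (states M) \<and> finite (alphabet M) \<and> finite (stack_alphabet M) \<and>
     start_state M \<in> states M \<and> start_symbol M \<in> stack_alphabet M \<and>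
     final_states M \<subseteq> states M \<and>
     (\<forall>p x \<tau> q \<alpha>. delta M p x \<tau> = Some (q, \<alpha>) \<longrightarrow>
        p \<in> states M \<and> set_option x \<subseteq> alphabet M \<and> \<tau> \<in> stack_alphabet M \<and>
        q \<in> states M \<and> set \<alpha> \<subseteq> stack_alphabet M) \<and>
     (\<forall>p \<tau>. delta M p None \<tau> \<noteq> None \<longrightarrow> (\<forall>\<sigma>. delta M p (Some \<sigma>) \<tau> = None))"

definition realtime :: "('q, 'a, 'g) dpda \<Rightarrow> bool" where
  "realtime M \<longleftrightarrow> (\<forall>p \<tau>. delta M p None \<tau> = None)"

text \<open>A configuration consists of the state, the unread input and the stack, whose top symbol
  is the head of the list. There is no step from a configuration with an empty stack.\<close>

type_synonym ('q, 'a, 'g) dpda_config = "'q \<times> 'a list \<times> 'g list"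

inductive dpda_step ::
  "('q, 'a, 'g) dpda \<Rightarrow> ('q, 'a, 'g) dpda_config \<Rightarrow> ('q, 'a, 'g) dpda_config \<Rightarrow> bool"
  for M where
  read: "delta M p (Some \<sigma>) \<tau> = Some (q, \<alpha>) \<Longrightarrow> dpda_step M (p, \<sigma> # u, \<tau> # \<gamma>) (q, u, \<alpha> @ \<gamma>)"
| lambda: "delta M p None \<tau> = Some (q, \<alpha>) \<Longrightarrow> dpda_step M (p, u, \<tau> # \<gamma>) (q, u, \<alpha> @ \<gamma>)"

lemma dpda_step_deterministic:
  assumes "wf_dpda M" "dpda_step M c c1" "dpda_step M c c2"
  shows "c1 = c2"
  using assms(2,3,1) by (auto simp: wf_dpda_def elim!: dpda_step.cases)

text \<open>By determinism there is one maximal run. A word is accepted if this run is finite, its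
  last configuration has no unread input, and the state of that configuration is final.\<close>

definition dpda_language :: "('q, 'a, 'g) dpda \<Rightarrow> 'a list set" where
  "dpda_language M =
     {w. \<exists>q \<gamma>. (dpda_step M)\<^sup>*\<^sup>* (start_state M, w, [start_symbol M]) (q, [], \<gamma>) \<and>
            (\<nexists>c. dpda_step M (q, [], \<gamma>) c) \<and> q \<in> final_states M}"

text \<open>All processors run the same program synchronously. They share a memory and have private
  registers. In \<open>Arith f d a b\<close>, \<open>Load d a\<close> and \<open>Store a b\<close> the numbers are register names:
  \<open>Load\<close> copies the shared cell whose address is in \<open>a\<close> to \<open>d\<close>, and \<open>Store\<close> copies \<open>b\<close> to
  the shared cell whose address is in \<open>a\<close>. Subtraction is truncated, and \<open>JumpZero a l\<close>
  branches to instruction \<open>l\<close> if register \<open>a\<close> is zero. A processor has halted when its program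
  counter is outside the program.\<close>

datatype arith = Plus | Minus | Times | Div

datatype instr =
    Const nat nat
  | Arith arith nat nat nat
  | Load nat nat
  | Store nat nat
  | JumpZero nat nat

type_synonym program = "instr list"
type_synonym memory = "nat \<Rightarrow> nat"

record proc =
  pc :: nat
  regs :: "nat \<Rightarrow> nat"

record pram_config =
  mem :: memory
  procs :: "nat \<Rightarrow> proc"

primrec arith_fun :: "arith \<Rightarrow> nat \<Rightarrow> nat \<Rightarrow> nat" where
  "arith_fun Plus = (+)"
| "arith_fun Minus = (-)"
| "arith_fun Times = (*)"
| "arith_fun Div = (div)"

primrec exec_instr :: "instr \<Rightarrow> memory \<Rightarrow> proc \<Rightarrow> proc" where
  "exec_instr (Const d k) m s = \<lparr>pc = Suc (pc s), regs = (regs s)(d := k)\<rparr>"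
| "exec_instr (Arith f d a b) m s =
     \<lparr>pc = Suc (pc s), regs = (regs s)(d := arith_fun f (regs s a) (regs s b))\<rparr>"
| "exec_instr (Load d a) m s = \<lparr>pc = Suc (pc s), regs = (regs s)(d := m (regs s a))\<rparr>"
| "exec_instr (Store a b) m s = \<lparr>pc = Suc (pc s), regs = regs s\<rparr>"
| "exec_instr (JumpZero a l) m s =
     \<lparr>pc = (if regs s a = 0 then l else Suc (pc s)), regs = regs s\<rparr>"

definition active :: "program \<Rightarrow> nat \<Rightarrow> pram_config \<Rightarrow> nat set" where
  "active prog P c = {p. p < P \<and> pc (procs c p) < length prog}"

definition writes :: "program \<Rightarrow> nat \<Rightarrow> pram_config \<Rightarrow> (nat \<times> nat) set" where
  "writes prog P c =
     {(regs (procs c p) a, regs (procs c p) b) | p a b.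
        p \<in> active prog P c \<and> prog ! pc (procs c p) = Store a b}"

text \<open>All reads of a step see the memory before the writes of that step. The memory after the step
  is meaningful only if \<open>writes\<close> is single-valued, which is the rule for common concurrent writes.
  Runs are required to satisfy this below.\<close>

definition pram_step :: "program \<Rightarrow> nat \<Rightarrow> pram_config \<Rightarrow> pram_config" where
  "pram_step prog P c =
     \<lparr>mem = (\<lambda>x. if \<exists>v. (x, v) \<in> writes prog P c
                 then SOME v. (x, v) \<in> writes prog P c else mem c x),
      procs = (\<lambda>p. if p \<in> active prog P c
                   then exec_instr (prog ! pc (procs c p)) (mem c) (procs c p)
                   else procs c p)\<rparr>"

text \<open>Initially, register 0 of a processor holds its index and the other registers are 0.\<close>

definition pram_init :: "memory \<Rightarrow> pram_config" where
  "pram_init m = \<lparr>mem = m, procs = (\<lambda>p. \<lparr>pc = 0, regs = (\<lambda>_. 0)(0 := p)\<rparr>)\<rparr>"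

definition pram_after :: "program \<Rightarrow> nat \<Rightarrow> memory \<Rightarrow> nat \<Rightarrow> pram_config" where
  "pram_after prog P m t = (pram_step prog P ^^ t) (pram_init m)"

text \<open>\<open>pram_run prog P m B t k m'\<close>: \<open>P\<close> processors run \<open>prog\<close> from memory \<open>m\<close> without write
  conflicts and have all halted after \<open>t\<close> parallel steps, with total work \<open>k\<close> and final memory
  \<open>m'\<close>. No processor ever holds a number above \<open>B\<close>. This also bounds the addresses used and the
  values written, since they are register contents.\<close>

definition pram_run ::
  "program \<Rightarrow> nat \<Rightarrow> memory \<Rightarrow> nat \<Rightarrow> nat \<Rightarrow> nat \<Rightarrow> memory \<Rightarrow> bool" where
  "pram_run prog P m B t k m' \<longleftrightarrow>
     active prog P (pram_after prog P m t) = {} \<and>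
     (\<forall>s<t. single_valued (writes prog P (pram_after prog P m s))) \<and>
     (\<forall>s\<le>t. \<forall>p<P. \<forall>r. regs (procs (pram_after prog P m s) p) r \<le> B) \<and>
     k = (\<Sum>s<t. card (active prog P (pram_after prog P m s))) \<and>
     m' = mem (pram_after prog P m t)"

text \<open>Positions are counted from 1. The constructors are the operations after \<open>Init\<close>.\<close>

datatype 'a oper =
    Relabel nat 'a
  | InsertPositionBefore nat 'a
  | InsertPositionAfter nat 'a
  | Query nat nat

text \<open>The empty string has no position to refer to. There both insertions are allowed with
  \<open>i = 1\<close> and create the first position.\<close>

fun valid_oper :: "'a set \<Rightarrow> 'a list \<Rightarrow> 'a oper \<Rightarrow> bool" where
  "valid_oper \<Sigma> w (Relabel i \<sigma>) \<longleftrightarrow> 1 \<le> i \<and> i \<le> length w \<and> \<sigma> \<in> \<Sigma>"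
| "valid_oper \<Sigma> w (InsertPositionBefore i \<sigma>) \<longleftrightarrow> 1 \<le> i \<and> i \<le> max 1 (length w) \<and> \<sigma> \<in> \<Sigma>"
| "valid_oper \<Sigma> w (InsertPositionAfter i \<sigma>) \<longleftrightarrow> 1 \<le> i \<and> i \<le> max 1 (length w) \<and> \<sigma> \<in> \<Sigma>"
| "valid_oper \<Sigma> w (Query i j) \<longleftrightarrow> 1 \<le> i \<and> i \<le> j \<and> j \<le> length w"

fun apply_oper :: "'a oper \<Rightarrow> 'a list \<Rightarrow> 'a list" where
  "apply_oper (Relabel i \<sigma>) w = w[i - 1 := \<sigma>]"
| "apply_oper (InsertPositionBefore i \<sigma>) w = take (i - 1) w @ \<sigma> # drop (i - 1) w"
| "apply_oper (InsertPositionAfter i \<sigma>) w = take i w @ \<sigma> # drop i w"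
| "apply_oper (Query i j) w = w"

definition substring :: "'a list \<Rightarrow> nat \<Rightarrow> nat \<Rightarrow> 'a list" where
  "substring w i j = drop (i - 1) (take j w)"

definition next_size :: "nat \<Rightarrow> 'a list \<Rightarrow> nat" where
  "next_size n w = (if 2 * length w > n then 2 * n else n)"

record dyn_alg =
  init_prog :: program
  relabel_prog :: program
  before_prog :: program
  after_prog :: program
  query_prog :: program

fun oper_prog :: "dyn_alg \<Rightarrow> 'a oper \<Rightarrow> program" where
  "oper_prog A (Relabel i \<sigma>) = relabel_prog A"
| "oper_prog A (InsertPositionBefore i \<sigma>) = before_prog A"
| "oper_prog A (InsertPositionAfter i \<sigma>) = after_prog A"
| "oper_prog A (Query i j) = query_prog A"

text \<open>The shared memory persists between operations, the registers do not. Cell 0 holds the number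
  of processors for the next operation, so that the algorithm itself has to compute this number.
  The two arguments of an operation are placed in cells 1 and 2 (symbols as numbers, via an
  encoding \<open>enc\<close>), and the answer to a query is expected in cell 3. \<open>Init\<close> is run by one processor
  on an otherwise zero memory.\<close>

fun load_args :: "('a \<Rightarrow> nat) \<Rightarrow> 'a oper \<Rightarrow> memory \<Rightarrow> memory" where
  "load_args enc (Relabel i \<sigma>) m = m(1 := i, 2 := enc \<sigma>)"
| "load_args enc (InsertPositionBefore i \<sigma>) m = m(1 := i, 2 := enc \<sigma>)"
| "load_args enc (InsertPositionAfter i \<sigma>) m = m(1 := i, 2 := enc \<sigma>)"
| "load_args enc (Query i j) m = m(1 := i, 2 := j)"

definition init_run :: "dyn_alg \<Rightarrow> nat \<Rightarrow> nat \<Rightarrow> nat \<Rightarrow> memory \<Rightarrow> bool" where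
  "init_run A B t k m' \<longleftrightarrow> pram_run (init_prog A) 1 ((\<lambda>_. 0)(0 := 1)) B t k m'"

definition oper_run ::
  "dyn_alg \<Rightarrow> ('a \<Rightarrow> nat) \<Rightarrow> 'a oper \<Rightarrow> memory \<Rightarrow> nat \<Rightarrow> nat \<Rightarrow> nat \<Rightarrow> memory \<Rightarrow> bool" where
  "oper_run A enc f m B t k m' \<longleftrightarrow>
     pram_run (oper_prog A f) (m 0) (load_args enc f m) B t k m'"

text \<open>\<open>reachable A \<Sigma> enc Bd w n m\<close>: some sequence of operations starting with \<open>Init\<close> leads to the
  string \<open>w\<close>, the size parameter \<open>n\<close> and the shared memory \<open>m\<close>, where numbers are bounded by
  \<open>Bd n\<close>. The size parameter starts with 1.\<close>

inductive reachable ::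
  "dyn_alg \<Rightarrow> 'a set \<Rightarrow> ('a \<Rightarrow> nat) \<Rightarrow> (nat \<Rightarrow> nat) \<Rightarrow> 'a list \<Rightarrow> nat \<Rightarrow> memory \<Rightarrow> bool"
  for A \<Sigma> enc Bd where
  init: "init_run A (Bd 1) t k m \<Longrightarrow> reachable A \<Sigma> enc Bd [] 1 m"
| oper: "\<lbrakk>reachable A \<Sigma> enc Bd w n m; valid_oper \<Sigma> w f; oper_run A enc f m (Bd n) t k m'\<rbrakk>
    \<Longrightarrow> reachable A \<Sigma> enc Bd (apply_oper f w) (next_size n (apply_oper f w)) m'"

lemma reachable_size:
  assumes "reachable A \<Sigma> enc Bd w n m"
  shows "n \<ge> 1" and "length w \<le> n" and "w \<noteq> [] \<Longrightarrow> n \<le> 4 * length w"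
proof -
  have "n \<ge> 1 \<and> 2 * length w \<le> n \<and> (w \<noteq> [] \<longrightarrow> n \<le> 4 * length w) \<and> (w = [] \<longrightarrow> n = 1)"
    using assms
  proof induction
    case (oper w n m f t k m')
    have "length (apply_oper f w) = length w \<or> length (apply_oper f w) = Suc (length w)"
      by (cases f) auto
    then show ?case
      using oper.IH oper.hyps(2)
      by (cases f; cases "w = []") (auto simp: next_size_def)
  qed auto
  then show "n \<ge> 1" and "length w \<le> n" and "w \<noteq> [] \<Longrightarrow> n \<le> 4 * length w" by auto
qed

text \<open>The bound \<open>K * n ^ K\<close> on the numbers expresses that memory words have \<open>O(log n)\<close> bits;
  without it, unit-cost multiplication would be unrealistically powerful.\<close>

definition constant_time_dynamic_algorithm ::
  "dyn_alg \<Rightarrow> 'a set \<Rightarrow> ('a \<Rightarrow> nat) \<Rightarrow> 'a list set \<Rightarrow> (nat \<Rightarrow> nat) \<Rightarrow> bool" where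
  "constant_time_dynamic_algorithm A \<Sigma> enc L W \<longleftrightarrow>
     (\<exists>T K. let Bd = (\<lambda>n. K * n ^ K) in
        (\<exists>t k m. init_run A (Bd 1) t k m \<and> t \<le> T \<and> k \<le> W 1) \<and>
        (\<forall>w n m f. reachable A \<Sigma> enc Bd w n m \<longrightarrow> valid_oper \<Sigma> w f \<longrightarrow>
           (\<exists>t k m'. oper_run A enc f m (Bd n) t k m' \<and> t \<le> T \<and> k \<le> W n \<and>
              (\<forall>i j. f = Query i j \<longrightarrow> m' 3 = of_bool (substring w i j \<in> L)))))"

end

theory Submission
  imports Defs
begin

text \<open>Cut the pushdown store into blocks so that a step changes its height by at most one. For all
  positions \<open>i \<le> k \<le> l\<close> maintain where a run starting at \<open>l\<close> has popped the whole stack which the run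
  from \<open>i\<close> leaves at \<open>k\<close>; these \<open>O(n\<^sup>3)\<close> entries compose, because the stack left at \<open>k\<close> splits at every
  earlier position whose stack is still present at \<open>k\<close>. After a change at position \<open>c\<close> every new entry is
  a composition of boundedly many old ones, once it is known which stack symbol is being popped at
  \<open>c\<close>. This symbol is the threshold of a monotone predicate on positions. With \<open>D ^ rd\<close> exceeding the
  length of the string, it is found digit by digit in \<open>rd\<close> rounds with \<open>D\<close> processors per entry, hence
  with \<open>O(n\<^sup>3 \<cdot> n\<^bsup>1/rd\<^esup>)\<close> work. All programs are straight-line, so that all processors run in lockstep
  and the work is the number of processors times the constant length of the program.\<close>

subsection \<open>Straight-line programs\<close>

text \<open>The stack left at \<open>k\<close> can be as high as the word is long, so only its
  effect is stored: a partial map from the position and state at which it starts to be popped to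
  those at which it is gone. Such maps compose along concatenation of stacks; this is the origin of
  the third position \<open>l\<close>. As the machine is realtime, a run has one configuration per
  position, and as a step puts at most one symbol below the top, such a symbol is named by the
  position of the step that pushed it. The obstacle: these entries speak of whole stacks, whereas a
  change interrupts a pop in the middle of a symbol. Once this symbol is known, all symbols above it
  are popped before the change and all below it behind it, where old entries are valid. A run that
  crosses the change and stops at \<open>k\<close> raises the same question for the symbol under way
  at \<open>k\<close>; hence there are two searches. Testing every position for every entry would
  cost a further factor n, which the digits reduce to \<open>n powr (1 / rd)\<close>. There is no
  instruction for roots: \<open>D\<close> is doubled whenever \<open>D ^ rd\<close> becomes too
  small against the length.\<close>

datatype exp = Lit nat | Pid | Op arith exp exp | Cell exp

primrec eval :: "memory \<Rightarrow> nat \<Rightarrow> exp \<Rightarrow> nat" where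
  "eval m p (Lit k) = k"
| "eval m p Pid = p"
| "eval m p (Op f a b) = arith_fun f (eval m p a) (eval m p b)"
| "eval m p (Cell a) = m (eval m p a)"

text \<open>\<open>pram_run\<close> bounds every register at every step, so intermediate results
  count as well: a difference can be small while its operands are large.\<close>

primrec peak :: "memory \<Rightarrow> nat \<Rightarrow> exp \<Rightarrow> nat" where
  "peak m p (Lit k) = k"
| "peak m p Pid = p"
| "peak m p (Op f a b) = max (eval m p (Op f a b)) (max (peak m p a) (peak m p b))"
| "peak m p (Cell a) = max (m (eval m p a)) (peak m p a)"

lemma eval_le_peak: "eval m p e \<le> peak m p e"
  by (cases e) auto

text \<open>Registers from \<open>d\<close> on serve as an evaluation stack, and register 0 keeps
  the processor index. As there is no move instruction, \<open>Pid\<close> copies the index by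
  adding 0.\<close>

primrec compile :: "exp \<Rightarrow> nat \<Rightarrow> instr list" where
  "compile (Lit k) d = [Const d k]"
| "compile Pid d = [Const d 0, Arith Plus d 0 d]"
| "compile (Op f a b) d = compile a d @ compile b (Suc d) @ [Arith f d d (Suc d)]"
| "compile (Cell a) d = compile a d @ [Load d d]"

type_synonym stmt = "exp \<times> exp"

definition compile_stmt :: "stmt \<Rightarrow> instr list" where
  "compile_stmt s = compile (fst s) 1 @ compile (snd s) 2 @ [Store 1 2]"

definition compile_prog :: "stmt list \<Rightarrow> program" where
  "compile_prog ss = concat (map compile_stmt ss)"

text \<open>Addresses and values of all processors refer to the memory before the statement. Under
  \<open>consistent\<close>, the common-write rule, the choice made by \<open>SOME\<close> is
  immaterial.\<close>

definition exec_stmt :: "nat \<Rightarrow> stmt \<Rightarrow> memory \<Rightarrow> memory" where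
  "exec_stmt P s m = (\<lambda>x. if \<exists>p<P. eval m p (fst s) = x
     then eval m (SOME p. p < P \<and> eval m p (fst s) = x) (snd s) else m x)"

definition consistent :: "nat \<Rightarrow> stmt \<Rightarrow> memory \<Rightarrow> bool" where
  "consistent P s m \<longleftrightarrow> (\<forall>p<P. \<forall>p'<P. eval m p (fst s) = eval m p' (fst s) \<longrightarrow>
     eval m p (snd s) = eval m p' (snd s))"

definition exec :: "nat \<Rightarrow> stmt list \<Rightarrow> memory \<Rightarrow> memory" where
  "exec P ss m = fold (exec_stmt P) ss m"

lemma exec_Nil [simp]: "exec P [] m = m"
  and exec_Cons [simp]: "exec P (s # ss) m = exec P ss (exec_stmt P s m)"
  and exec_append: "exec P (ss @ ss') m = exec P ss' (exec P ss m)"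
  by (auto simp: exec_def)

primrec all_consistent :: "nat \<Rightarrow> stmt list \<Rightarrow> memory \<Rightarrow> bool" where
  "all_consistent P [] m \<longleftrightarrow> True"
| "all_consistent P (s # ss) m \<longleftrightarrow> consistent P s m \<and> all_consistent P ss (exec_stmt P s m)"

lemma all_consistent_append:
  "all_consistent P (ss @ ss') m \<longleftrightarrow> all_consistent P ss m \<and> all_consistent P ss' (exec P ss m)"
  by (induction ss arbitrary: m) auto

primrec all_peaks :: "nat \<Rightarrow> nat \<Rightarrow> stmt list \<Rightarrow> memory \<Rightarrow> bool" where
  "all_peaks P B [] m \<longleftrightarrow> True"
| "all_peaks P B (s # ss) m \<longleftrightarrow> (\<forall>p<P. peak m p (fst s) \<le> B \<and> peak m p (snd s) \<le> B) \<and>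
     all_peaks P B ss (exec_stmt P s m)"

section \<open>Compiled programs run in lockstep\<close>

definition lockstep :: "nat \<Rightarrow> nat \<Rightarrow> memory \<Rightarrow> (nat \<Rightarrow> nat \<Rightarrow> nat) \<Rightarrow> pram_config \<Rightarrow> bool" where
  "lockstep P t m rs c \<longleftrightarrow> mem c = m \<and> (\<forall>p<P. procs c p = \<lparr>pc = t, regs = rs p\<rparr>)"

text \<open>All \<open>P\<close> processors have to be active in each step because work is the sum
  of the numbers of active processors; it then equals \<open>P\<close> times the number of
  steps.\<close>

definition steps_ok :: "program \<Rightarrow> nat \<Rightarrow> nat \<Rightarrow> nat \<Rightarrow> pram_config \<Rightarrow> pram_config \<Rightarrow> bool" where
  "steps_ok prog P B n c c' \<longleftrightarrow> c' = (pram_step prog P ^^ n) c \<and>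
     (\<forall>s<n. single_valued (writes prog P ((pram_step prog P ^^ s) c)) \<and>
            active prog P ((pram_step prog P ^^ s) c) = {..<P}) \<and>
     (\<forall>s\<le>n. \<forall>p<P. \<forall>r. regs (procs ((pram_step prog P ^^ s) c) p) r \<le> B)"

lemma steps_ok_trans:
  assumes 1: "steps_ok prog P B n c c'" and 2: "steps_ok prog P B k c' c''"
  shows "steps_ok prog P B (n + k) c c''"
proof -
  let ?f = "pram_step prog P"
  have *: "(?f ^^ s) c = (?f ^^ (s - n)) c'" if "s \<ge> n" for s
  proof -
    have "(?f ^^ s) c = (?f ^^ ((s - n) + n)) c" using that by simp
    also have "\<dots> = (?f ^^ (s - n)) c'"
      using 1 by (simp only: funpow_add o_apply steps_ok_def)
    finally show ?thesis .
  qed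
  show ?thesis
    unfolding steps_ok_def
  proof (intro conjI allI impI)
    show "c'' = (?f ^^ (n + k)) c" using *[of "n + k"] 2 by (simp add: steps_ok_def)
  next
    fix s assume "s < n + k"
    then show "single_valued (writes prog P ((?f ^^ s) c))"
      using 1 2 * by (cases "s < n") (auto simp: steps_ok_def)
    show "active prog P ((?f ^^ s) c) = {..<P}"
      using 1 2 * \<open>s < n + k\<close> by (cases "s < n") (auto simp: steps_ok_def)
  next
    fix s p r assume "s \<le> n + k" "p < P"
    then show "regs (procs ((?f ^^ s) c) p) r \<le> B"
      using 1 2 * by (cases "s < n") (auto simp: steps_ok_def)
  qed
qed

lemma lockstep_active:
  "lockstep P t m rs c \<Longrightarrow> t < length prog \<Longrightarrow> active prog P c = {..<P}"
  by (auto simp: lockstep_def active_def)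

lemma steps_ok_local:
  assumes lock: "lockstep P t m rs c" and t: "t < length prog"
    and no_store: "\<And>a b. prog ! t \<noteq> Store a b"
    and ex: "\<And>p. p < P \<Longrightarrow> exec_instr (prog ! t) m \<lparr>pc = t, regs = rs p\<rparr> = \<lparr>pc = Suc t, regs = rs' p\<rparr>"
    and B: "\<And>p r. p < P \<Longrightarrow> rs p r \<le> B" "\<And>p r. p < P \<Longrightarrow> rs' p r \<le> B"
  shows "steps_ok prog P B 1 c (pram_step prog P c) \<and> lockstep P (Suc t) m rs' (pram_step prog P c)"
proof -
  have act: "active prog P c = {..<P}" using lockstep_active[OF lock t] .
  have w: "writes prog P c = {}"
    using lock no_store unfolding writes_def act by (auto simp: lockstep_def)
  have lock': "lockstep P (Suc t) m rs' (pram_step prog P c)"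
    using lock ex by (auto simp: lockstep_def pram_step_def w act)
  have "steps_ok prog P B 1 c (pram_step prog P c)"
    using lock lock' B act w
    by (auto simp: steps_ok_def less_Suc_eq le_Suc_eq lockstep_def)
  then show ?thesis using lock' by blast
qed

lemma steps_ok_refl:
  "lockstep P t m rs c \<Longrightarrow> (\<And>p r. p < P \<Longrightarrow> rs p r \<le> B) \<Longrightarrow> steps_ok prog P B 0 c c"
  by (auto simp: steps_ok_def lockstep_def)

text \<open>Preserving the registers below \<open>d\<close> carries the induction: it protects the
  left operand in \<open>d\<close> while the right one is computed from \<open>Suc d\<close> on, and
  the processor index in register 0.\<close>

lemma compile_correct:
  assumes "prog = pre @ compile e d @ post" "d \<ge> 1"
    and "lockstep P (length pre) m rs c"
    and "\<And>p. p < P \<Longrightarrow> rs p 0 = p" "\<And>p r. p < P \<Longrightarrow> rs p r \<le> B"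
    and "\<And>p. p < P \<Longrightarrow> peak m p e \<le> B"
  shows "\<exists>c' rs'. steps_ok prog P B (length (compile e d)) c c' \<and>
    lockstep P (length pre + length (compile e d)) m rs' c' \<and>
    (\<forall>p<P. rs' p d = eval m p e \<and> (\<forall>r<d. rs' p r = rs p r) \<and> (\<forall>r. rs' p r \<le> B))"
  using assms
proof (induction e arbitrary: d pre post c rs)
  case (Lit k)
  let ?rs = "\<lambda>p. (rs p)(d := k)"
  have 1: "steps_ok prog P B 1 c (pram_step prog P c) \<and>
    lockstep P (Suc (length pre)) m ?rs (pram_step prog P c)"
    by (rule steps_ok_local[OF Lit(3)]) (use Lit in \<open>auto simp: nth_append\<close>)
  show ?case
  proof (intro exI conjI)
    show "steps_ok prog P B (length (compile (Lit k) d)) c (pram_step prog P c)"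
      using 1 by simp
    show "lockstep P (length pre + length (compile (Lit k) d)) m ?rs (pram_step prog P c)"
      using 1 by simp
  qed (use Lit in auto)
next
  case Pid
  let ?rs = "\<lambda>p. (rs p)(d := 0)" and ?rs' = "\<lambda>p. (rs p)(d := p)"
  have p: "p \<le> B" if "p < P" for p using Pid(6)[OF that] by simp
  have 1: "steps_ok prog P B 1 c (pram_step prog P c) \<and>
    lockstep P (Suc (length pre)) m ?rs (pram_step prog P c)"
    by (rule steps_ok_local[OF Pid(3)]) (use Pid in \<open>auto simp: nth_append\<close>)
  have 2: "steps_ok prog P B 1 (pram_step prog P c) (pram_step prog P (pram_step prog P c)) \<and>
    lockstep P (Suc (Suc (length pre))) m ?rs' (pram_step prog P (pram_step prog P c))"
    by (rule steps_ok_local[OF 1[THEN conjunct2]]) (use Pid p in \<open>auto simp: nth_append\<close>)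
  show ?case
  proof (intro exI conjI)
    show "steps_ok prog P B (length (compile Pid d)) c (pram_step prog P (pram_step prog P c))"
      using steps_ok_trans[OF 1[THEN conjunct1] 2[THEN conjunct1]] by (simp add: numeral_2_eq_2)
    show "lockstep P (length pre + length (compile Pid d)) m ?rs' (pram_step prog P (pram_step prog P c))"
      using 2 by simp
  qed (use Pid p in auto)
next
  case (Op f a b)
  let ?A = "compile a d" and ?B = "compile b (Suc d)"
  have "\<exists>c' rs'. steps_ok prog P B (length ?A) c c' \<and> lockstep P (length pre + length ?A) m rs' c' \<and>
    (\<forall>p<P. rs' p d = eval m p a \<and> (\<forall>r<d. rs' p r = rs p r) \<and> (\<forall>r. rs' p r \<le> B))"
    by (rule Op.IH(1)[where post = "?B @ [Arith f d d (Suc d)] @ post"]) (use Op.prems in auto)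
  then obtain c1 rs1 where 1: "steps_ok prog P B (length ?A) c c1"
    "lockstep P (length pre + length ?A) m rs1 c1"
    "\<forall>p<P. rs1 p d = eval m p a \<and> (\<forall>r<d. rs1 p r = rs p r) \<and> (\<forall>r. rs1 p r \<le> B)" by blast
  have "\<exists>c' rs'. steps_ok prog P B (length ?B) c1 c' \<and>
    lockstep P (length (pre @ ?A) + length ?B) m rs' c' \<and>
    (\<forall>p<P. rs' p (Suc d) = eval m p b \<and> (\<forall>r<Suc d. rs' p r = rs1 p r) \<and> (\<forall>r. rs' p r \<le> B))"
    by (rule Op.IH(2)[where post = "[Arith f d d (Suc d)] @ post"]) (use Op.prems 1 in auto)
  then obtain c2 rs2 where 2: "steps_ok prog P B (length ?B) c1 c2"
    "lockstep P (length (pre @ ?A) + length ?B) m rs2 c2"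
    "\<forall>p<P. rs2 p (Suc d) = eval m p b \<and> (\<forall>r<Suc d. rs2 p r = rs1 p r) \<and> (\<forall>r. rs2 p r \<le> B)"
    by blast
  let ?rs = "\<lambda>p. (rs2 p)(d := eval m p (Op f a b))"
  have 3: "steps_ok prog P B 1 c2 (pram_step prog P c2) \<and>
    lockstep P (Suc (length (pre @ ?A) + length ?B)) m ?rs (pram_step prog P c2)"
    by (rule steps_ok_local[OF 2(2)]) (use Op.prems 1 2 in \<open>auto simp: nth_append\<close>)
  show ?case
  proof (intro exI conjI)
    show "steps_ok prog P B (length (compile (Op f a b) d)) c (pram_step prog P c2)"
      using steps_ok_trans[OF steps_ok_trans[OF 1(1) 2(1)] 3[THEN conjunct1]]
      by (simp add: add.assoc)
    show "lockstep P (length pre + length (compile (Op f a b) d)) m ?rs (pram_step prog P c2)"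
      using 3 by (simp add: add.assoc)
  qed (use Op.prems 1 2 in auto)
next
  case (Cell a)
  let ?A = "compile a d"
  have "\<exists>c' rs'. steps_ok prog P B (length ?A) c c' \<and> lockstep P (length pre + length ?A) m rs' c' \<and>
    (\<forall>p<P. rs' p d = eval m p a \<and> (\<forall>r<d. rs' p r = rs p r) \<and> (\<forall>r. rs' p r \<le> B))"
    by (rule Cell.IH(1)[where post = "[Load d d] @ post"]) (use Cell.prems in auto)
  then obtain c1 rs1 where 1: "steps_ok prog P B (length ?A) c c1"
    "lockstep P (length pre + length ?A) m rs1 c1"
    "\<forall>p<P. rs1 p d = eval m p a \<and> (\<forall>r<d. rs1 p r = rs p r) \<and> (\<forall>r. rs1 p r \<le> B)" by blast
  let ?rs = "\<lambda>p. (rs1 p)(d := m (eval m p a))"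
  have 3: "steps_ok prog P B 1 c1 (pram_step prog P c1) \<and>
    lockstep P (Suc (length pre + length ?A)) m ?rs (pram_step prog P c1)"
    by (rule steps_ok_local[OF 1(2)]) (use Cell.prems 1 in \<open>auto simp: nth_append\<close>)
  show ?case
  proof (intro exI conjI)
    show "steps_ok prog P B (length (compile (Cell a) d)) c (pram_step prog P c1)"
      using steps_ok_trans[OF 1(1) 3[THEN conjunct1]] by simp
    show "lockstep P (length pre + length (compile (Cell a) d)) m ?rs (pram_step prog P c1)"
      using 3 by simp
  qed (use Cell.prems 1 in auto)
qed

lemma steps_ok_store:
  assumes lock: "lockstep P t m rs c" and t: "t < length prog" "prog ! t = Store 1 2"
    and v: "\<And>p. p < P \<Longrightarrow> rs p 1 = eval m p (fst s) \<and> rs p 2 = eval m p (snd s)"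
    and B: "\<And>p r. p < P \<Longrightarrow> rs p r \<le> B" and cons: "consistent P s m"
  shows "steps_ok prog P B 1 c (pram_step prog P c) \<and>
    lockstep P (Suc t) (exec_stmt P s m) rs (pram_step prog P c)"
proof -
  have act: "active prog P c = {..<P}" using lockstep_active[OF lock t(1)] .
  have w: "writes prog P c = {(eval m p (fst s), eval m p (snd s)) | p. p < P}"
  proof -
    have "writes prog P c = {(rs p 1, rs p 2) | p. p < P}"
      using lock t(2) unfolding writes_def act lockstep_def by force
    also have "\<dots> = {(eval m p (fst s), eval m p (snd s)) | p. p < P}"
      using v by (intro Collect_cong) metis
    finally show ?thesis .
  qed
  have sv: "single_valued (writes prog P c)"
  proof (rule single_valuedI)
    fix x y z assume "(x, y) \<in> writes prog P c" "(x, z) \<in> writes prog P c"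
    then obtain p p' where "p < P" "p' < P" "x = eval m p (fst s)" "x = eval m p' (fst s)"
      "y = eval m p (snd s)" "z = eval m p' (snd s)" unfolding w by auto
    then show "y = z" using cons unfolding consistent_def by metis
  qed
  \<comment> \<open>The machine chooses among the values written, \<open>exec_stmt\<close> among the
    writing processors; single-valuedness makes both yield the same value.\<close>
  have "(if \<exists>v. (x, v) \<in> writes prog P c then SOME v. (x, v) \<in> writes prog P c else m x)
    = exec_stmt P s m x" for x
  proof (cases "\<exists>p<P. eval m p (fst s) = x")
    case True
    define p where "p = (SOME p. p < P \<and> eval m p (fst s) = x)"
    have p: "p < P" "eval m p (fst s) = x" unfolding p_def using someI_ex[OF True] by auto
    have "(x, eval m p (snd s)) \<in> writes prog P c" using p by (auto simp: w)
    then have "(SOME v. (x, v) \<in> writes prog P c) = eval m p (snd s)"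
      using sv by (intro some_equality) (auto simp: single_valued_def)
    moreover have "\<exists>v. (x, v) \<in> writes prog P c" using \<open>(x, _) \<in> _\<close> by blast
    ultimately show ?thesis using True by (simp add: exec_stmt_def p_def)
  next
    case False
    then show ?thesis by (auto simp: exec_stmt_def w)
  qed
  then have lock': "lockstep P (Suc t) (exec_stmt P s m) rs (pram_step prog P c)"
    using lock t by (auto simp: lockstep_def pram_step_def act)
  have "steps_ok prog P B 1 c (pram_step prog P c)"
    using lock lock' B act sv
    by (auto simp: steps_ok_def less_Suc_eq le_Suc_eq lockstep_def)
  then show ?thesis using lock' by blast
qed

lemma compile_stmt_correct:
  assumes prog: "prog = pre @ compile_stmt s @ post"
    and lock: "lockstep P (length pre) m rs c"
    and rs: "\<And>p. p < P \<Longrightarrow> rs p 0 = p" "\<And>p r. p < P \<Longrightarrow> rs p r \<le> B"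
    and peak: "\<And>p. p < P \<Longrightarrow> peak m p (fst s) \<le> B \<and> peak m p (snd s) \<le> B"
    and cons: "consistent P s m"
  shows "\<exists>c' rs'. steps_ok prog P B (length (compile_stmt s)) c c' \<and>
    lockstep P (length pre + length (compile_stmt s)) (exec_stmt P s m) rs' c' \<and>
    (\<forall>p<P. rs' p 0 = p \<and> (\<forall>r. rs' p r \<le> B))"
proof -
  let ?A = "compile (fst s) 1" and ?B = "compile (snd s) 2"
  have "\<exists>c' rs'. steps_ok prog P B (length ?A) c c' \<and> lockstep P (length pre + length ?A) m rs' c' \<and>
    (\<forall>p<P. rs' p 1 = eval m p (fst s) \<and> (\<forall>r<1. rs' p r = rs p r) \<and> (\<forall>r. rs' p r \<le> B))"
    by (rule compile_correct[where post = "?B @ [Store 1 2] @ post"])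
      (use assms in \<open>auto simp: compile_stmt_def\<close>)
  then obtain c1 rs1 where 1: "steps_ok prog P B (length ?A) c c1"
    "lockstep P (length pre + length ?A) m rs1 c1"
    "\<forall>p<P. rs1 p 1 = eval m p (fst s) \<and> (\<forall>r<1. rs1 p r = rs p r) \<and> (\<forall>r. rs1 p r \<le> B)" by blast
  have "\<exists>c' rs'. steps_ok prog P B (length ?B) c1 c' \<and>
    lockstep P (length (pre @ ?A) + length ?B) m rs' c' \<and>
    (\<forall>p<P. rs' p 2 = eval m p (snd s) \<and> (\<forall>r<2. rs' p r = rs1 p r) \<and> (\<forall>r. rs' p r \<le> B))"
    by (rule compile_correct[where post = "[Store 1 2] @ post"])
      (use assms 1 in \<open>auto simp: compile_stmt_def\<close>)
  then obtain c2 rs2 where 2: "steps_ok prog P B (length ?B) c1 c2"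
    "lockstep P (length (pre @ ?A) + length ?B) m rs2 c2"
    "\<forall>p<P. rs2 p 2 = eval m p (snd s) \<and> (\<forall>r<2. rs2 p r = rs1 p r) \<and> (\<forall>r. rs2 p r \<le> B)" by blast
  have 3: "steps_ok prog P B 1 c2 (pram_step prog P c2) \<and>
    lockstep P (Suc (length (pre @ ?A) + length ?B)) (exec_stmt P s m) rs2 (pram_step prog P c2)"
    by (rule steps_ok_store[OF 2(2)]) (use assms 1 2 in \<open>auto simp: compile_stmt_def nth_append\<close>)
  show ?thesis
  proof (intro exI conjI)
    show "steps_ok prog P B (length (compile_stmt s)) c (pram_step prog P c2)"
      using steps_ok_trans[OF steps_ok_trans[OF 1(1) 2(1)] 3[THEN conjunct1]]
      by (simp add: compile_stmt_def add.assoc)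
    show "lockstep P (length pre + length (compile_stmt s)) (exec_stmt P s m) rs2 (pram_step prog P c2)"
      using 3 by (simp add: compile_stmt_def add.assoc)
  qed (use 1 2 rs in auto)
qed

lemma compile_prog_steps:
  assumes "prog = pre @ compile_prog ss @ post"
    and "lockstep P (length pre) m rs c"
    and "\<And>p. p < P \<Longrightarrow> rs p 0 = p" "\<And>p r. p < P \<Longrightarrow> rs p r \<le> B"
    and "all_peaks P B ss m" and "all_consistent P ss m"
  shows "\<exists>c' rs'. steps_ok prog P B (length (compile_prog ss)) c c' \<and>
    lockstep P (length pre + length (compile_prog ss)) (exec P ss m) rs' c'"
  using assms
proof (induction ss arbitrary: pre m rs c)
  case Nil
  then show ?case
    using steps_ok_refl[OF Nil(2,4), of prog] by (fastforce simp: compile_prog_def)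
next
  case (Cons s ss)
  have "\<exists>c' rs'. steps_ok prog P B (length (compile_stmt s)) c c' \<and>
    lockstep P (length pre + length (compile_stmt s)) (exec_stmt P s m) rs' c' \<and>
    (\<forall>p<P. rs' p 0 = p \<and> (\<forall>r. rs' p r \<le> B))"
    by (rule compile_stmt_correct[where post = "compile_prog ss @ post" and rs = rs])
      (use Cons.prems in \<open>auto simp: compile_prog_def\<close>)
  then obtain c1 rs1 where 1: "steps_ok prog P B (length (compile_stmt s)) c c1"
    "lockstep P (length (pre @ compile_stmt s)) (exec_stmt P s m) rs1 c1"
    "\<forall>p<P. rs1 p 0 = p \<and> (\<forall>r. rs1 p r \<le> B)" by auto
  have "\<exists>c' rs'. steps_ok prog P B (length (compile_prog ss)) c1 c' \<and>
    lockstep P (length (pre @ compile_stmt s) + length (compile_prog ss))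
      (exec P ss (exec_stmt P s m)) rs' c'"
    by (rule Cons.IH[OF _ 1(2)]) (use Cons.prems 1 in \<open>auto simp: compile_prog_def\<close>)
  then show ?case
    using steps_ok_trans[OF 1(1)] by (simp add: compile_prog_def add.assoc) blast
qed

lemma pram_step_halted: "active prog P c = {} \<Longrightarrow> pram_step prog P c = c"
  by (auto simp: pram_step_def writes_def)

text \<open>\<open>reachable\<close> admits any witnesses of a run, with any \<open>t\<close>,
  \<open>k\<close> and final memory. Halted configurations are fixed points, so all witnesses agree
  on the memory, and an invariant shown for one run holds for all.\<close>

lemma pram_run_mem_unique:
  assumes 1: "pram_run prog P m B t k m'" and 2: "pram_run prog P m B' t' k' m''"
  shows "m' = m''"
proof -
  have halt: "pram_after prog P m (t + j) = pram_after prog P m t"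
    if "active prog P (pram_after prog P m t) = {}" for t j
    using that by (induction j) (auto simp: pram_after_def pram_step_halted)
  have "pram_after prog P m t = pram_after prog P m t'"
    using halt[of t "t' - t"] halt[of t' "t - t'"] 1 2
    by (cases "t \<le> t'") (auto simp: pram_run_def)
  then show ?thesis using 1 2 by (simp add: pram_run_def)
qed

lemma compile_prog_run:
  assumes "P \<le> B" "all_peaks P B ss m" "all_consistent P ss m"
  shows "pram_run (compile_prog ss) P m B (length (compile_prog ss))
    (P * length (compile_prog ss)) (exec P ss m)"
proof -
  let ?prog = "compile_prog ss"
  have "\<exists>c' rs'. steps_ok ?prog P B (length ?prog) (pram_init m) c' \<and>
    lockstep P (length ([]::instr list) + length ?prog) (exec P ss m) rs' c'"
    by (rule compile_prog_steps[where post = "[]" and rs = "\<lambda>p. (\<lambda>_. 0)(0 := p)"])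
      (use assms in \<open>auto simp: lockstep_def pram_init_def\<close>)
  then obtain c' rs' where c': "steps_ok ?prog P B (length ?prog) (pram_init m) c'"
    "lockstep P (length ?prog) (exec P ss m) rs' c'" by auto
  then show ?thesis
    by (auto simp: pram_run_def steps_ok_def pram_after_def lockstep_def active_def)
qed

section \<open>Polynomial bounds on register contents\<close>

lemma power_mono_exp: "(2::nat) \<le> V \<Longrightarrow> a \<le> b \<Longrightarrow> V ^ a \<le> V ^ b"
  by (rule power_increasing) auto

lemma le_power_Suc: "(2::nat) \<le> V \<Longrightarrow> V \<le> V ^ (k + 1)"
  using power_mono_exp[of V 1 "k + 1"] by (simp only: power_one_right)

text \<open>Powers of \<open>V\<close> are closed under the operations of expressions: products add
  exponents, and because of \<open>2 <= V\<close> a constant \<open>k\<close> is below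
  \<open>V ^ k\<close> and a sum costs one more factor.\<close>

lemma peak_bound:
  "\<exists>K. \<forall>m p V. 2 \<le> V \<longrightarrow> p \<le> V \<longrightarrow> (\<forall>x. m x \<le> V) \<longrightarrow> peak m p e \<le> V ^ K"
proof (induction e)
  case (Lit k)
  have "k \<le> V ^ k" if "2 \<le> V" for V :: nat
    using less_exp[of k] power_mono[OF that, of k] by linarith
  then show ?case by (auto intro!: exI[of _ k])
next
  case Pid
  show ?case by (rule exI[of _ 1]) auto
next
  case (Op f a b)
  obtain K L where K: "\<And>m p V. 2 \<le> V \<Longrightarrow> p \<le> V \<Longrightarrow> (\<forall>x. m x \<le> V) \<Longrightarrow> peak m p a \<le> V ^ K"
    and L: "\<And>m p V. 2 \<le> V \<Longrightarrow> p \<le> V \<Longrightarrow> (\<forall>x. m x \<le> V) \<Longrightarrow> peak m p b \<le> V ^ L"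
    using Op by blast
  have "peak m p (Op f a b) \<le> V ^ (K + L + 1)"
    if V: "2 \<le> V" "p \<le> V" "\<forall>x. m x \<le> V" for m p V
  proof -
    have ab: "peak m p a \<le> V ^ K" "peak m p b \<le> V ^ L" using K L V by auto
    have e: "eval m p a \<le> V ^ K" "eval m p b \<le> V ^ L"
      using ab eval_le_peak order_trans by blast+
    have s: "V ^ K \<le> V ^ (K + L)" "V ^ L \<le> V ^ (K + L)" "V ^ (K + L) \<le> V ^ (K + L + 1)"
      by (intro power_mono_exp V; simp)+
    have d: "V ^ (K + L) + V ^ (K + L) \<le> V ^ (K + L + 1)"
    proof -
      have "2 * V ^ (K + L) \<le> V * V ^ (K + L)" by (rule mult_le_mono1[OF V(1)])
      then show ?thesis by (simp only: power_add power_one_right mult_2 mult.commute)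
    qed
    have m: "eval m p a * eval m p b \<le> V ^ (K + L)" using e by (simp add: power_add mult_mono)
    have dv: "eval m p a div eval m p b \<le> eval m p a" by simp
    have "arith_fun f (eval m p a) (eval m p b) \<le> V ^ (K + L + 1)"
    proof (cases f)
      case Plus
      show ?thesis unfolding Plus arith_fun.simps using e s d by linarith
    next
      case Minus
      show ?thesis unfolding Minus arith_fun.simps using e s by linarith
    next
      case Times
      show ?thesis unfolding Times arith_fun.simps using m s by linarith
    next
      case Div
      show ?thesis unfolding Div arith_fun.simps using dv e s by linarith
    qed
    then show ?thesis using ab s unfolding peak.simps eval.simps by (intro max.boundedI) linarith+
  qed
  then show ?case by blast
next
  case (Cell a)
  then obtain K where K: "\<And>m p V. 2 \<le> V \<Longrightarrow> p \<le> V \<Longrightarrow> (\<forall>x. m x \<le> V) \<Longrightarrow> peak m p a \<le> V ^ K"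
    by blast
  have "peak m p (Cell a) \<le> V ^ (K + 1)" if V: "2 \<le> V" "p \<le> V" "\<forall>x. m x \<le> V" for m p V
  proof -
    have "V ^ K \<le> V ^ (K + 1)" "V \<le> V ^ (K + 1)"
      by (intro power_mono_exp le_power_Suc V(1); simp)+
    then show ?thesis using K[OF V] V(3) unfolding peak.simps by (intro max.boundedI) (auto intro: order_trans)
  qed
  then show ?case by blast
qed

text \<open>After a statement the memory is bounded by \<open>V ^ (J + 1)\<close>, and the bound for
  the remaining statements is applied with this number in place of \<open>V\<close>. Exponents
  multiply along the program, whose length is fixed.\<close>

lemma all_peaks_bound:
  "\<exists>K. \<forall>P m V. 2 \<le> V \<longrightarrow> P \<le> V \<longrightarrow> (\<forall>x. m x \<le> V) \<longrightarrow> all_peaks P (V ^ K) ss m"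
proof (induction ss)
  case Nil
  then show ?case by auto
next
  case (Cons s ss)
  obtain K where K: "\<And>m P V. 2 \<le> V \<Longrightarrow> P \<le> V \<Longrightarrow> (\<forall>x. m x \<le> V) \<Longrightarrow> all_peaks P (V ^ K) ss m"
    using Cons by blast
  obtain L where L: "\<And>m p V. 2 \<le> V \<Longrightarrow> p \<le> V \<Longrightarrow> (\<forall>x. m x \<le> V) \<Longrightarrow> peak m p (fst s) \<le> V ^ L"
    using peak_bound by blast
  obtain J where J: "\<And>m p V. 2 \<le> V \<Longrightarrow> p \<le> V \<Longrightarrow> (\<forall>x. m x \<le> V) \<Longrightarrow> peak m p (snd s) \<le> V ^ J"
    using peak_bound by blast
  have mono: "all_peaks P B ss m \<Longrightarrow> B \<le> B' \<Longrightarrow> all_peaks P B' ss m" for P B B' m ss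
    by (induction ss arbitrary: m) (auto intro: order_trans)
  have "all_peaks P (V ^ (L + (J + 1) * (K + 1))) (s # ss) m"
    if V: "2 \<le> V" "P \<le> V" "\<forall>x. m x \<le> V" for P m V
  proof -
    have le: "V ^ L \<le> V ^ (L + (J + 1) * (K + 1))" "V ^ J \<le> V ^ (L + (J + 1) * (K + 1))"
      "V ^ ((J + 1) * K) \<le> V ^ (L + (J + 1) * (K + 1))" "V \<le> V ^ (J + 1)" "V ^ J \<le> V ^ (J + 1)"
      by (intro power_mono_exp le_power_Suc V(1); simp add: algebra_simps)+
    have "exec_stmt P s m x \<le> V ^ (J + 1)" for x
    proof (cases "\<exists>p<P. eval m p (fst s) = x")
      case True
      define p where "p = (SOME p. p < P \<and> eval m p (fst s) = x)"
      have "p < P" unfolding p_def using someI_ex[OF True] by auto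
      then have "eval m p (snd s) \<le> V ^ J"
        using J[of V p m] V eval_le_peak[of m p "snd s"] by (meson le_trans less_imp_le)
      then show ?thesis using True le(5) by (simp add: exec_stmt_def p_def[symmetric] del: power_Suc)
    next
      case False
      then have "exec_stmt P s m x = m x" unfolding exec_stmt_def by (rule if_not_P)
      then show ?thesis using V(3)[rule_format, of x] le(4) by linarith
    qed
    then have "all_peaks P ((V ^ (J + 1)) ^ K) ss (exec_stmt P s m)"
      by (intro K) (use le(4) V in \<open>auto simp del: power_Suc intro: order_trans\<close>)
    then have "all_peaks P (V ^ (L + (J + 1) * (K + 1))) ss (exec_stmt P s m)"
      using mono le(3) by (simp only: power_mult[symmetric])
    moreover have "peak m p (fst s) \<le> V ^ (L + (J + 1) * (K + 1))"
      "peak m p (snd s) \<le> V ^ (L + (J + 1) * (K + 1))" if "p < P" for p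
      using L[of V p m] J[of V p m] that V le(1,2) by (auto intro: order_trans)
    ultimately show ?thesis by simp
  qed
  then show ?case by blast
qed

text \<open>Used for one operation at a time, since over a sequence of operations the exponents
  would multiply. From one operation to the next \<open>inv\<close> keeps the memory small, by
  knowing what the cells contain.\<close>

lemma compile_prog_run_poly:
  "\<exists>K. \<forall>P m V. 2 \<le> V \<longrightarrow> P \<le> V \<longrightarrow> (\<forall>x. m x \<le> V) \<longrightarrow> all_consistent P ss m \<longrightarrow>
     pram_run (compile_prog ss) P m (V ^ K) (length (compile_prog ss))
       (P * length (compile_prog ss)) (exec P ss m)"
proof -
  obtain K where K: "\<And>m P V. 2 \<le> V \<Longrightarrow> P \<le> V \<Longrightarrow> (\<forall>x. m x \<le> V) \<Longrightarrow> all_peaks P (V ^ K) ss m"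
    using all_peaks_bound by blast
  have mono: "all_peaks P B ss m \<Longrightarrow> B \<le> B' \<Longrightarrow> all_peaks P B' ss m" for P B B' m ss
    by (induction ss arbitrary: m) (auto intro: order_trans)
  have "pram_run (compile_prog ss) P m (V ^ (K + 1)) (length (compile_prog ss))
       (P * length (compile_prog ss)) (exec P ss m)"
    if V: "2 \<le> V" "P \<le> V" "\<forall>x. m x \<le> V" and c: "all_consistent P ss m" for P m V
  proof (rule compile_prog_run[OF _ _ c])
    have "V \<le> V ^ (K + 1)" "V ^ K \<le> V ^ (K + 1)"
      by (intro power_mono_exp le_power_Suc V(1); simp)+
    then show "P \<le> V ^ (K + 1)" "all_peaks P (V ^ (K + 1)) ss m"
      using V(2) mono[OF K[OF V]] by (auto simp del: power_Suc)
  qed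
  then show ?thesis by blast
qed

subsection \<open>Stack machines\<close>

primrec runs :: "('l \<Rightarrow> 's \<Rightarrow> 'g \<Rightarrow> ('s \<times> 'g list) option) \<Rightarrow> 'l list \<Rightarrow> 's \<times> 'g list \<Rightarrow>
    ('s \<times> 'g list) option" where
  "runs stp [] C = Some C"
| "runs stp (a # u) C = (case snd C of [] \<Rightarrow> None
     | g # \<gamma> \<Rightarrow> (case stp a (fst C) g of None \<Rightarrow> None
        | Some (q', \<alpha>) \<Rightarrow> runs stp u (q', \<alpha> @ \<gamma>)))"

lemma runs_append: "runs stp (u @ v) C = Option.bind (runs stp u C) (runs stp v)"
  by (induction u arbitrary: C) (auto split: list.splits option.splits)

lemma runs_Nil_stack: "runs stp u (q, []) = Some C \<longleftrightarrow> u = [] \<and> C = (q, [])"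
  by (cases u) auto

lemma runs_under:
  "runs stp u (q, \<gamma>) = Some (q', \<gamma>') \<Longrightarrow> runs stp u (q, \<gamma> @ \<delta>) = Some (q', \<gamma>' @ \<delta>)"
proof (induction u arbitrary: q \<gamma>)
  case (Cons a u)
  then obtain g \<gamma>0 where g: "\<gamma> = g # \<gamma>0" by (cases \<gamma>) auto
  then obtain q1 \<alpha> where s: "stp a q g = Some (q1, \<alpha>)" using Cons.prems by (auto split: option.splits)
  then show ?case using Cons.IH[of q1 "\<alpha> @ \<gamma>0"] Cons.prems g by simp
qed auto

text \<open>The cases exclude each other: if \<open>\<gamma>\<close> is used up exactly at the end
  of \<open>u\<close>, this counts as \<open>below\<close> with empty \<open>u2\<close>.\<close>

lemma runs_append_cases:
  assumes "runs stp u (q, \<gamma> @ \<delta>) = Some (q', \<eta>)"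
  obtains (inside) \<gamma>' where "runs stp u (q, \<gamma>) = Some (q', \<gamma>')" "\<gamma>' \<noteq> []" "\<eta> = \<gamma>' @ \<delta>"
  | (below) u1 u2 q1 where "u = u1 @ u2" "runs stp u1 (q, \<gamma>) = Some (q1, [])"
      "runs stp u2 (q1, \<delta>) = Some (q', \<eta>)"
  using assms
proof (induction u arbitrary: q \<gamma> thesis)
  case Nil
  then show ?case by (cases \<gamma>) auto
next
  case (Cons a u)
  show ?case
  proof (cases \<gamma>)
    case Nil
    then show ?thesis using Cons.prems(2)[of "[]" "a # u" q] Cons.prems(3) by simp
  next
    case (Cons g \<gamma>0)
    then obtain q1 \<alpha> where s: "stp a q g = Some (q1, \<alpha>)"
      using Cons.prems by (auto split: option.splits)
    have r: "runs stp u (q1, (\<alpha> @ \<gamma>0) @ \<delta>) = Some (q', \<eta>)" using Cons.prems(3) Cons s by simp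
    show ?thesis
    proof (rule Cons.IH[OF _ _ r])
      fix \<gamma>' assume "runs stp u (q1, \<alpha> @ \<gamma>0) = Some (q', \<gamma>')" "\<gamma>' \<noteq> []" "\<eta> = \<gamma>' @ \<delta>"
      then show thesis using Cons.prems(1)[of \<gamma>'] Cons s by simp
    next
      fix u1 u2 q2 assume "u = u1 @ u2" "runs stp u1 (q1, \<alpha> @ \<gamma>0) = Some (q2, [])"
        "runs stp u2 (q2, \<delta>) = Some (q', \<eta>)"
      then show thesis using Cons.prems(2)[of "a # u1" u2 q2] Cons s by simp
    qed
  qed
qed

lemma drop_take_split:
  assumes "l \<le> j" "j \<le> e"
  shows "drop l (take e w) = drop l (take j w) @ drop j (take e w)"
proof -
  have "take e w = take j w @ take (e - j) (drop j w)"
    using assms take_add[of j "e - j" w] by simp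
  then have "drop l (take e w) = drop l (take j w) @ drop (l - min (length w) j) (take (e - j) (drop j w))"
    by (metis drop_append length_take)
  moreover have "drop (l - min (length w) j) (take (e - j) (drop j w)) = drop j (take e w)"
    using assms by (cases "j \<le> length w") (auto simp: drop_take)
  ultimately show ?thesis by simp
qed

lemma drop_take_Suc: "e < length w \<Longrightarrow> drop e (take (Suc e) w) = [w ! e]"
  by (simp add: take_Suc_conv_app_nth)

text \<open>If \<open>h\<close> is the stack height along a run, \<open>anc h k a\<close> means that the stack below the top symbol
  at position \<open>a\<close> is still present, untouched, at position \<open>k\<close>.\<close>

definition anc :: "(nat \<Rightarrow> nat) \<Rightarrow> nat \<Rightarrow> nat \<Rightarrow> bool" where
  "anc h k a \<longleftrightarrow> (\<forall>j. a \<le> j \<and> j \<le> k \<longrightarrow> h a \<le> h j)"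

definition lastanc :: "(nat \<Rightarrow> nat) \<Rightarrow> nat \<Rightarrow> nat \<Rightarrow> nat \<Rightarrow> nat" where
  "lastanc h i k x = Max {a. i \<le> a \<and> a \<le> x \<and> anc h k a}"

lemma anc_refl [simp]: "anc h k k"
  by (auto simp: anc_def dest: le_antisym)

lemma anc_trans: "anc h k b \<Longrightarrow> anc h b a \<Longrightarrow> a \<le> b \<Longrightarrow> anc h k a"
  unfolding anc_def by (metis le_trans nat_le_linear order_refl)

lemma anc_mono: "anc h k a \<Longrightarrow> b \<le> k \<Longrightarrow> anc h b a"
  unfolding anc_def by auto

lemma lastanc_eqI:
  assumes "i \<le> a" "a \<le> x" "anc h k a" "\<And>b. a < b \<Longrightarrow> b \<le> x \<Longrightarrow> \<not> anc h k b"
  shows "lastanc h i k x = a"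
  unfolding lastanc_def by (rule Max_eqI) (use assms not_le in auto)

lemma lastanc_props:
  assumes "anc h k i" "i \<le> x"
  shows "i \<le> lastanc h i k x" "lastanc h i k x \<le> x" "anc h k (lastanc h i k x)"
    "\<And>a. i \<le> a \<Longrightarrow> a \<le> x \<Longrightarrow> anc h k a \<Longrightarrow> a \<le> lastanc h i k x"
proof -
  let ?A = "{a. i \<le> a \<and> a \<le> x \<and> anc h k a}"
  have f: "finite ?A" by (rule finite_subset[of _ "{..x}"]) auto
  have "i \<in> ?A" using assms by auto
  then have "Max ?A \<in> ?A" using f Max_in by blast
  then show "i \<le> lastanc h i k x" "lastanc h i k x \<le> x" "anc h k (lastanc h i k x)"
    unfolding lastanc_def by auto
  show "a \<le> lastanc h i k x" if "i \<le> a" "a \<le> x" "anc h k a" for a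
    unfolding lastanc_def using f that by (intro Max_ge) auto
qed

lemma lastanc_self: "anc h k x \<Longrightarrow> i \<le> x \<Longrightarrow> lastanc h i k x = x"
  by (rule lastanc_eqI) auto

lemma lastanc_cong:
  assumes "\<And>j. i \<le> j \<Longrightarrow> j \<le> k \<Longrightarrow> h j = h' j" "x \<le> k"
  shows "lastanc h i k x = lastanc h' i k x"
proof -
  have "i \<le> a \<and> a \<le> x \<and> anc h k a \<longleftrightarrow> i \<le> a \<and> a \<le> x \<and> anc h' k a" for a
    using assms by (auto simp: anc_def)
  then show ?thesis by (simp add: lastanc_def)
qed

text \<open>No position strictly between \<open>a\<close> and \<open>P\<close> is an ancestor of
  \<open>k\<close>, as the height at \<open>P\<close> is below its own. Up to \<open>a\<close>, the
  ancestors of \<open>k\<close> are those of \<open>a\<close>, because \<open>a\<close> is an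
  ancestor of \<open>P\<close> and \<open>P\<close> one of \<open>k\<close>.\<close>

lemma lastanc_glue_below:
  assumes "anc h k i" "i \<le> a" "a < P" "P \<le> k" "anc h k P" "anc h P a" "x < P" "i \<le> x"
    and above: "\<And>j. a < j \<Longrightarrow> j < P \<Longrightarrow> h P < h j"
  shows "lastanc h i k x = lastanc h i a (min x a)"
proof (rule lastanc_eqI)
  have ai: "anc h a i" using assms anc_mono[of h k i a] by auto
  have "i \<le> min x a" using assms by simp
  note L = lastanc_props[OF ai this]
  show "i \<le> lastanc h i a (min x a)" "lastanc h i a (min x a) \<le> x"
    using L(1,2) assms by auto
  have "anc h a (lastanc h i a (min x a))" "lastanc h i a (min x a) \<le> a" using L(2,3) assms by auto
  then show "anc h k (lastanc h i a (min x a))"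
    using assms anc_trans by (meson le_trans less_imp_le)
  fix b assume b: "lastanc h i a (min x a) < b" "b \<le> x"
  show "\<not> anc h k b"
  proof
    assume n: "anc h k b"
    show False
    proof (cases "b \<le> a")
      case True
      then have "anc h a b" using n anc_mono assms by (meson le_trans less_imp_le)
      then have "b \<le> lastanc h i a (min x a)"
        using L(1) L(4)[of b] b True assms by auto
      then show False using b by simp
    next
      case False
      then have "h P < h b" using above[of b] b assms by auto
      moreover have "h b \<le> h P" using n b assms by (auto simp: anc_def)
      ultimately show False by simp
    qed
  qed
qed

lemma lastanc_glue_above:
  assumes "anc h k i" "i \<le> P" "anc h k P" "P \<le> x" "x \<le> k"
  shows "lastanc h i k x = lastanc h P k x"
proof -
  note L = lastanc_props[OF assms(3,4)]
  show ?thesis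
  proof (rule lastanc_eqI)
    show "i \<le> lastanc h P k x" using L(1) assms(2) by simp
    show "\<not> anc h k b" if "lastanc h P k x < b" "b \<le> x" for b
      using L(1) L(4)[of b] that by auto
  qed (use L in auto)
qed

text \<open>One bound for states and stack symbols lets \<open>opc\<close> code pairs of state and
  symbol and pairs of position and state in the same radix.\<close>

locale stack_machine =
  fixes stp :: "nat \<Rightarrow> nat \<Rightarrow> nat \<Rightarrow> (nat \<times> nat list) option" and cap :: nat
  assumes stp_length: "stp a q g = Some (q', \<alpha>) \<Longrightarrow> length \<alpha> \<le> 2"
    and stp_range: "stp a q g = Some (q', \<alpha>) \<Longrightarrow> q' < cap \<and> set \<alpha> \<subseteq> {..<cap}"
begin

text \<open>Positions are the gaps between letters, numbered from 0 to \<open>length w\<close>; the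
  letter read from gap \<open>e\<close> to gap \<open>Suc e\<close> is \<open>w ! e\<close>.\<close>

definition run :: "nat list \<Rightarrow> nat \<Rightarrow> nat \<Rightarrow> nat \<times> nat list \<Rightarrow> (nat \<times> nat list) option" where
  "run w l e = runs stp (drop l (take e w))"

lemma run_refl [simp]: "run w l l C = Some C"
  by (simp add: run_def)

lemma run_split: "l \<le> j \<Longrightarrow> j \<le> e \<Longrightarrow> run w l e C = Option.bind (run w l j C) (run w j e)"
  by (simp add: run_def drop_take_split[of l j e] runs_append)

lemma run_trans: "l \<le> j \<Longrightarrow> j \<le> e \<Longrightarrow> run w l j C = Some C' \<Longrightarrow> run w l e C = run w j e C'"
  by (simp add: run_split[of l j e])

lemma run_Suc: "e < length w \<Longrightarrow> run w e (Suc e) C = runs stp [w ! e] C"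
  unfolding run_def by (subst drop_take_Suc) auto

lemma run_Nil_stack: "run w l e (q, []) = Some C \<Longrightarrow> C = (q, []) \<and> (e \<le> length w \<longrightarrow> e \<le> l)"
  by (auto simp: run_def runs_Nil_stack)

lemma run_under: "run w l e (q, \<gamma>) = Some (q', \<gamma>') \<Longrightarrow> run w l e (q, \<gamma> @ \<delta>) = Some (q', \<gamma>' @ \<delta>)"
  unfolding run_def by (rule runs_under)

lemma run_append_cases:
  assumes "run w l e (q, \<gamma> @ \<delta>) = Some (q', \<eta>)" "l \<le> e" "e \<le> length w"
  obtains (inside) \<gamma>' where "run w l e (q, \<gamma>) = Some (q', \<gamma>')" "\<gamma>' \<noteq> []" "\<eta> = \<gamma>' @ \<delta>"
  | (below) j q1 where "l \<le> j" "j \<le> e" "run w l j (q, \<gamma>) = Some (q1, [])"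
      "run w j e (q1, \<delta>) = Some (q', \<eta>)"
  using assms(1) unfolding run_def
proof (cases rule: runs_append_cases)
  case (below u1 u2 q1)
  define j where "j = l + length u1"
  have len: "e - l = length u1 + length u2"
    using arg_cong[OF below(1), of length] assms by simp
  have j: "l \<le> j" "j \<le> e" using len assms by (auto simp: j_def)
  have "u1 @ u2 = drop l (take j w) @ drop j (take e w)"
    using below(1) drop_take_split[OF j, of w] by simp
  moreover have "length u1 = length (drop l (take j w))" using j assms by (simp add: j_def)
  ultimately have "u1 = drop l (take j w)" "u2 = drop j (take e w)" by auto
  then show ?thesis using that(2)[OF j] below by (simp add: run_def)
qed (use that(1) in \<open>auto simp: run_def\<close>)

section \<open>Popping a stack completely\<close>

definition popped :: "nat list \<Rightarrow> nat \<Rightarrow> nat \<Rightarrow> nat list \<Rightarrow> nat \<Rightarrow> nat \<Rightarrow> bool" where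
  "popped w l q \<gamma> l' q' \<longleftrightarrow> l \<le> l' \<and> l' \<le> length w \<and> run w l l' (q, \<gamma>) = Some (q', [])"

lemma popped_run:
  assumes "popped w l q \<gamma> l' q'" "l' \<le> e"
  shows "run w l e (q, \<gamma> @ \<delta>) = run w l' e (q', \<delta>)"
  using assms run_under[of w l l' q \<gamma> q' "[]" \<delta>]
  by (auto simp: popped_def intro: run_trans)

text \<open>The machine cannot move on an empty stack, so there is at most one position at which a
  run has an empty stack.\<close>

lemma popped_unique:
  assumes 1: "popped w l q \<gamma> l1 q1" and 2: "popped w l q \<gamma> l2 q2"
  shows "l1 = l2 \<and> q1 = q2"
proof -
  have *: "l2 = l1 \<and> q2 = q1" if "l1 \<le> l2" "popped w l q \<gamma> l1 q1" "popped w l q \<gamma> l2 q2" for l1 l2 q1 q2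
  proof -
    have "run w l1 l2 (q1, []) = Some (q2, [])" "l2 \<le> length w"
      using popped_run[OF that(2,1), of "[]"] that(3) by (simp_all add: popped_def)
    from run_Nil_stack[OF this(1)] this(2) show ?thesis using that(1) by simp
  qed
  show ?thesis using *[OF _ 1 2] *[OF _ 2 1] by (cases "l1 \<le> l2") auto
qed

definition pp :: "nat list \<Rightarrow> nat \<Rightarrow> nat \<Rightarrow> nat list \<Rightarrow> (nat \<times> nat) option" where
  "pp w l q \<gamma> = (if \<exists>l' q'. popped w l q \<gamma> l' q'
     then Some (SOME x. popped w l q \<gamma> (fst x) (snd x)) else None)"

lemma pp_eq_Some: "pp w l q \<gamma> = Some (l', q') \<longleftrightarrow> popped w l q \<gamma> l' q'"
proof
  assume a: "popped w l q \<gamma> l' q'"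
  have "(SOME x. popped w l q \<gamma> (fst x) (snd x)) = (l', q')"
  proof (rule some_equality)
    show "x = (l', q')" if "popped w l q \<gamma> (fst x) (snd x)" for x
      using popped_unique[OF a that] by (simp add: prod_eq_iff)
  qed (use a in simp)
  then show "pp w l q \<gamma> = Some (l', q')" using a by (auto simp: pp_def)
next
  assume a: "pp w l q \<gamma> = Some (l', q')"
  then have "\<exists>x. popped w l q \<gamma> (fst x) (snd x)" by (auto simp: pp_def split: if_splits)
  then have "popped w l q \<gamma> (fst (SOME x. popped w l q \<gamma> (fst x) (snd x)))
    (snd (SOME x. popped w l q \<gamma> (fst x) (snd x)))" by (rule someI_ex)
  then show "popped w l q \<gamma> l' q'" using a by (auto simp: pp_def split: if_splits)
qed

lemma pp_Nil [simp]: "l \<le> length w \<Longrightarrow> pp w l q [] = Some (l, q)"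
  by (simp add: pp_eq_Some popped_def)

text \<open>The symbols below see nothing of a pop but the position and state where it ends. Hence
  pops compose as partial maps, and this is how old table entries are combined into new
  ones.\<close>

lemma pp_append: "pp w l q (\<gamma> @ \<delta>) = Option.bind (pp w l q \<gamma>) (\<lambda>(l', q'). pp w l' q' \<delta>)"
proof -
  have "popped w l q (\<gamma> @ \<delta>) l2 q2 \<longleftrightarrow> (\<exists>l1 q1. popped w l q \<gamma> l1 q1 \<and> popped w l1 q1 \<delta> l2 q2)" for l2 q2
  proof
    assume a: "popped w l q (\<gamma> @ \<delta>) l2 q2"
    then have "run w l l2 (q, \<gamma> @ \<delta>) = Some (q2, [])" "l \<le> l2" "l2 \<le> length w"
      by (auto simp: popped_def)
    then show "\<exists>l1 q1. popped w l q \<gamma> l1 q1 \<and> popped w l1 q1 \<delta> l2 q2"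
    proof (cases rule: run_append_cases)
      case (below j q1)
      then show ?thesis using a by (intro exI[of _ j] exI[of _ q1]) (auto simp: popped_def)
    qed auto
  next
    assume "\<exists>l1 q1. popped w l q \<gamma> l1 q1 \<and> popped w l1 q1 \<delta> l2 q2"
    then obtain l1 q1 where 1: "popped w l q \<gamma> l1 q1" "popped w l1 q1 \<delta> l2 q2" by blast
    then show "popped w l q (\<gamma> @ \<delta>) l2 q2"
      using popped_run[OF 1(1), of l2 \<delta>] by (auto simp: popped_def)
  qed
  then have "pp w l q (\<gamma> @ \<delta>) = Some (l2, q2) \<longleftrightarrow>
      Option.bind (pp w l q \<gamma>) (\<lambda>(l', q'). pp w l' q' \<delta>) = Some (l2, q2)" for l2 q2
    by (simp add: bind_eq_Some_conv pp_eq_Some)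
  then show ?thesis by (metis not_None_eq surj_pair)
qed

text \<open>The surface configuration at \<open>k\<close>: state and top symbol. It is
  \<open>None\<close> when the run is stuck, but also when its stack is empty at \<open>k\<close>,
  so \<open>cf\<close> is defined exactly if a run survives with a nonempty stack.\<close>

definition cf :: "nat list \<Rightarrow> nat \<Rightarrow> nat \<Rightarrow> nat \<Rightarrow> nat \<Rightarrow> (nat \<times> nat) option" where
  "cf w i q g k = (case run w i k (q, [g]) of Some (q', g' # R) \<Rightarrow> Some (q', g') | _ \<Rightarrow> None)"

definition rest :: "nat list \<Rightarrow> nat \<Rightarrow> nat \<Rightarrow> nat \<Rightarrow> nat \<Rightarrow> nat list" where
  "rest w i q g k = (case run w i k (q, [g]) of Some (q', g' # R) \<Rightarrow> R | _ \<Rightarrow> [])"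

definition ht :: "nat list \<Rightarrow> nat \<Rightarrow> nat \<Rightarrow> nat \<Rightarrow> nat \<Rightarrow> nat" where
  "ht w i q g k = (case run w i k (q, [g]) of Some (q', \<gamma>) \<Rightarrow> length \<gamma> | _ \<Rightarrow> 0)"

lemma cf_eq_Some: "cf w i q g k = Some (q', g') \<longleftrightarrow> run w i k (q, [g]) = Some (q', g' # rest w i q g k)"
  by (auto simp: cf_def rest_def split: option.splits list.splits)

lemma run_eq_SomeD:
  "run w i k (q, [g]) = Some (q', g' # R) \<Longrightarrow>
   cf w i q g k = Some (q', g') \<and> rest w i q g k = R \<and> ht w i q g k = Suc (length R)"
  by (auto simp: cf_def rest_def ht_def)

lemma cf_refl [simp]: "cf w i q g i = Some (q, g)" and rest_refl [simp]: "rest w i q g i = []"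
  and ht_refl [simp]: "ht w i q g i = 1"
  using run_eq_SomeD[of w i i q g q g "[]"] by auto

lemma cf_ht: "cf w i q g k = Some (q', g') \<Longrightarrow> ht w i q g k = Suc (length (rest w i q g k))"
  by (auto simp: cf_eq_Some ht_def)

lemma cf_alive:
  assumes "cf w i q g k = Some x" "i \<le> j" "j \<le> k"
  obtains q' g' where "cf w i q g j = Some (q', g')" "run w i j (q, [g]) = Some (q', g' # rest w i q g j)"
proof -
  obtain q1 g1 where r: "run w i k (q, [g]) = Some (q1, g1 # rest w i q g k)"
    using assms(1) by (cases x) (auto simp: cf_eq_Some)
  then obtain C where C: "run w i j (q, [g]) = Some C" "run w j k C = Some (q1, g1 # rest w i q g k)"
    using run_split[OF assms(2,3), of w "(q, [g])"] by (auto simp: bind_eq_Some_conv)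
  obtain q' \<gamma> where "C = (q', \<gamma>)" by (cases C)
  moreover have "\<gamma> \<noteq> []" using C calculation run_Nil_stack by fastforce
  ultimately show ?thesis using that C by (cases \<gamma>) (auto dest: run_eq_SomeD)
qed

lemma cf_alive_ex:
  "cf w i q g k = Some x \<Longrightarrow> i \<le> j \<Longrightarrow> j \<le> k \<Longrightarrow> \<exists>q' g'. cf w i q g j = Some (q', g')"
  by (erule cf_alive) auto

lemma ht_pos: "cf w i q g k = Some x \<Longrightarrow> i \<le> j \<Longrightarrow> j \<le> k \<Longrightarrow> 1 \<le> ht w i q g j"
  by (erule cf_alive) (auto dest: run_eq_SomeD)

lemma anc_start: "cf w i q g k = Some x \<Longrightarrow> anc (ht w i q g) k i"
  using ht_pos unfolding anc_def by auto

lemma cf_segment: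
  assumes "cf w i q g a = Some (qa, ga)" "i \<le> a" "a \<le> k" "cf w a qa ga k = Some (qk, gk)"
  shows "cf w i q g k = Some (qk, gk)" "rest w i q g k = rest w a qa ga k @ rest w i q g a"
    "\<And>j. a \<le> j \<Longrightarrow> j \<le> k \<Longrightarrow> ht w i q g j = ht w a qa ga j + length (rest w i q g a)"
proof -
  have *: "run w i j (q, [g]) = Some (q1, \<gamma> @ rest w i q g a)"
    if "a \<le> j" "run w a j (qa, [ga]) = Some (q1, \<gamma>)" for j q1 \<gamma>
    using assms(1) run_trans[OF assms(2) that(1), of w "(q, [g])"]
      run_under[OF that(2), of "rest w i q g a"] by (simp add: cf_eq_Some)
  have "run w i k (q, [g]) = Some (qk, gk # rest w a qa ga k @ rest w i q g a)"
    using *[OF assms(3)] assms(4) by (simp add: cf_eq_Some)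
  then show "cf w i q g k = Some (qk, gk)" "rest w i q g k = rest w a qa ga k @ rest w i q g a"
    by (auto dest: run_eq_SomeD)
  fix j assume j: "a \<le> j" "j \<le> k"
  obtain q1 g1 where 1: "run w a j (qa, [ga]) = Some (q1, g1 # rest w a qa ga j)"
    using cf_alive[OF assms(4) j] by blast
  show "ht w i q g j = ht w a qa ga j + length (rest w i q g a)"
    using *[OF j(1) 1] 1 by (auto simp: ht_def)
qed

text \<open>Once everything above \<open>rest w i q g a\<close> were gone, the height would be below
  that at \<open>a\<close>, which an ancestor forbids. So the run from \<open>a\<close> to
  \<open>k\<close> never sees what lies below the symbol on top at \<open>a\<close>.\<close>

lemma cf_segment_anc:
  assumes "cf w i q g k = Some (qk, gk)" "i \<le> a" "a \<le> k" "k \<le> length w" "anc (ht w i q g) k a"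
    and "cf w i q g a = Some (qa, ga)"
  shows "cf w a qa ga k = Some (qk, gk)" "rest w i q g k = rest w a qa ga k @ rest w i q g a"
proof -
  have "run w a k (qa, [ga] @ rest w i q g a) = Some (qk, gk # rest w i q g k)"
    using assms(1,6) run_trans[OF assms(2,3), of w "(q, [g])"] by (simp add: cf_eq_Some)
  from this assms(3,4) show c: "cf w a qa ga k = Some (qk, gk)"
  proof (cases rule: run_append_cases)
    case (inside \<gamma>')
    then show ?thesis by (cases \<gamma>') (auto dest: run_eq_SomeD)
  next
    case (below j q1)
    have "run w i j (q, [g]) = Some (q1, rest w i q g a)"
      using assms(6) below(3) run_trans[OF assms(2) below(1), of w "(q, [g])"]
        run_under[of w a j qa "[ga]" q1 "[]" "rest w i q g a"] by (simp add: cf_eq_Some)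
    then have "ht w i q g j < ht w i q g a" using cf_ht[OF assms(6)] by (simp add: ht_def)
    then show ?thesis using assms(5) below by (auto simp: anc_def)
  qed
  show "rest w i q g k = rest w a qa ga k @ rest w i q g a"
    using cf_segment(2)[OF assms(6,2,3) c] .
qed

lemma ht_Suc:
  assumes "cf w i q g j = Some (q1, g1)" "i \<le> j" "j < length w" "cf w i q g (Suc j) = Some (q2, g2)"
  obtains \<alpha> where "stp (w ! j) q1 g1 = Some (q2, \<alpha>)"
    "g2 # rest w i q g (Suc j) = \<alpha> @ rest w i q g j" "ht w i q g (Suc j) + 1 = ht w i q g j + length \<alpha>"
proof -
  have "run w i (Suc j) (q, [g]) = runs stp [w ! j] (q1, g1 # rest w i q g j)"
    using assms run_trans[of i j "Suc j" w "(q, [g])"] by (simp add: cf_eq_Some run_Suc)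
  then have r: "runs stp [w ! j] (q1, g1 # rest w i q g j) = Some (q2, g2 # rest w i q g (Suc j))"
    using assms(4) by (simp add: cf_eq_Some)
  then obtain \<alpha> where s: "stp (w ! j) q1 g1 = Some (q2, \<alpha>)"
    "g2 # rest w i q g (Suc j) = \<alpha> @ rest w i q g j"
    by (auto split: option.splits)
  have "Suc (length (rest w i q g (Suc j))) = length \<alpha> + length (rest w i q g j)"
    using arg_cong[OF s(2), of length] by simp
  then show ?thesis using that[OF s] cf_ht[OF assms(1)] cf_ht[OF assms(4)] by simp
qed

text \<open>Consider the last position before \<open>k\<close> whose height is at most that at
  \<open>k\<close>. It is an ancestor, and if it is strictly lower, it must be \<open>k - 1\<close>,
  because a step raises the height by at most one.\<close>

lemma push_or_same_height:
  assumes al: "cf w i q g k = Some x" and k: "i < k" "k \<le> length w"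
  obtains (same) a where "i \<le> a" "a < k" "anc (ht w i q g) k a" "ht w i q g a = ht w i q g k"
  | (push) q1 g1 q2 g2 g' where "cf w i q g (k - 1) = Some (q1, g1)" "cf w i q g k = Some (q2, g2)"
     "stp (w ! (k - 1)) q1 g1 = Some (q2, [g2, g'])" "rest w i q g k = g' # rest w i q g (k - 1)"
     "anc (ht w i q g) k (k - 1)" "ht w i q g k = ht w i q g (k - 1) + 1"
proof -
  let ?h = "ht w i q g"
  define a where "a = Max {a. i \<le> a \<and> a < k \<and> ?h a \<le> ?h k}"
  have f: "finite {a. i \<le> a \<and> a < k \<and> ?h a \<le> ?h k}" by auto
  have "i \<in> {a. i \<le> a \<and> a < k \<and> ?h a \<le> ?h k}" using ht_pos[OF al, of k] k by auto
  then have "a \<in> {a. i \<le> a \<and> a < k \<and> ?h a \<le> ?h k}" unfolding a_def using f Max_in by blast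
  then have a: "i \<le> a" "a < k" "?h a \<le> ?h k" by auto
  have gr: "?h k < ?h j" if "a < j" "j < k" for j
  proof (rule ccontr)
    assume "\<not> ?h k < ?h j"
    then have "j \<le> a" unfolding a_def using f that a by (intro Max_ge) auto
    then show False using that by simp
  qed
  have an: "anc ?h k a" unfolding anc_def
  proof (intro allI impI)
    fix j assume "a \<le> j \<and> j \<le> k"
    then consider "j = a" | "j = k" | "a < j" "j < k" by force
    then show "?h a \<le> ?h j" using gr[of j] a by cases auto
  qed
  show ?thesis
  proof (cases "?h a = ?h k")
    case True
    then show ?thesis using same a an by blast
  next
    case False
    obtain q1 g1 where 1: "cf w i q g a = Some (q1, g1)" using cf_alive_ex[OF al, of a] a by auto
    obtain q2 g2 where 2: "cf w i q g (Suc a) = Some (q2, g2)" using cf_alive_ex[OF al, of "Suc a"] a by auto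
    obtain \<alpha> where \<alpha>: "stp (w ! a) q1 g1 = Some (q2, \<alpha>)"
      "g2 # rest w i q g (Suc a) = \<alpha> @ rest w i q g a" "?h (Suc a) + 1 = ?h a + length \<alpha>"
      using ht_Suc[OF 1 a(1) _ 2] a k by auto
    have le: "length \<alpha> \<le> 2" using stp_length[OF \<alpha>(1)] .
    have ak: "Suc a = k"
    proof (rule ccontr)
      assume "Suc a \<noteq> k"
      then have "?h k < ?h (Suc a)" using gr[of "Suc a"] a by auto
      then show False using \<alpha>(3) le a False by linarith
    qed
    have "length \<alpha> = 2" using \<alpha>(3)[unfolded ak] le a False by linarith
    then obtain x g' where x: "\<alpha> = [x, g']" by (auto simp: length_Suc_conv numeral_2_eq_2)
    show ?thesis
      by (rule push) (use 1 2 \<alpha> ak an x in auto)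
  qed
qed

subsection \<open>Popping a stack up to a given position\<close>

text \<open>The stack below the top symbol at \<open>k\<close>, in the run of \<open>(q, g)\<close> from \<open>i\<close>, is popped by a run from
  \<open>(l, p)\<close>. An ancestor \<open>a\<close> of \<open>k\<close> is reached when the stack below \<open>a\<close> is left. Rounding \<open>x\<close> to an
  ancestor makes \<open>ok\<close> monotone in \<open>x\<close>, so that its threshold \<open>cross\<close> can be found by a search;
  the symbol being popped at position \<open>e\<close> is the one pushed just before \<open>cross\<close>.\<close>

definition reach :: "nat list \<Rightarrow> nat \<Rightarrow> nat \<Rightarrow> nat \<Rightarrow> nat \<Rightarrow> nat \<Rightarrow> nat \<Rightarrow> nat \<Rightarrow> (nat \<times> nat) option" where
  "reach w i q g k l p a = Option.bind (cf w i q g a) (\<lambda>(qa, ga). pp w l p (rest w a qa ga k))"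

definition early :: "(nat \<times> nat) option \<Rightarrow> nat \<Rightarrow> bool" where
  "early z e \<longleftrightarrow> (\<exists>l q. z = Some (l, q) \<and> l \<le> e)"

definition ok :: "nat list \<Rightarrow> nat \<Rightarrow> nat \<Rightarrow> nat \<Rightarrow> nat \<Rightarrow> nat \<Rightarrow> nat \<Rightarrow> nat \<Rightarrow> nat \<Rightarrow> bool" where
  "ok w i q g k l p e x = early (reach w i q g k l p (lastanc (ht w i q g) i k x)) e"

definition cross :: "nat list \<Rightarrow> nat \<Rightarrow> nat \<Rightarrow> nat \<Rightarrow> nat \<Rightarrow> nat \<Rightarrow> nat \<Rightarrow> nat \<Rightarrow> nat" where
  "cross w i q g k l p e = (LEAST x. i \<le> x \<and> x \<le> k \<and> ok w i q g k l p e x)"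

context
  fixes w :: "nat list" and i q g k l p e :: nat and x :: "nat \<times> nat"
  assumes al: "cf w i q g k = Some x" and ik: "i \<le> k" and kw: "k \<le> length w"
    and le: "l \<le> e" and ew: "e \<le> length w"
begin

text \<open>For \<open>a <= b\<close> the stack to be popped down to \<open>b\<close> is the upper
  part of the one to be popped down to \<open>a\<close>, so it is gone no later.\<close>

lemma reach_mono:
  assumes "anc (ht w i q g) k a" "anc (ht w i q g) k b" "i \<le> a" "a \<le> b" "b \<le> k"
    and "early (reach w i q g k l p a) e"
  shows "early (reach w i q g k l p b) e"
proof -
  obtain qk gk where x: "x = (qk, gk)" by (cases x)
  obtain qa ga where a: "cf w i q g a = Some (qa, ga)" using cf_alive_ex[OF al, of a] assms by auto
  obtain qb gb where b: "cf w i q g b = Some (qb, gb)" using cf_alive_ex[OF al, of b] assms by auto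
  have ab: "anc (ht w i q g) b a" using assms anc_mono by blast
  have Ab: "cf w a qa ga b = Some (qb, gb)"
    using cf_segment_anc(1)[OF b _ assms(4) _ ab a] assms kw by auto
  have B: "cf w b qb gb k = Some (qk, gk)"
    using cf_segment_anc(1)[OF al[unfolded x] _ assms(5) kw assms(2) b] assms by auto
  have "rest w a qa ga k = rest w b qb gb k @ rest w a qa ga b"
    using cf_segment(2)[OF Ab assms(4,5) B] .
  then show ?thesis using assms(6) a b
    by (fastforce simp: reach_def early_def pp_append bind_eq_Some_conv pp_eq_Some popped_def)
qed

lemma lastanc_ok:
  assumes "i \<le> y" "y \<le> k"
  shows "i \<le> lastanc (ht w i q g) i k y" "lastanc (ht w i q g) i k y \<le> y"
    "anc (ht w i q g) k (lastanc (ht w i q g) i k y)"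
  using lastanc_props[OF anc_start[OF al] assms(1)] by auto

lemma ok_mono:
  assumes "i \<le> y" "y \<le> z" "z \<le> k" "ok w i q g k l p e y"
  shows "ok w i q g k l p e z"
proof -
  note y = lastanc_ok[of y] and z = lastanc_ok[of z]
  have "lastanc (ht w i q g) i k y \<le> lastanc (ht w i q g) i k z"
    by (rule lastanc_props(4)[OF anc_start[OF al]]) (use assms y in auto)
  then show ?thesis
    using assms(4) reach_mono[OF y(3) z(3)] y(1) z(2) assms unfolding ok_def by auto
qed

text \<open>Down to \<open>k\<close> itself nothing has to be popped; hence the \<open>LEAST\<close>
  in \<open>cross\<close> ranges over a nonempty set.\<close>

lemma ok_top: "ok w i q g k l p e k"
proof -
  obtain qk gk where x: "x = (qk, gk)" by (cases x)
  show ?thesis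
    using al x le ew ik by (simp add: ok_def lastanc_self reach_def early_def)
qed

lemma cross_props: "i \<le> cross w i q g k l p e" "cross w i q g k l p e \<le> k"
  "ok w i q g k l p e (cross w i q g k l p e)"
  and cross_iff: "\<And>y. i \<le> y \<Longrightarrow> y \<le> k \<Longrightarrow> ok w i q g k l p e y \<longleftrightarrow> cross w i q g k l p e \<le> y"
proof -
  have "i \<le> k \<and> k \<le> k \<and> ok w i q g k l p e k" using ik ok_top by auto
  from LeastI[of "\<lambda>x. i \<le> x \<and> x \<le> k \<and> ok w i q g k l p e x", OF this]
  show c: "i \<le> cross w i q g k l p e" "cross w i q g k l p e \<le> k"
    "ok w i q g k l p e (cross w i q g k l p e)" by (auto simp: cross_def)
  fix y assume y: "i \<le> y" "y \<le> k"
  show "ok w i q g k l p e y \<longleftrightarrow> cross w i q g k l p e \<le> y"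
  proof
    assume "ok w i q g k l p e y"
    then show "cross w i q g k l p e \<le> y" unfolding cross_def using y by (intro Least_le) auto
  next
    assume "cross w i q g k l p e \<le> y"
    then show "ok w i q g k l p e y" using ok_mono c y by blast
  qed
qed

text \<open>The search compares candidates with the unknown \<open>cross\<close>. By monotonicity
  one evaluation of \<open>ok\<close>, at \<open>y - 1\<close>, decides this; candidates outside
  \<open>i < y <= k\<close> are settled without it.\<close>

lemma le_cross_iff:
  "y \<le> cross w i q g k l p e \<longleftrightarrow> y \<le> k \<and> (y \<le> i \<or> \<not> ok w i q g k l p e (y - 1))"
proof (cases "y \<le> i \<or> k < y")
  case True
  then show ?thesis using cross_props ik by auto
next
  case False
  then have "i \<le> y - 1" "y - 1 \<le> k" by auto
  then show ?thesis using cross_iff[of "y - 1"] False by auto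
qed

text \<open>A threshold at the very start means that no symbol is under way at
  \<open>e\<close>.\<close>

lemma cross_start:
  assumes "cross w i q g k l p e = i"
  shows "early (pp w l p (rest w i q g k)) e"
proof -
  have "ok w i q g k l p e i" using cross_props(3) assms by simp
  moreover have "lastanc (ht w i q g) i k i = i" using lastanc_ok[of i] ik by auto
  ultimately show ?thesis by (simp add: ok_def reach_def)
qed

text \<open>\<open>ok\<close> changes between \<open>cross - 1\<close> and \<open>cross\<close>, so
  the rounding changes there and \<open>cross\<close> is an ancestor. An earlier ancestor of the
  same height would leave the same stack to pop, hence the step to \<open>cross\<close> is a push.
  The symbol \<open>g'\<close> which it puts below the top is the one under way at \<open>e\<close>:
  all above it is popped by \<open>e\<close>, but \<open>g'\<close> is not.\<close>

lemma cross_push: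
  assumes "i < cross w i q g k l p e"
  obtains a q1 g1 q2 g2 g' l3 p3 where "cross w i q g k l p e = Suc a" "i \<le> a" "a < k"
    "cf w i q g a = Some (q1, g1)" "stp (w ! a) q1 g1 = Some (q2, [g2, g'])"
    "cf w i q g (Suc a) = Some (q2, g2)"
    "pp w l p (rest w (Suc a) q2 g2 k) = Some (l3, p3)" "l3 \<le> e"
    "rest w i q g k = rest w (Suc a) q2 g2 k @ g' # rest w i q g a"
    "\<not> early (pp w l3 p3 [g']) e"
    "\<And>j. a < j \<Longrightarrow> j \<le> k \<Longrightarrow> ht w i q g a < ht w i q g j"
proof -
  let ?h = "ht w i q g"
  define b where "b = cross w i q g k l p e"
  have b: "i < b" "b \<le> k" "ok w i q g k l p e b" "\<not> ok w i q g k l p e (b - 1)"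
    using cross_props assms cross_iff[of "b - 1"] by (auto simp: b_def)
  obtain qk gk where x: "x = (qk, gk)" by (cases x)
  have ancb: "anc ?h k b"
  proof (rule ccontr)
    assume n: "\<not> anc ?h k b"
    have i: "i \<le> b - 1" "b - 1 \<le> k" using b by auto
    note L = lastanc_ok[OF i]
    have "lastanc ?h i k b = lastanc ?h i k (b - 1)"
    proof (rule lastanc_eqI)
      fix c assume c: "lastanc ?h i k (b - 1) < c" "c \<le> b"
      show "\<not> anc ?h k c"
      proof
        assume "anc ?h k c"
        then have "c \<noteq> b" using n by auto
        then have "c \<le> lastanc ?h i k (b - 1)"
          using \<open>anc ?h k c\<close> c L b by (intro lastanc_props(4)[OF anc_start[OF al]]) auto
        then show False using c by simp
      qed
    qed (use L b in auto)
    then show False using b by (simp add: ok_def)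
  qed
  obtain qb gb where cb: "cf w i q g b = Some (qb, gb)" using cf_alive_ex[OF al, of b] b by auto
  have bw: "b \<le> length w" using b kw by simp
  have segb: "cf w b qb gb k = Some (qk, gk)" "rest w i q g k = rest w b qb gb k @ rest w i q g b"
    using cf_segment_anc[OF al[unfolded x] _ b(2) kw ancb cb] b by auto
  have lb: "lastanc ?h i k b = b" using lastanc_self[OF ancb] b by simp
  from cb b(1) bw show ?thesis
  proof (cases rule: push_or_same_height)
    case (same a)
    have ak: "anc ?h k a" using anc_trans[OF ancb same(3)] same by simp
    have i: "i \<le> b - 1" "b - 1 \<le> k" using b by auto
    note L = lastanc_ok[OF i]
    let ?A = "lastanc ?h i k (b - 1)"
    have aA: "a \<le> ?A" using same ak b by (intro lastanc_props(4)[OF anc_start[OF al]]) auto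
    have A: "i \<le> ?A" "?A \<le> b" "anc ?h k ?A" using L b by auto
    have "?h a \<le> ?h ?A" using same(3) aA A by (auto simp: anc_def)
    moreover have "?h ?A \<le> ?h b" using A b by (auto simp: anc_def)
    ultimately have hA: "?h ?A = ?h b" using same by simp
    obtain qa ga where ca: "cf w i q g ?A = Some (qa, ga)" using cf_alive_ex[OF al, of ?A] A b by auto
    have sA: "cf w ?A qa ga b = Some (qb, gb)" "rest w i q g b = rest w ?A qa ga b @ rest w i q g ?A"
      using cf_segment_anc[OF cb A(1,2) bw anc_mono[OF A(3) b(2)] ca] by auto
    have "rest w ?A qa ga b = []" using hA sA(2) cf_ht[OF cb] cf_ht[OF ca] by simp
    then have "rest w ?A qa ga k = rest w b qb gb k"
      using cf_segment(2)[OF sA(1) A(2) b(2) segb(1)] by simp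
    then have "ok w i q g k l p e (b - 1) = ok w i q g k l p e b"
      using ca cb by (simp add: ok_def reach_def lb)
    then show ?thesis using b by simp
  next
    case (push q1 g1 q2 g2 g')
    define a where "a = b - 1"
    have ab: "b = Suc a" using b by (simp add: a_def)
    have e: "q2 = qb" "g2 = gb" using push(2) cb by auto
    have "anc ?h k a" using anc_trans[OF ancb push(5)] by (simp add: a_def)
    then have la: "lastanc ?h i k a = a" using lastanc_self b ab by auto
    obtain l3 p3 where 3: "pp w l p (rest w b qb gb k) = Some (l3, p3)" "l3 \<le> e"
      using b(3) cb by (auto simp: ok_def lb reach_def early_def)
    have "ht w a q1 g1 b = 2" "rest w a q1 g1 b = [g']" "cf w a q1 g1 b = Some (qb, gb)"
    proof -
      have "run w a b (q1, [g1]) = Some (qb, [gb, g'])"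
        using push e ab bw by (simp add: run_Suc a_def[symmetric])
      then show "ht w a q1 g1 b = 2" "rest w a q1 g1 b = [g']" "cf w a q1 g1 b = Some (qb, gb)"
        by (auto dest: run_eq_SomeD)
    qed
    then have "rest w a q1 g1 k = rest w b qb gb k @ [g']"
      using cf_segment(2)[of w a q1 g1 b qb gb k] segb b ab by simp
    then have ne: "\<not> early (pp w l3 p3 [g']) e"
      using b(4)[folded a_def] 3 push(1)[folded a_def] by (simp add: ok_def la reach_def pp_append)
    have hj: "?h a < ?h j" if "a < j" "j \<le> k" for j
    proof -
      have "?h b \<le> ?h j" using ancb that ab by (auto simp: anc_def)
      then show ?thesis using push(6) by (simp add: a_def)
    qed
    show ?thesis
    proof (rule that[of a q1 g1 qb gb g' l3 p3])
      show "cross w i q g k l p e = Suc a" using ab by (simp add: b_def)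
      show "i \<le> a" "a < k" using b(1,2) ab by simp_all
      show "cf w i q g a = Some (q1, g1)" using push(1)[folded a_def] .
      show "stp (w ! a) q1 g1 = Some (qb, [gb, g'])" using push(3)[folded a_def] e by simp
      show "cf w i q g (Suc a) = Some (qb, gb)" using cb unfolding ab .
      show "pp w l p (rest w (Suc a) qb gb k) = Some (l3, p3)" using 3(1) unfolding ab .
      show "rest w i q g k = rest w (Suc a) qb gb k @ g' # rest w i q g a"
        using segb(2) push(4)[folded a_def] unfolding ab[symmetric] by simp
    qed (fact 3 ne hj)+
  qed
qed

end

end

subsection \<open>Effect of a change\<close>

text \<open>Being an ancestor depends only on comparisons of heights, so it survives the constant
  \<open>C\<close> of a stack lying below and the order isomorphism \<open>f\<close> of positions,
  whose inverse is \<open>g\<close>.\<close>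

lemma lastanc_shift:
  fixes f g :: "nat \<Rightarrow> nat"
  assumes h: "\<And>j. P \<le> j \<Longrightarrow> j \<le> k \<Longrightarrow> h j = h' (f j) + C"
    and f: "\<And>x y. P \<le> x \<Longrightarrow> P \<le> y \<Longrightarrow> f x \<le> f y \<longleftrightarrow> x \<le> y"
    and g: "\<And>y. f P \<le> y \<Longrightarrow> P \<le> g y \<and> f (g y) = y"
    and an: "anc h k P" and x: "P \<le> x" "x \<le> k"
  shows "lastanc h P k x = g (lastanc h' (f P) (f k) (f x))"
proof -
  have fP: "f P \<le> f y" if "P \<le> y" for y using f that by simp
  have eq: "anc h k y \<longleftrightarrow> anc h' (f k) (f y)" if y: "P \<le> y" for y
  proof
    assume a: "anc h k y"
    show "anc h' (f k) (f y)" unfolding anc_def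
    proof (intro allI impI)
      fix j assume j: "f y \<le> j \<and> j \<le> f k"
      have jp: "P \<le> g j" "f (g j) = j" using g[of j] j fP[OF y] by auto
      then have "y \<le> g j" "g j \<le> k" using f[of y "g j"] f[of "g j" k] j y x by auto
      then have "h y \<le> h (g j)" using a by (simp add: anc_def)
      then show "h' (f y) \<le> h' j" using h[of y] h[of "g j"] y jp \<open>y \<le> g j\<close> \<open>g j \<le> k\<close> by simp
    qed
  next
    assume a: "anc h' (f k) (f y)"
    show "anc h k y" unfolding anc_def
    proof (intro allI impI)
      fix j assume j: "y \<le> j \<and> j \<le> k"
      then have "f y \<le> f j" "f j \<le> f k" using f y by auto
      then have "h' (f y) \<le> h' (f j)" using a by (simp add: anc_def)
      then show "h y \<le> h j" using h[of y] h[of j] j y by simp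
    qed
  qed
  note L = lastanc_props[OF an[unfolded eq[OF order_refl]] fP[OF x(1)]]
  show ?thesis
  proof (rule lastanc_eqI)
    let ?a = "lastanc h' (f P) (f k) (f x)"
    have ga: "P \<le> g ?a" "f (g ?a) = ?a" using g[OF L(1)] by auto
    show "P \<le> g ?a" by (rule ga)
    show "g ?a \<le> x" using f[OF ga(1) x(1)] ga(2) L(2) by simp
    show "anc h k (g ?a)" using eq[OF ga(1)] ga(2) L(3) by simp
    fix z assume z: "g ?a < z" "z \<le> x"
    show "\<not> anc h k z"
    proof
      assume "anc h k z"
      then have "f z \<le> ?a" using L(4)[of "f z"] eq[of z] fP[of z] f[of z x] z ga x by simp
      then have "z \<le> g ?a" using f[of z "g ?a"] ga z by simp
      then show False using z by simp
    qed
  qed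
qed

context stack_machine
begin

lemma runs_range:
  "runs stp u (q, \<gamma>) = Some (q', \<gamma>') \<Longrightarrow> q < cap \<Longrightarrow> set \<gamma> \<subseteq> {..<cap} \<Longrightarrow> q' < cap \<and> set \<gamma>' \<subseteq> {..<cap}"
proof (induction u arbitrary: q \<gamma>)
  case (Cons a u)
  then obtain g \<gamma>0 where g: "\<gamma> = g # \<gamma>0" by (cases \<gamma>) auto
  then obtain q1 \<alpha> where s: "stp a q g = Some (q1, \<alpha>)" using Cons.prems by (auto split: option.splits)
  then show ?case using Cons.IH[of q1 "\<alpha> @ \<gamma>0"] Cons.prems g stp_range[OF s] by simp
qed auto

text \<open>Nothing is assumed about the stack, as every transition leads to a state below
  \<open>cap\<close>. So the range of the state after a pop is available for arbitrary
  stacks.\<close>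

lemma runs_state_range:
  "runs stp u (q, \<gamma>) = Some (q', \<gamma>') \<Longrightarrow> q < cap \<Longrightarrow> q' < cap"
proof (induction u arbitrary: q \<gamma>)
  case (Cons a u)
  then obtain g \<gamma>0 where g: "\<gamma> = g # \<gamma>0" by (cases \<gamma>) auto
  then obtain q1 \<alpha> where s: "stp a q g = Some (q1, \<alpha>)" using Cons.prems by (auto split: option.splits)
  then show ?case using Cons.IH[of q1 "\<alpha> @ \<gamma>0"] Cons.prems g stp_range[OF s] by simp
qed auto

lemma cf_range: "cf w i q g k = Some (q', g') \<Longrightarrow> q < cap \<Longrightarrow> g < cap \<Longrightarrow> q' < cap \<and> g' < cap"
  using runs_range[of _ q "[g]" q' "g' # rest w i q g k"] by (auto simp: cf_eq_Some run_def)

lemma pp_range: "pp w l q \<gamma> = Some (l', q') \<Longrightarrow> q < cap \<Longrightarrow> q' < cap"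
  by (auto simp: pp_eq_Some popped_def run_def dest: runs_state_range)

lemma pp_le: "pp w l q \<gamma> = Some (l', q') \<Longrightarrow> l \<le> l' \<and> l' \<le> length w"
  by (auto simp: pp_eq_Some popped_def)

end

text \<open>\<open>d\<close> is the number of old letters that \<open>s\<close> replaces: 1 for a
  relabelling, 0 for an insertion. The new letter lies between the gaps \<open>c\<close> and
  \<open>c + 1\<close>; \<open>b\<close> is the old gap behind the change. \<open>up\<close> takes
  the old gaps from \<open>b\<close> on to new ones, and \<open>dn\<close> takes them back.\<close>

locale edit = stack_machine stp cap for stp :: "nat \<Rightarrow> nat \<Rightarrow> nat \<Rightarrow> (nat \<times> nat list) option" and cap :: nat +
  fixes w w' :: "nat list" and s c d b :: nat and up dn :: "nat \<Rightarrow> nat"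
  assumes d: "d \<le> 1" and cd: "c + d \<le> length w"
  assumes w': "w' = take c w @ s # drop (c + d) w" and b: "b = c + d"
    and up: "up = (\<lambda>j. j + 1 - d)" and dn: "dn = (\<lambda>j. j - 1 + d)"
begin

lemma len_edit: "length w' = up (length w)" "c < length w'"
  using d cd by (auto simp: w' up)

lemma up_dn: "c < j \<Longrightarrow> up (dn j) = j" "b \<le> j \<Longrightarrow> dn (up j) = j" "c < j \<Longrightarrow> b \<le> dn j"
  "b \<le> j \<Longrightarrow> c < up j" "j \<le> k \<Longrightarrow> dn j \<le> dn k" "j \<le> k \<Longrightarrow> up j \<le> up k"
  "c < j \<Longrightarrow> dn j \<le> k \<longleftrightarrow> j \<le> up k" "c < j \<Longrightarrow> c < k \<Longrightarrow> dn j \<le> dn k \<longleftrightarrow> j \<le> k"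
  using d by (auto simp: up dn b)

lemma dn_le: "k \<le> length w' \<Longrightarrow> c < k \<Longrightarrow> dn k \<le> length w"
  using len_edit d by (auto simp: up dn)

definition mapup :: "(nat \<times> nat) option \<Rightarrow> (nat \<times> nat) option" where
  "mapup z = map_option (\<lambda>(l, q). (up l, q)) z"

lemma mapup_simps [simp]: "mapup None = None" "mapup (Some (l, q)) = Some (up l, q)"
  by (auto simp: mapup_def)

lemma run_edit_prefix: "k \<le> c \<Longrightarrow> run w' i k = run w i k"
  using cd by (simp add: run_def w')

lemma nth_edit_prefix: "j < c \<Longrightarrow> w' ! j = w ! j"
  using cd by (simp add: w' nth_append)

lemma run_edit_suffix:
  assumes "c < i"
  shows "run w' i k = run w (dn i) (dn k)"
proof -
  have "drop i w' = drop (dn i) w" using assms cd by (simp add: w' dn Cons_eq_append_conv add.commute drop_Cons')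
  moreover have "k - i = dn k - dn i" using assms by (auto simp: dn)
  ultimately show ?thesis by (simp add: run_def drop_take)
qed

lemma run_edit_across:
  assumes "i \<le> c" "c < k"
  shows "run w' i k C = Option.bind (run w i c C) (\<lambda>C1. Option.bind (runs stp [s] C1) (run w b (dn k)))"
proof -
  have "run w' i k C = Option.bind (run w' i c C) (run w' c k)"
    using run_split[of i c k w' C] assms by simp
  moreover have "run w' c k C1 = Option.bind (runs stp [s] C1) (run w b (dn k))" for C1
  proof -
    have "run w' c k C1 = Option.bind (run w' c (Suc c) C1) (run w' (Suc c) k)"
      using run_split[of c "Suc c" k w' C1] assms by simp
    moreover have "w' ! c = s" using cd by (simp add: w' nth_append)
    ultimately show ?thesis using run_edit_suffix[of "Suc c" k] run_Suc[OF len_edit(2)]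
      by (simp add: b dn add.commute)
  qed
  ultimately show ?thesis using run_edit_prefix[of c i] by (cases "run w i c C") simp_all
qed

lemma pp_edit_suffix:
  assumes "c < l"
  shows "pp w' l q \<gamma> = mapup (pp w (dn l) q \<gamma>)"
proof -
  have *: "popped w' l q \<gamma> l' q' \<longleftrightarrow> (\<exists>j. l' = up j \<and> popped w (dn l) q \<gamma> j q')" for l' q'
  proof
    assume a: "popped w' l q \<gamma> l' q'"
    then have "c < l'" using assms by (auto simp: popped_def)
    then show "\<exists>j. l' = up j \<and> popped w (dn l) q \<gamma> j q'"
      using a assms run_edit_suffix[OF assms, of l'] dn_le[of l'] up_dn(1)[of l'] up_dn(5)[of l l']
      by (intro exI[of _ "dn l'"]) (auto simp: popped_def)
  next
    assume "\<exists>j. l' = up j \<and> popped w (dn l) q \<gamma> j q'"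
    then obtain j where j: "l' = up j" "popped w (dn l) q \<gamma> j q'" by blast
    then have bj: "b \<le> j" using up_dn(3)[OF assms] by (auto simp: popped_def)
    then show "popped w' l q \<gamma> l' q'"
      using j run_edit_suffix[OF assms, of l'] up_dn(2)[OF bj] up_dn(7)[OF assms, of j] up_dn(6)[of j "length w"]
      by (auto simp: popped_def len_edit)
  qed
  have "pp w' l q \<gamma> = Some (l', q') \<longleftrightarrow> mapup (pp w (dn l) q \<gamma>) = Some (l', q')" for l' q'
  proof -
    have "mapup (pp w (dn l) q \<gamma>) = Some (l', q') \<longleftrightarrow> (\<exists>j. l' = up j \<and> pp w (dn l) q \<gamma> = Some (j, q'))"
      by (cases "pp w (dn l) q \<gamma>") auto
    then show ?thesis using *[of l' q'] by (simp only: pp_eq_Some)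
  qed
  then show ?thesis by (metis not_None_eq surj_pair)
qed

lemma popped_edit_prefix: "l' \<le> c \<Longrightarrow> popped w' l q \<gamma> l' q' \<longleftrightarrow> popped w l q \<gamma> l' q'"
  using run_edit_prefix[of l' l] len_edit(2) cd by (auto simp: popped_def)

lemma pp_edit_early:
  assumes "early (pp w l q \<gamma>) c"
  shows "pp w' l q \<gamma> = pp w l q \<gamma>"
proof -
  obtain l' q' where p: "pp w l q \<gamma> = Some (l', q')" "l' \<le> c" using assms by (auto simp: early_def)
  then show ?thesis by (metis popped_edit_prefix pp_eq_Some)
qed

lemma early_edit: "early (pp w' l q \<gamma>) c \<longleftrightarrow> early (pp w l q \<gamma>) c"
  unfolding early_def pp_eq_Some using popped_edit_prefix by blast

text \<open>A pop not finished by \<open>c\<close> has to read the new letter. What is left of the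
  stack after that is popped over the unchanged suffix, hence by the old \<open>pp\<close> from
  \<open>b\<close>.\<close>

lemma pp_edit_late:
  assumes l: "l \<le> c" and late: "\<not> early (pp w l q \<gamma>) c"
  shows "pp w' l q \<gamma> = Option.bind (run w l c (q, \<gamma>)) (\<lambda>C1. Option.bind (runs stp [s] C1)
    (\<lambda>(q2, \<gamma>2). mapup (pp w b q2 \<gamma>2)))" (is "_ = ?R")
proof -
  have "pp w' l q \<gamma> = Some (l', q') \<longleftrightarrow> ?R = Some (l', q')" for l' q'
  proof (cases "c < l'")
    case True
    have "pp w' l q \<gamma> = Some (l', q') \<longleftrightarrow> l' \<le> length w' \<and> Option.bind (run w l c (q, \<gamma>))
      (\<lambda>C1. Option.bind (runs stp [s] C1) (run w b (dn l'))) = Some (q', [])"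
      unfolding pp_eq_Some popped_def run_edit_across[OF l True] using l True by auto
    also have "\<dots> \<longleftrightarrow> ?R = Some (l', q')"
    proof -
      have "mapup (pp w b q2 \<gamma>2) = Some (l', q') \<longleftrightarrow> l' \<le> length w' \<and> run w b (dn l') (q2, \<gamma>2) = Some (q', [])"
        for q2 \<gamma>2
      proof
        assume "mapup (pp w b q2 \<gamma>2) = Some (l', q')"
        then obtain j where j: "popped w b q2 \<gamma>2 j q'" "l' = up j"
          by (cases "pp w b q2 \<gamma>2") (auto simp: pp_eq_Some[symmetric])
        then show "l' \<le> length w' \<and> run w b (dn l') (q2, \<gamma>2) = Some (q', [])"
          using up_dn(2)[of j] up_dn(6)[of j "length w"] by (auto simp: popped_def len_edit)
      next
        assume a: "l' \<le> length w' \<and> run w b (dn l') (q2, \<gamma>2) = Some (q', [])"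
        then have "pp w b q2 \<gamma>2 = Some (dn l', q')"
          using dn_le[of l'] True up_dn(3)[OF True] by (auto simp: popped_def pp_eq_Some)
        then show "mapup (pp w b q2 \<gamma>2) = Some (l', q')" using up_dn(1)[OF True] by simp
      qed
      then show ?thesis by (auto simp: bind_eq_Some_conv)
    qed
    finally show ?thesis .
  next
    case False
    have "?R \<noteq> Some (l', q')"
    proof
      assume "?R = Some (l', q')"
      then obtain q2 \<gamma>2 where "mapup (pp w b q2 \<gamma>2) = Some (l', q')" by (auto simp: bind_eq_Some_conv)
      then obtain j where j: "popped w b q2 \<gamma>2 j q'" "l' = up j"
        by (cases "pp w b q2 \<gamma>2") (auto simp: pp_eq_Some[symmetric])
      then show False using up_dn(4)[of j] False by (auto simp: popped_def)
    qed
    moreover have "pp w' l q \<gamma> \<noteq> Some (l', q')"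
      using late early_edit[of l q \<gamma>] False by (auto simp: early_def)
    ultimately show ?thesis by blast
  qed
  then show ?thesis by (metis not_None_eq surj_pair)
qed

text \<open>The new letter is read in the configuration at \<open>c\<close>, and what it pushed is
  popped: the result, in old numbering, is where the stack \<open>rest w i q g c\<close> gets
  exposed.\<close>

definition resume :: "nat \<Rightarrow> nat \<Rightarrow> nat \<Rightarrow> (nat \<times> nat) option" where
  "resume i q g = Option.bind (cf w i q g c) (\<lambda>(q1, g1). Option.bind (stp s q1 g1) (\<lambda>(q2, \<alpha>). pp w b q2 \<alpha>))"

text \<open>For a single symbol the stack exposed after \<open>resume\<close> is
  \<open>rest w l q g c\<close>, and popping it is an old table entry. So two old results determine
  the new one.\<close>

lemma pp_edit_symbol:
  assumes l: "l \<le> c" and late: "\<not> early (pp w l q [g]) c"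
  shows "pp w' l q [g] = mapup (Option.bind (resume l q g) (\<lambda>(l2, q2). pp w l2 q2 (rest w l q g c)))"
proof (cases "cf w l q g c")
  case None
  \<comment> \<open>\<open>cf\<close> is undefined also for an empty stack at \<open>c\<close>, but
    that would be a pop finished by \<open>c\<close>.\<close>
  have "runs stp [s] C1 = None" if r: "run w l c (q, [g]) = Some C1" for C1
  proof (cases C1)
    case (Pair q1 \<gamma>)
    then have "\<gamma> = []" using None r by (cases \<gamma>) (auto simp: cf_def)
    then have "popped w l q [g] c q1" using r Pair l cd by (auto simp: popped_def)
    then show ?thesis using late by (auto simp: early_def pp_eq_Some)
  qed
  then have "Option.bind (run w l c (q, [g])) (\<lambda>C1. Option.bind (runs stp [s] C1)
    (\<lambda>(q2, \<gamma>2). mapup (pp w b q2 \<gamma>2))) = None"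
    by (cases "run w l c (q, [g])") auto
  then show ?thesis using None by (simp add: pp_edit_late[OF l late] resume_def del: runs.simps)
next
  case (Some x)
  obtain q1 g1 where x: "x = (q1, g1)" by (cases x)
  then have r: "run w l c (q, [g]) = Some (q1, g1 # rest w l q g c)" using Some by (simp add: cf_eq_Some)
  show ?thesis
    by (cases "stp s q1 g1") (auto simp: pp_edit_late[OF l late] resume_def r Some x pp_append)
qed

lemma cf_edit_prefix: "k \<le> c \<Longrightarrow> cf w' i q g k = cf w i q g k"
  "k \<le> c \<Longrightarrow> rest w' i q g k = rest w i q g k" "k \<le> c \<Longrightarrow> ht w' i q g k = ht w i q g k"
  by (simp_all add: cf_def rest_def ht_def run_edit_prefix)

lemma cf_edit_suffix: "c < i \<Longrightarrow> cf w' i q g k = cf w (dn i) q g (dn k)"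
  "c < i \<Longrightarrow> rest w' i q g k = rest w (dn i) q g (dn k)" "c < i \<Longrightarrow> ht w' i q g k = ht w (dn i) q g (dn k)"
  by (simp_all add: cf_def rest_def ht_def run_edit_suffix)

lemma lastanc_edit_suffix:
  assumes "c < i" "cf w' i q g k = Some y" "i \<le> x" "x \<le> k"
  shows "lastanc (ht w' i q g) i k x = up (lastanc (ht w (dn i) q g) (dn i) (dn k) (dn x))"
proof (rule lastanc_shift[where C = 0 and h' = "ht w (dn i) q g" and f = dn])
  show "ht w' i q g j = ht w (dn i) q g (dn j) + 0" for j
    using cf_edit_suffix(3)[OF assms(1)] by simp
  show "dn x \<le> dn y \<longleftrightarrow> x \<le> y" if "i \<le> x" "i \<le> y" for x y using up_dn(8) that assms by simp
  show "i \<le> up y \<and> dn (up y) = y" if "dn i \<le> y" for y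
    using that up_dn(7)[OF assms(1), of y] up_dn(2)[of y] up_dn(3)[OF assms(1)] by auto
  show "anc (ht w' i q g) k i" using anc_start[OF assms(2)] .
qed (use assms in auto)

text \<open>The run of \<open>(q, g)\<close> over \<open>w'\<close> from \<open>i \<le> c\<close> to \<open>k > c\<close> ends in the run of \<open>(p, g1)\<close> over the
  old suffix from \<open>l\<close>, on top of \<open>\<beta>\<close> and the stack below the old ancestor \<open>a\<close>.\<close>

definition decomp :: "nat \<Rightarrow> nat \<Rightarrow> nat \<Rightarrow> nat \<Rightarrow> nat \<Rightarrow> nat \<Rightarrow> nat \<Rightarrow> nat list \<Rightarrow> nat \<Rightarrow> bool" where
  "decomp i q g k l p g1 \<beta> a \<longleftrightarrow> b \<le> l \<and> l \<le> dn k \<and> i \<le> a \<and> a \<le> c \<and> length \<beta> \<le> 1 \<and>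
     cf w i q g a \<noteq> None \<and> cf w l p g1 (dn k) \<noteq> None \<and>
     run w' i (up l) (q, [g]) = Some (p, g1 # \<beta> @ rest w i q g a) \<and>
     anc (ht w' i q g) (up l) a \<and>
     (\<forall>j. a < j \<and> j < up l \<longrightarrow> ht w' i q g (up l) < ht w' i q g j)"

text \<open>Strictly between \<open>a\<close> and \<open>up l\<close> the run is higher than at
  \<open>up l\<close>, so no ancestor of \<open>k\<close> lies there. The last ancestor is thus
  found either in the old suffix run from \<open>l\<close> or in the old prefix run up to
  \<open>a\<close>.\<close>

lemma decomp_props:
  assumes "decomp i q g k l p g1 \<beta> a" "i \<le> c" "c < k"
  shows "cf w' i q g k = cf w l p g1 (dn k)"
    and "rest w' i q g k = rest w l p g1 (dn k) @ \<beta> @ rest w i q g a"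
    and "i \<le> x \<Longrightarrow> x \<le> k \<Longrightarrow> lastanc (ht w' i q g) i k x =
      (if up l \<le> x then up (lastanc (ht w l p g1) l (dn k) (dn x))
       else lastanc (ht w i q g) i a (min x a))"
proof -
  have bl: "b \<le> l" and ldn: "l \<le> dn k" and a: "i \<le> a" "a \<le> c"
    using assms(1) unfolding decomp_def by auto
  have ul: "c < up l" "dn (up l) = l" "up l \<le> k"
    using up_dn(4)[OF bl] up_dn(2)[OF bl] up_dn(1)[OF assms(3)] up_dn(6)[OF ldn] by auto
  obtain qk gk where k: "cf w l p g1 (dn k) = Some (qk, gk)" using assms(1) unfolding decomp_def by auto
  have u: "cf w' i q g (up l) = Some (p, g1)" "rest w' i q g (up l) = \<beta> @ rest w i q g a"
    using assms(1) unfolding decomp_def by (auto dest: run_eq_SomeD)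
  have k': "cf w' (up l) p g1 k = Some (qk, gk)" using cf_edit_suffix(1)[OF ul(1)] ul k by simp
  have iu: "i \<le> up l" using a ul by simp
  note S = cf_segment[OF u(1) iu ul(3) k']
  show c': "cf w' i q g k = cf w l p g1 (dn k)" using S(1) k by simp
  show "rest w' i q g k = rest w l p g1 (dn k) @ \<beta> @ rest w i q g a"
    using S(2) u(2) cf_edit_suffix(2)[OF ul(1)] ul by simp
  assume x: "i \<le> x" "x \<le> k"
  have ai: "anc (ht w' i q g) k i" using anc_start[OF S(1)] .
  have au: "anc (ht w' i q g) k (up l)" unfolding anc_def
  proof (intro allI impI)
    fix j assume j: "up l \<le> j \<and> j \<le> k"
    have "1 \<le> ht w' (up l) p g1 j" using ht_pos[OF k'] j by auto
    then show "ht w' i q g (up l) \<le> ht w' i q g j" using S(3)[of j] S(3)[of "up l"] j ul by simp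
  qed
  show "lastanc (ht w' i q g) i k x =
      (if up l \<le> x then up (lastanc (ht w l p g1) l (dn k) (dn x))
       else lastanc (ht w i q g) i a (min x a))"
  proof (cases "up l \<le> x")
    case True
    have "lastanc (ht w' i q g) i k x = lastanc (ht w' i q g) (up l) k x"
      using lastanc_glue_above[OF ai iu au True x(2)] .
    also have "\<dots> = up (lastanc (ht w l p g1) (dn (up l)) (dn k) (dn x))"
    proof (rule lastanc_shift[where C = "length (rest w' i q g (up l))" and f = dn])
      show "ht w' i q g j = ht w l p g1 (dn j) + length (rest w' i q g (up l))" if "up l \<le> j" "j \<le> k" for j
        using S(3)[OF that] cf_edit_suffix(3)[OF ul(1)] ul by simp
      show "dn x \<le> dn y \<longleftrightarrow> x \<le> y" if "up l \<le> x" "up l \<le> y" for x y using up_dn(8) that ul by simp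
      show "up l \<le> up y \<and> dn (up y) = y" if "dn (up l) \<le> y" for y
        using that up_dn(2)[of y] up_dn(6)[of l y] bl ul by auto
    qed (use au True x in auto)
    finally show ?thesis using True ul by simp
  next
    case False
    have "lastanc (ht w' i q g) i k x = lastanc (ht w' i q g) i a (min x a)"
      by (rule lastanc_glue_below[OF ai a(1) _ ul(3) au])
        (use assms(1) False x a ul in \<open>auto simp: decomp_def\<close>)
    also have "\<dots> = lastanc (ht w i q g) i a (min x a)"
      by (rule lastanc_cong) (use cf_edit_prefix(3) a in auto)
    finally show ?thesis using False by simp
  qed
qed

section \<open>Decomposing a run across the change\<close>

context
  fixes i q g k q1 g1 q2 :: nat and \<alpha> :: "nat list"
  assumes ic: "i \<le> c" and ck: "c < k" and kw: "k \<le> length w'"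
    and old: "cf w i q g c = Some (q1, g1)" and st: "stp s q1 g1 = Some (q2, \<alpha>)"
begin

lemma edit_run: "b \<le> e \<Longrightarrow> run w' i (up e) (q, [g]) = run w b e (q2, \<alpha> @ rest w i q g c)"
  using run_edit_across[OF ic, of "up e" "(q, [g])"] old st up_dn(4)[of e] up_dn(2)[of e]
  by (simp add: cf_eq_Some)

text \<open>The first symbol pushed by the new letter is not yet popped at \<open>k\<close>. Only
  here can \<open>\<beta>\<close> be nonempty: it is the second symbol pushed by the new step, which
  no step of the old run has pushed.\<close>

lemma decomp_top:
  assumes "\<alpha> = \<alpha>1 # \<beta>" "cf w b q2 \<alpha>1 (dn k) \<noteq> None"
  shows "decomp i q g k b q2 \<alpha>1 \<beta> c"
proof -
  have r: "run w' i (up b) (q, [g]) = Some (q2, \<alpha>1 # \<beta> @ rest w i q g c)"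
    using edit_run[of b] assms by simp
  have ub: "up b = Suc c" using d by (auto simp: up b)
  have h: "ht w' i q g c \<le> ht w' i q g (up b)"
    using run_eq_SomeD[OF r] cf_edit_prefix(3)[of c i q g] cf_ht[OF old] by simp
  have "anc (ht w' i q g) (up b) c" unfolding anc_def
  proof (intro allI impI)
    fix j assume "c \<le> j \<and> j \<le> up b"
    then have "j = c \<or> j = up b" using ub by auto
    then show "ht w' i q g c \<le> ht w' i q g j" using h by auto
  qed
  then show ?thesis
    using assms r old ic up_dn(3)[OF ck] stp_length[OF st] ub by (simp add: decomp_def)
qed

text \<open>While \<open>\<gamma>\<close> lasts, the run stays above \<open>g' # R\<close>; thus
  \<open>up l1\<close> is the first position after \<open>c\<close> where the height has come down
  to that of \<open>g' # R\<close>. This yields the height conditions of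
  \<open>decomp\<close>.\<close>

lemma above_edit:
  assumes "\<alpha> @ rest w i q g c = \<gamma> @ g' # R" "popped w b q2 \<gamma> l1 p1"
  shows "run w' i (up l1) (q, [g]) = Some (p1, g' # R)"
    and "c < j \<Longrightarrow> j < up l1 \<Longrightarrow> Suc (length R) < ht w' i q g j"
proof -
  have bl: "b \<le> l1" "l1 \<le> length w" using assms(2) by (auto simp: popped_def)
  show "run w' i (up l1) (q, [g]) = Some (p1, g' # R)"
    using edit_run[OF bl(1)] popped_run[OF assms(2) order_refl, of "g' # R"] assms(1) by simp
  assume j: "c < j" "j < up l1"
  have bj: "b \<le> dn j" "dn j \<le> l1" "dn j \<noteq> l1"
    using up_dn(3)[OF j(1)] up_dn(7)[OF j(1), of l1] up_dn(1)[OF j(1)] j by auto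
  have "run w b l1 (q2, \<gamma>) = Some (p1, [])" using assms(2) by (simp add: popped_def)
  then obtain C where C: "run w b (dn j) (q2, \<gamma>) = Some C" "run w (dn j) l1 C = Some (p1, [])"
    using run_split[OF bj(1,2), of w "(q2, \<gamma>)"] by (auto simp: bind_eq_Some_conv)
  obtain p \<delta> where pd: "C = (p, \<delta>)" by (cases C)
  have ne: "\<delta> \<noteq> []" using run_Nil_stack[of w "dn j" l1 p] C(2) pd bj bl by auto
  have "run w' i j (q, [g]) = Some (p, \<delta> @ g' # R)"
    using edit_run[OF bj(1)] up_dn(1)[OF j(1)] run_under[of w b "dn j" q2 \<gamma> p \<delta> "g' # R"] C pd assms(1) by simp
  then show "Suc (length R) < ht w' i q g j" using ne by (cases \<delta>) (auto simp: ht_def)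
qed

lemma decomp_second:
  assumes "\<alpha> = [\<alpha>1, \<alpha>2]" "pp w b q2 [\<alpha>1] = Some (l1, p1)" "l1 \<le> dn k" "cf w l1 p1 \<alpha>2 (dn k) \<noteq> None"
  shows "decomp i q g k l1 p1 \<alpha>2 [] c"
proof -
  have p: "popped w b q2 [\<alpha>1] l1 p1" using assms(2) by (simp add: pp_eq_Some)
  note A = above_edit[OF _ p, of \<alpha>2 "rest w i q g c"]
  have r: "run w' i (up l1) (q, [g]) = Some (p1, \<alpha>2 # rest w i q g c)" using A assms by simp
  have h: "ht w' i q g (up l1) = ht w' i q g c" "ht w' i q g (up l1) = Suc (length (rest w i q g c))"
    using run_eq_SomeD[OF r] cf_edit_prefix(3)[of c i q g] cf_ht[OF old] by auto
  have gr: "ht w' i q g (up l1) < ht w' i q g j" if "c < j" "j < up l1" for j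
    using A(2)[of j] that h assms by simp
  have "anc (ht w' i q g) (up l1) c" unfolding anc_def
  proof (intro allI impI)
    fix j assume "c \<le> j \<and> j \<le> up l1"
    then have "j = c \<or> j = up l1 \<or> (c < j \<and> j < up l1)" by auto
    then show "ht w' i q g c \<le> ht w' i q g j" using h gr[of j] by auto
  qed
  then show ?thesis
    using assms r gr old ic p by (auto simp: decomp_def popped_def)
qed

text \<open>Everything pushed by the new letter is popped by \<open>k\<close>, and the run eats into
  the stack left at \<open>c\<close>. The symbol under way at \<open>k\<close> is found by
  \<open>cross\<close> with the bound \<open>dn k\<close>. The step from \<open>a\<close> to
  \<open>Suc a\<close> pushed it, so below it lies the stack \<open>rest w i q g a\<close>.\<close>

lemma decomp_cross:
  assumes 2: "pp w b q2 \<alpha> = Some (l2, p2)" "l2 \<le> dn k"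
    and c3: "cross w i q g c l2 p2 (dn k) = Suc a" "i \<le> a"
    and x: "cf w i q g (Suc a) = Some (x1, x2)" "cf w i q g a = Some (y1, y2)"
      "stp (w ! a) y1 y2 = Some (z1, [z2, g'])"
    and 3: "pp w l2 p2 (rest w (Suc a) x1 x2 c) = Some (l3, p3)" "cf w l3 p3 g' (dn k) \<noteq> None"
  shows "decomp i q g k l3 p3 g' [] a" "\<not> early (pp w l3 p3 [g']) (dn k)"
proof -
  have cw: "c \<le> length w" using cd by simp
  have ew: "dn k \<le> length w" using dn_le[OF kw ck] .
  have "i < cross w i q g c l2 p2 (dn k)" using c3 by simp
  then have lt: "i < cross w i q g c l2 p2 (dn k)" .
  have "decomp i q g k l3 p3 g' [] a \<and> \<not> early (pp w l3 p3 [g']) (dn k)"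
  proof (cases rule: cross_push[OF old ic cw 2(2) ew lt, consumes 0, case_names 1])
    case (1 a' r1 r2 s1 s2 h' m3 n3)
    have e: "a' = a" "r1 = y1" "r2 = y2" "s1 = x1" "s2 = x2" using 1(1,4,6) c3 x by auto
    then have e': "h' = g'" "m3 = l3" "n3 = p3" using 1(5,7) x 3 by auto
    have ac: "a < c" using 1(3) e by simp
    have rest: "\<alpha> @ rest w i q g c = (\<alpha> @ rest w (Suc a) x1 x2 c) @ g' # rest w i q g a"
      using 1(9) e e' by simp
    have p: "popped w b q2 (\<alpha> @ rest w (Suc a) x1 x2 c) l3 p3"
      using 2 3(1) by (simp add: pp_eq_Some[symmetric] pp_append)
    note A = above_edit[OF rest p]
    have h: "ht w' i q g (up l3) = ht w' i q g a" "ht w' i q g (up l3) = Suc (length (rest w i q g a))"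
      using run_eq_SomeD[OF A(1)] cf_edit_prefix(3)[of a i q g] cf_ht[OF x(2)] ac by auto
    have gr: "ht w' i q g (up l3) < ht w' i q g j" if "a < j" "j < up l3" for j
      using A(2)[of j] 1(11)[of j] cf_edit_prefix(3)[of j i q g] cf_edit_prefix(3)[of a i q g] that h ac e
      by (cases "c < j") auto
    have "anc (ht w' i q g) (up l3) a" unfolding anc_def
    proof (intro allI impI)
      fix j assume "a \<le> j \<and> j \<le> up l3"
      then have "j = a \<or> j = up l3 \<or> (a < j \<and> j < up l3)" by auto
      then show "ht w' i q g a \<le> ht w' i q g j" using h gr[of j] by auto
    qed
    then show "decomp i q g k l3 p3 g' [] a \<and> \<not> early (pp w l3 p3 [g']) (dn k)"
      using A(1) gr x 3 p ac c3 1(8) 1(10) e e' by (auto simp: decomp_def popped_def)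
  qed
  then show "decomp i q g k l3 p3 g' [] a" "\<not> early (pp w l3 p3 [g']) (dn k)" by auto
qed

text \<open>The three decompositions above exhaust the ways in which a nonempty stack can remain at
  \<open>k\<close>. It is applied in contrapositive form: if all three tests fail, the new entry is
  undefined.\<close>

lemma edit_dead:
  assumes "cf w' i q g k \<noteq> None"
  shows "(\<exists>\<alpha>1 \<beta>. \<alpha> = \<alpha>1 # \<beta> \<and> cf w b q2 \<alpha>1 (dn k) \<noteq> None) \<or>
    (\<exists>\<alpha>1 \<alpha>2 l1 p1. \<alpha> = [\<alpha>1, \<alpha>2] \<and> pp w b q2 [\<alpha>1] = Some (l1, p1) \<and> l1 \<le> dn k \<and> cf w l1 p1 \<alpha>2 (dn k) \<noteq> None) \<or>
    (\<exists>l2 p2. pp w b q2 \<alpha> = Some (l2, p2) \<and> l2 \<le> dn k \<and> i < cross w i q g c l2 p2 (dn k) \<and>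
       (\<forall>a x1 x2 y1 y2 z1 z2 g' l3 p3. cross w i q g c l2 p2 (dn k) = Suc a \<longrightarrow>
          cf w i q g (Suc a) = Some (x1, x2) \<longrightarrow> cf w i q g a = Some (y1, y2) \<longrightarrow>
          stp (w ! a) y1 y2 = Some (z1, [z2, g']) \<longrightarrow>
          pp w l2 p2 (rest w (Suc a) x1 x2 c) = Some (l3, p3) \<longrightarrow> cf w l3 p3 g' (dn k) \<noteq> None))"
proof -
  have cw: "c \<le> length w" using cd by simp
  have ew: "dn k \<le> length w" using dn_le[OF kw ck] .
  have bk: "b \<le> dn k" using up_dn(3)[OF ck] .
  have pop0: "popped w l p \<gamma> j p' \<longleftrightarrow> l \<le> j \<and> run w l j (p, \<gamma>) = Some (p', [])" if "j \<le> dn k" for l p \<gamma> j p'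
    using that ew by (auto simp: popped_def)
  obtain p \<eta> where r: "run w b (dn k) (q2, \<alpha> @ rest w i q g c) = Some (p, \<eta>)" "\<eta> \<noteq> []"
    using assms edit_run[OF bk] up_dn(1)[OF ck] by (auto simp: cf_eq_Some)
  have alive: "cf w l p1 g' (dn k) \<noteq> None" if "run w l (dn k) (p1, [g']) = Some (p, \<gamma>)" "\<gamma> \<noteq> []" for l p1 g' \<gamma>
    using that by (cases \<gamma>) (auto dest: run_eq_SomeD)
  from r(1) bk ew show ?thesis
  proof (cases rule: run_append_cases)
    case (inside \<gamma>)
    then have "\<alpha> \<noteq> []" using run_Nil_stack[of w b "dn k" q2 "(p, \<gamma>)"] by auto
    then obtain \<alpha>1 \<beta> where \<alpha>: "\<alpha> = [\<alpha>1] @ \<beta>" by (cases \<alpha>) auto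
    from inside(1)[unfolded \<alpha>] bk ew show ?thesis
    proof (cases rule: run_append_cases)
      case (inside \<gamma>')
      then show ?thesis using \<alpha> alive by auto
    next
      case (below j p1)
      then have "\<beta> \<noteq> []" using run_Nil_stack[of w j "dn k" p1 "(p, \<gamma>)"] inside by auto
      then obtain \<alpha>2 where "\<alpha> = [\<alpha>1, \<alpha>2]" using stp_length[OF st] \<alpha> by (cases \<beta>) auto
      then show ?thesis using below \<alpha> alive[of j p1 \<alpha>2 \<gamma>] inside pop0[of j b q2 "[\<alpha>1]" p1]
        by (auto simp: pp_eq_Some)
    qed
  next
    case (below l2 p2)
    have p: "pp w b q2 \<alpha> = Some (l2, p2)" using below pop0[of l2] by (simp add: pp_eq_Some)
    have ne: "cross w i q g c l2 p2 (dn k) \<noteq> i"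
    proof
      assume "cross w i q g c l2 p2 (dn k) = i"
      then obtain j p3 where j: "popped w l2 p2 (rest w i q g c) j p3" "j \<le> dn k"
        using cross_start[OF old ic cw below(2) ew, of p2] by (auto simp: early_def pp_eq_Some)
      have "run w j (dn k) (p3, []) = Some (p, \<eta>)" using popped_run[OF j, of "[]"] below(4) by simp
      then show False using run_Nil_stack[of w j "dn k" p3 "(p, \<eta>)"] r(2) by simp
    qed
    then have lt: "i < cross w i q g c l2 p2 (dn k)"
      using cross_props(1)[OF old ic cw below(2) ew, of p2] by simp
    have "cf w l3 p3 g' (dn k) \<noteq> None"
      if h: "cross w i q g c l2 p2 (dn k) = Suc a"
        "cf w i q g (Suc a) = Some (x1, x2)" "cf w i q g a = Some (y1, y2)"
        "stp (w ! a) y1 y2 = Some (z1, [z2, g'])"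
        "pp w l2 p2 (rest w (Suc a) x1 x2 c) = Some (l3, p3)" for a x1 x2 y1 y2 z1 z2 g' l3 p3
    proof (cases rule: cross_push[OF old ic cw below(2) ew lt, consumes 0, case_names 1])
      case (1 a' r1 r2 s1 s2 h' m3 n3)
      have e: "a' = a" "r1 = y1" "r2 = y2" "s1 = x1" "s2 = x2" using 1(1,4,6) h by auto
      then have e': "h' = g'" "m3 = l3" "n3 = p3" using 1(5,7) h by auto
      have pl: "popped w l2 p2 (rest w (Suc a) x1 x2 c) l3 p3" "l3 \<le> dn k"
        using h(5) 1(8) e' by (auto simp: pp_eq_Some)
      have "run w l3 (dn k) (p3, [g'] @ rest w i q g a) = Some (p, \<eta>)"
        using popped_run[OF pl, of "g' # rest w i q g a"] below(4) 1(9) e e' by simp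
      from this pl(2) ew show ?thesis
      proof (cases rule: run_append_cases)
        case (inside \<gamma>)
        then show ?thesis using alive by auto
      next
        case (below j p4)
        then show ?thesis using 1(10) e' pop0[of j l3 p3 "[g']" p4] by (auto simp: early_def pp_eq_Some)
      qed
    qed
    then show ?thesis using p below(2) lt by blast
  qed
qed

end

text \<open>When a pop that starts before the change is not finished by \<open>c\<close>, only the
  symbol \<open>g'\<close> under way at \<open>c\<close> has to be popped across the new letter. The
  symbols above it are popped in the unchanged prefix, those below it in the unchanged
  suffix.\<close>

lemma pp_rest_edit:
  assumes al: "cf w i q g k = Some x" and ik: "i \<le> k" and kl: "k \<le> l" and lc: "l \<le> c"
    and late: "\<not> early (pp w l p (rest w i q g k)) c"
    and c3: "cross w i q g k l p c = Suc a"
    and x: "cf w i q g (Suc a) = Some (x1, x2)" "cf w i q g a = Some (y1, y2)"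
      "stp (w ! a) y1 y2 = Some (z1, [z2, g'])"
    and 3: "pp w l p (rest w (Suc a) x1 x2 k) = Some (l3, p3)"
  shows "pp w' l p (rest w i q g k) = Option.bind (pp w' l3 p3 [g']) (\<lambda>(l4, p4).
      mapup (pp w (dn l4) p4 (rest w i q g a)))" "l3 \<le> c" "\<not> early (pp w l3 p3 [g']) c"
proof -
  have cw: "c \<le> length w" "k \<le> length w" using cd kl lc by auto
  have "cross w i q g k l p c \<noteq> i" using cross_start[OF al ik cw(2) lc cw(1)] late by auto
  then have lt: "i < cross w i q g k l p c" using cross_props(1)[OF al ik cw(2) lc cw(1), of p] by simp
  have "pp w' l p (rest w i q g k) = Option.bind (pp w' l3 p3 [g']) (\<lambda>(l4, p4).
      mapup (pp w (dn l4) p4 (rest w i q g a))) \<and> l3 \<le> c \<and> \<not> early (pp w l3 p3 [g']) c"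
  proof (cases rule: cross_push[OF al ik cw(2) lc cw(1) lt, consumes 0, case_names 1])
    case (1 a' r1 r2 s1 s2 h' m3 n3)
    have e: "a' = a" "r1 = y1" "r2 = y2" "s1 = x1" "s2 = x2" using 1(1,4,6) c3 x by auto
    then have e': "h' = g'" "m3 = l3" "n3 = p3" using 1(5,7) x 3 by auto
    have "pp w' l p (rest w (Suc a) x1 x2 k) = Some (l3, p3)"
      using pp_edit_early[of l p "rest w (Suc a) x1 x2 k"] 3 1(8) e' by (auto simp: early_def)
    moreover have "rest w i q g k = rest w (Suc a) x1 x2 k @ [g'] @ rest w i q g a"
      using 1(9) e e' by simp
    ultimately have "pp w' l p (rest w i q g k) = Option.bind (pp w' l3 p3 [g']) (\<lambda>(l4, p4).
      pp w' l4 p4 (rest w i q g a))" by (simp only: pp_append bind.bind_lunit case_prod_conv)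
    also have "\<dots> = Option.bind (pp w' l3 p3 [g']) (\<lambda>(l4, p4).
      mapup (pp w (dn l4) p4 (rest w i q g a)))"
    proof (cases "pp w' l3 p3 [g']")
      case (Some y)
      obtain l4 p4 where y: "y = (l4, p4)" by (cases y)
      have "\<not> early (pp w' l3 p3 [g']) c" using early_edit 1(10) e' by simp
      then have "c < l4" using Some y by (simp add: early_def)
      then show ?thesis using Some y pp_edit_suffix by simp
    qed simp
    finally show ?thesis using 1(8) 1(10) e' by simp
  qed
  then show "pp w' l p (rest w i q g k) = Option.bind (pp w' l3 p3 [g']) (\<lambda>(l4, p4).
      mapup (pp w (dn l4) p4 (rest w i q g a)))" "l3 \<le> c" "\<not> early (pp w l3 p3 [g']) c" by auto
qed

end

subsection \<open>Expressions\<close>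

text \<open>Truncated subtraction supplies the logic: \<open>1 - (1 - a)\<close> normalizes a truth
  value to 0 or 1, and \<open>a - b\<close> vanishes exactly if \<open>a <= b\<close>.\<close>

definition tt_e where "tt_e a = Op Minus (Lit 1) (Op Minus (Lit 1) a)"
definition le_e where "le_e a b = Op Minus (Lit 1) (Op Minus a b)"
definition not_e where "not_e a = Op Minus (Lit 1) a"
definition and_e where "and_e a b = Op Times (tt_e a) (tt_e b)"
definition or_e where "or_e a b = tt_e (Op Plus a b)"
definition eq_e where "eq_e a b = and_e (le_e a b) (le_e b a)"
definition lt_e where "lt_e a b = not_e (le_e b a)"
text \<open>Both branches are evaluated and the wrong one is multiplied by 0, so it may read
  meaningless cells. \<open>peak_bound\<close> makes no assumption on the meaning of cells and
  covers these readings too.\<close>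

definition if_e where "if_e g a b = Op Plus (Op Times (tt_e g) a) (Op Times (not_e g) b)"
definition mod_e where "mod_e a b = Op Minus a (Op Times b (Op Div a b))"
definition plus_e where "plus_e a b = Op Plus a b"
definition minus_e where "minus_e a b = Op Minus a b"
definition times_e where "times_e a b = Op Times a b"
primrec pow_e where "pow_e a 0 = Lit 1" | "pow_e a (Suc n) = Op Times a (pow_e a n)"

text \<open>Any nonzero number counts as true; so the code of an optional value is itself the test
  whether it is defined.\<close>

definition holds :: "memory \<Rightarrow> nat \<Rightarrow> exp \<Rightarrow> bool" where
  "holds m p e \<longleftrightarrow> eval m p e \<noteq> 0"

lemma holds_simps [simp]:
  "holds m p (le_e a b) \<longleftrightarrow> eval m p a \<le> eval m p b"
  "holds m p (not_e a) \<longleftrightarrow> \<not> holds m p a"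
  "holds m p (and_e a b) \<longleftrightarrow> holds m p a \<and> holds m p b"
  "holds m p (or_e a b) \<longleftrightarrow> holds m p a \<or> holds m p b"
  "holds m p (eq_e a b) \<longleftrightarrow> eval m p a = eval m p b"
  "holds m p (lt_e a b) \<longleftrightarrow> eval m p a < eval m p b"
  by (auto simp: holds_def le_e_def not_e_def and_e_def or_e_def eq_e_def lt_e_def tt_e_def)

lemma eval_simps [simp]:
  "eval m p (if_e g a b) = (if holds m p g then eval m p a else eval m p b)"
  "eval m p (mod_e a b) = eval m p a mod eval m p b"
  "eval m p (plus_e a b) = eval m p a + eval m p b"
  "eval m p (minus_e a b) = eval m p a - eval m p b"
  "eval m p (times_e a b) = eval m p a * eval m p b"
  "eval m p (pow_e a n) = eval m p a ^ n"
proof -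
  show "eval m p (if_e g a b) = (if holds m p g then eval m p a else eval m p b)"
    by (auto simp: if_e_def holds_def not_e_def tt_e_def)
  show "eval m p (mod_e a b) = eval m p a mod eval m p b"
    by (simp add: mod_e_def minus_mult_div_eq_mod)
  show "eval m p (pow_e a n) = eval m p a ^ n" by (induction n) auto
qed (simp_all add: plus_e_def minus_e_def times_e_def)

lemma eval_if_e: "eval m p (if_e g a b) = r"
  if "holds m p g \<Longrightarrow> eval m p a = r" "\<not> holds m p g \<Longrightarrow> eval m p b = r"
  using that by simp

subsection \<open>Addresses\<close>

text \<open>With \<open>t = x + y\<close> the number \<open>t * t + x\<close> determines
  \<open>x\<close> and \<open>y\<close>, as \<open>x <= t\<close> keeps it below the next square. It
  needs only sums and products. The successor separates the empty list from all others, so keys of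
  different length never collide.\<close>

fun cell :: "nat list \<Rightarrow> nat" where
  "cell [] = 0"
| "cell (x # xs) = Suc ((x + cell xs) * (x + cell xs) + x)"

lemma pair_less:
  assumes "x + y < x' + (y'::nat)"
  shows "(x + y) * (x + y) + x < (x' + y') * (x' + y') + x'"
proof -
  have "(x + y) * (x + y) + x < Suc (x + y) * Suc (x + y)" by (simp add: algebra_simps)
  also have "\<dots> \<le> (x' + y') * (x' + y')" using assms by (intro mult_le_mono) auto
  finally show ?thesis by simp
qed

lemma cell_inject [simp]: "cell xs = cell ys \<longleftrightarrow> xs = ys"
proof (induction xs arbitrary: ys)
  case Nil
  then show ?case by (cases ys) auto
next
  case (Cons x xs)
  show ?case
  proof (cases ys)
    case (Cons y ys')
    have "x = y \<and> cell xs = cell ys'"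
      if "(x + cell xs) * (x + cell xs) + x = (y + cell ys') * (y + cell ys') + y"
    proof (cases "x + cell xs = y + cell ys'")
      case True
      then show ?thesis using that by simp
    next
      case False
      then show ?thesis using that pair_less[of x "cell xs" y "cell ys'"]
          pair_less[of y "cell ys'" x "cell xs"] by (metis nat_neq_iff)
    qed
    then show ?thesis using Cons Cons.IH[of ys'] by auto
  qed simp
qed

text \<open>Cells 0 to 3 carry the number of processors, the arguments and the answer; the internal
  data stay off them.\<close>

lemma cell_gt_3: "2 \<le> h \<Longrightarrow> 3 < cell (h # ks)"
proof -
  assume "2 \<le> h"
  then have "2 * 2 \<le> (h + cell ks) * (h + cell ks)" by (intro mult_le_mono) auto
  then show "3 < cell (h # ks)" by simp
qed

declare cell.simps(2) [simp del]

fun addr :: "exp list \<Rightarrow> exp" where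
  "addr [] = Lit 0"
| "addr (e # es) = Op Plus (Op Plus (Op Times (Op Plus e (addr es)) (Op Plus e (addr es))) e) (Lit 1)"

lemma eval_addr [simp]: "eval m p (addr es) = cell (map (eval m p) es)"
  by (induction es) (simp_all add: cell.simps(2))

declare addr.simps [simp del]

text \<open>A processor whose guard fails writes 0 to the dummy cell \<open>cell [2]\<close>, so that all processors
  stay in lockstep.\<close>

definition store :: "exp \<Rightarrow> exp list \<Rightarrow> exp \<Rightarrow> stmt" where
  "store g as v = (if_e g (addr as) (Lit (cell [2])), if_e g v (Lit 0))"

text \<open>Many processors share a key, as they differ only in fields that do not occur in it.
  Their concurrent writes agree because the stored value is a function \<open>F\<close> of the
  key.\<close>

lemma store_correct:
  assumes F: "\<forall>p<P. holds m p g \<longrightarrow> map (eval m p) as = h # key p \<and> eval m p v = F (key p)"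
    and h: "h \<noteq> 2"
  shows "consistent P (store g as v) m"
    and "p < P \<Longrightarrow> holds m p g \<Longrightarrow> exec_stmt P (store g as v) m (cell (h # key p)) = F (key p)"
    and "x \<noteq> cell [2] \<Longrightarrow> (\<And>\<kappa>. x \<noteq> cell (h # \<kappa>)) \<Longrightarrow> exec_stmt P (store g as v) m x = m x"
    and "(\<And>p. p < P \<Longrightarrow> holds m p g \<Longrightarrow> F (key p) \<le> V) \<Longrightarrow> m x \<le> V \<Longrightarrow>
      exec_stmt P (store g as v) m x \<le> V"
proof -
  have a: "eval m p (fst (store g as v)) = (if holds m p g then cell (h # key p) else cell [2])"
    "eval m p (snd (store g as v)) = (if holds m p g then F (key p) else 0)" if "p < P" for p
    using F that by (simp_all add: store_def)
  show c: "consistent P (store g as v) m"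
    using h a by (auto simp: consistent_def)
  have e: "exec_stmt P (store g as v) m x = eval m p (snd (store g as v))"
    if "p < P" "eval m p (fst (store g as v)) = x" for p x
  proof -
    have ex: "\<exists>p<P. eval m p (fst (store g as v)) = x" using that by blast
    define p' where "p' = (SOME p. p < P \<and> eval m p (fst (store g as v)) = x)"
    have "p' < P \<and> eval m p' (fst (store g as v)) = x" unfolding p'_def by (rule someI_ex[OF ex])
    then have "eval m p' (snd (store g as v)) = eval m p (snd (store g as v))"
      using c that unfolding consistent_def by metis
    moreover have "exec_stmt P (store g as v) m x = eval m p' (snd (store g as v))"
      unfolding exec_stmt_def p'_def using ex by (rule if_P)
    ultimately show ?thesis by simp
  qed
  show "p < P \<Longrightarrow> holds m p g \<Longrightarrow> exec_stmt P (store g as v) m (cell (h # key p)) = F (key p)"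
    using e[of p "cell (h # key p)"] a[of p] by simp
  show "exec_stmt P (store g as v) m x = m x" if "x \<noteq> cell [2]" "\<And>\<kappa>. x \<noteq> cell (h # \<kappa>)"
  proof -
    have "\<not> (\<exists>p<P. eval m p (fst (store g as v)) = x)" using a that by metis
    then show ?thesis unfolding exec_stmt_def by (rule if_not_P)
  qed
  show "exec_stmt P (store g as v) m x \<le> V"
    if "\<And>p. p < P \<Longrightarrow> holds m p g \<Longrightarrow> F (key p) \<le> V" "m x \<le> V"
  proof (cases "\<exists>p<P. eval m p (fst (store g as v)) = x")
    case True
    then obtain p where p: "p < P" "eval m p (fst (store g as v)) = x" by blast
    then show ?thesis using e[OF p] a[OF p(1)] that(1)[OF p(1)] by simp
  next
    case False
    then have "exec_stmt P (store g as v) m x = m x" unfolding exec_stmt_def by (rule if_not_P)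
    then show ?thesis using that(2) by simp
  qed
qed

lemma exec_scalar:
  assumes "P > 0" "\<And>p. p < P \<Longrightarrow> eval m p v = y"
  shows "consistent P (Lit a, v) m" "exec_stmt P (Lit a, v) m = m(a := y)"
proof -
  show "consistent P (Lit a, v) m" using assms by (simp add: consistent_def)
  have "eval m (SOME p. p < P) v = y" using someI_ex[of "\<lambda>p. p < P"] assms by auto
  moreover have "(\<exists>p<P. eval m p (Lit a) = x) \<longleftrightarrow> x = a" for x using assms(1) by auto
  ultimately show "exec_stmt P (Lit a, v) m = m(a := y)"
    unfolding exec_stmt_def by (intro ext) simp
qed

subsection \<open>Processor fields\<close>

text \<open>The processor number is read in mixed radix: a digit below \<open>D\<close> for the searches, three
  positions below \<open>D ^ rd\<close> and three machine symbols below \<open>cap\<close>.\<close>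

definition D_e where "D_e = Cell (Lit (cell [3]))"
definition len_e where "len_e = Cell (Lit (cell [4]))"
definition par_e where "par_e = Cell (Lit (cell [5]))"

definition "rem1 = Op Div Pid D_e"
definition "rem2 rd = Op Div rem1 (pow_e D_e rd)"
definition "rem3 rd = Op Div (rem2 rd) (pow_e D_e rd)"
definition "rem4 rd = Op Div (rem3 rd) (pow_e D_e rd)"
definition "rem5 rd cap = Op Div (rem4 rd) (Lit cap)"
definition "rem6 rd cap = Op Div (rem5 rd cap) (Lit cap)"
definition "fa = mod_e Pid D_e"
definition "fi rd = mod_e rem1 (pow_e D_e rd)"
definition "fk rd = mod_e (rem2 rd) (pow_e D_e rd)"
definition "fl rd = mod_e (rem3 rd) (pow_e D_e rd)"
definition "fq rd cap = mod_e (rem4 rd) (Lit cap)"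
definition "fg rd cap = mod_e (rem5 rd cap) (Lit cap)"
definition "fp rd cap = mod_e (rem6 rd cap) (Lit cap)"

lemmas field_defs = rem1_def rem2_def rem3_def rem4_def rem5_def rem6_def fa_def fi_def fk_def
  fl_def fq_def fg_def fp_def D_e_def

definition nprocs :: "nat \<Rightarrow> nat \<Rightarrow> nat \<Rightarrow> nat" where
  "nprocs rd cap D = D * (D ^ rd * (D ^ rd * (D ^ rd * (cap * (cap * cap)))))"

lemma mixed_radix_less: "a < n \<Longrightarrow> x < k \<Longrightarrow> a + n * x < n * (k::nat)"
proof -
  assume a: "a < n" "x < k"
  then have "a + n * x < n * Suc x" by simp
  also have "\<dots> \<le> n * k" using a by (intro mult_le_mono) auto
  finally show ?thesis .
qed

text \<open>Surjectivity is what counts: every table entry must be computed by some processor, and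
  in a search every digit must be tried.\<close>

lemma fields_surj:
  assumes "a < D" "i < D ^ rd" "k < D ^ rd" "l < D ^ rd" "q < cap" "g < cap" "x < cap"
  obtains p where "p < nprocs rd cap D"
    "\<And>m. m (cell [3]) = D \<Longrightarrow> eval m p fa = a \<and> eval m p (fi rd) = i \<and> eval m p (fk rd) = k \<and>
       eval m p (fl rd) = l \<and> eval m p (fq rd cap) = q \<and> eval m p (fg rd cap) = g \<and> eval m p (fp rd cap) = x"
proof -
  let ?N = "D ^ rd"
  define p where "p = a + D * (i + ?N * (k + ?N * (l + ?N * (q + cap * (g + cap * x)))))"
  have "p < nprocs rd cap D"
    unfolding p_def nprocs_def by (intro mixed_radix_less assms)
  moreover have "eval m p fa = a \<and> eval m p (fi rd) = i \<and> eval m p (fk rd) = k \<and>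
       eval m p (fl rd) = l \<and> eval m p (fq rd cap) = q \<and> eval m p (fg rd cap) = g \<and> eval m p (fp rd cap) = x"
    if m: "m (cell [3]) = D" for m
    using assms by (simp add: field_defs m p_def)
  ultimately show ?thesis using that by blast
qed

subsection \<open>Searching for a threshold\<close>

text \<open>The digits found so far are kept in the result cell itself. Round 0 starts from 0 and
  ignores what an earlier operation has left there.\<close>

definition lo_e where "lo_e h ks r = (if r = 0 then Lit 0 else Cell (addr (Lit h # ks)))"

definition cand_e where
  "cand_e rd h ks r = plus_e (lo_e h ks r) (times_e fa (pow_e D_e (rd - 1 - r)))"

text \<open>In round \<open>r\<close> the processors of a key try the \<open>D\<close> candidates
  that extend the digits found by one more. The winner is a candidate not above the threshold such
  that adding the distance of this round leads above it; it is unique, so the writes agree.\<close>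

definition search_stmt :: "nat \<Rightarrow> nat \<Rightarrow> exp list \<Rightarrow> exp \<Rightarrow> (exp \<Rightarrow> exp) \<Rightarrow> nat \<Rightarrow> stmt" where
  "search_stmt rd h ks g pr r = store (and_e g (and_e (pr (cand_e rd h ks r))
     (not_e (pr (plus_e (cand_e rd h ks r) (pow_e D_e (rd - 1 - r))))))) (Lit h # ks) (cand_e rd h ks r)"

definition search_prog :: "nat \<Rightarrow> nat \<Rightarrow> exp list \<Rightarrow> exp \<Rightarrow> (exp \<Rightarrow> exp) \<Rightarrow> stmt list" where
  "search_prog rd h ks g pr = map (search_stmt rd h ks g pr) [0..<rd]"

definition same_off :: "nat set \<Rightarrow> memory \<Rightarrow> memory \<Rightarrow> bool" where
  "same_off H m m' \<longleftrightarrow> (\<forall>x. x \<noteq> cell [2] \<longrightarrow> (\<forall>h\<in>H. \<forall>\<kappa>. x \<noteq> cell (h # \<kappa>)) \<longrightarrow> m' x = m x)"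

lemma same_off_refl [simp]: "same_off H m m"
  by (simp add: same_off_def)

lemma same_off_trans: "same_off H m m' \<Longrightarrow> same_off H m' m'' \<Longrightarrow> same_off H m m''"
  by (simp add: same_off_def)

lemma same_off_mono: "same_off H m m' \<Longrightarrow> H \<subseteq> H' \<Longrightarrow> same_off H' m m'"
  unfolding same_off_def by blast

text \<open>After \<open>r\<close> rounds the cell holds \<open>T\<close> rounded down to a multiple
  of \<open>D ^ (rd - r)\<close>. The assumptions speak of all memories satisfying
  \<open>Vw\<close>, because the search changes its own cells between rounds while keys, guard and
  predicate must keep their meaning.\<close>

lemma search_correct:
  fixes T :: "nat list \<Rightarrow> nat"
  assumes view: "\<And>m'. same_off {h} m m' \<Longrightarrow> Vw m'" and h: "h \<noteq> 2"
    and D: "0 < D" "\<And>m'. Vw m' \<Longrightarrow> m' (cell [3]) = D"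
    and key: "\<And>m' p. Vw m' \<Longrightarrow> map (eval m' p) ks = key p"
    and gd: "\<And>m' p. Vw m' \<Longrightarrow> holds m' p g \<longleftrightarrow> gd p"
    and pr: "\<And>m' p X. Vw m' \<Longrightarrow> gd p \<Longrightarrow> holds m' p (pr X) \<longleftrightarrow> eval m' p X \<le> T (key p)"
    and T: "\<And>p. gd p \<Longrightarrow> T (key p) < D ^ rd"
    and digits: "\<And>p a. p < P \<Longrightarrow> gd p \<Longrightarrow> a < D \<Longrightarrow>
       \<exists>p'<P. gd p' \<and> key p' = key p \<and> p' mod D = a"
    and rd: "0 < rd"
  shows "all_consistent P (search_prog rd h ks g pr) m"
    and "same_off {h} m (exec P (search_prog rd h ks g pr) m)"
    and "p < P \<Longrightarrow> gd p \<Longrightarrow> exec P (search_prog rd h ks g pr) m (cell (h # key p)) = T (key p)"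
    and "(\<And>x. m x \<le> V) \<Longrightarrow> D ^ rd \<le> V \<Longrightarrow> exec P (search_prog rd h ks g pr) m x \<le> V"
proof -
  define pre where "pre r = map (search_stmt rd h ks g pr) [0..<r]" for r
  have pre_Suc: "pre (Suc r) = pre r @ [search_stmt rd h ks g pr r]" for r by (simp add: pre_def)
  have main: "all_consistent P (pre r) m \<and> same_off {h} m (exec P (pre r) m) \<and>
    (0 < r \<longrightarrow> (\<forall>p<P. gd p \<longrightarrow> exec P (pre r) m (cell (h # key p)) = D ^ (rd - r) * (T (key p) div D ^ (rd - r)))) \<and>
    ((\<forall>x. m x \<le> V) \<longrightarrow> D ^ rd \<le> V \<longrightarrow> (\<forall>x. exec P (pre r) m x \<le> V))"
    if "r \<le> rd" for r
    using that
  proof (induction r)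
    case 0
    then show ?case by (simp add: pre_def)
  next
    case (Suc r)
    let ?m = "exec P (pre r) m" and ?B = "D ^ (rd - Suc r)" and ?B' = "D ^ (rd - r)"
    have IH: "all_consistent P (pre r) m" "same_off {h} m ?m"
      "0 < r \<longrightarrow> (\<forall>p<P. gd p \<longrightarrow> ?m (cell (h # key p)) = ?B' * (T (key p) div ?B'))"
      "(\<forall>x. m x \<le> V) \<longrightarrow> D ^ rd \<le> V \<longrightarrow> (\<forall>x. ?m x \<le> V)"
      using Suc by auto
    have vw: "Vw ?m" using view IH(2) .
    have Dm: "?m (cell [3]) = D" using D(2)[OF vw] .
    have B': "?B' = D * ?B" using Suc.prems by (simp add: Suc_diff_Suc power_Suc[symmetric] del: power_Suc)
    have B0: "0 < ?B" using D by simp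
    have lo: "eval ?m p (lo_e h ks r) = ?B' * (T (key p) div ?B')" if "p < P" "gd p" for p
    proof (cases "r = 0")
      case True
      then show ?thesis using T[OF that(2)] by (simp add: lo_e_def)
    next
      case False
      then show ?thesis using IH(3) that key[OF vw, of p] by (simp add: lo_e_def)
    qed
    have cand: "eval ?m p (cand_e rd h ks r) = ?B * (D * (T (key p) div ?B') + p mod D)"
      if "p < P" "gd p" for p
      using lo[OF that] Suc.prems Dm by (simp add: cand_e_def fa_def D_e_def B' algebra_simps)
    let ?G = "and_e g (and_e (pr (cand_e rd h ks r)) (not_e (pr (plus_e (cand_e rd h ks r) (pow_e D_e (rd - 1 - r))))))"
    define F where "F \<kappa> = ?B * (T \<kappa> div ?B)" for \<kappa>
    have G: "holds ?m p ?G \<longleftrightarrow> gd p \<and> eval ?m p (cand_e rd h ks r) = F (key p)" if "p < P" for p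
    proof (cases "gd p")
      case True
      define y where "y = D * (T (key p) div ?B') + p mod D"
      have c: "eval ?m p (cand_e rd h ks r) = ?B * y" using cand[OF that True] by (simp add: y_def)
      have "holds ?m p ?G \<longleftrightarrow> ?B * y \<le> T (key p) \<and> \<not> ?B * y + ?B \<le> T (key p)"
        using gd[OF vw, of p] True pr[OF vw True] c Dm by (simp add: D_e_def)
      also have "\<dots> \<longleftrightarrow> y = T (key p) div ?B"
      proof
        assume a: "?B * y \<le> T (key p) \<and> \<not> ?B * y + ?B \<le> T (key p)"
        show "y = T (key p) div ?B"
          by (rule sym, rule div_nat_eqI) (use a in \<open>auto simp: mult.commute\<close>)
      next
        assume y: "y = T (key p) div ?B"
        have "T (key p) = ?B * y + T (key p) mod ?B" unfolding y by simp
        moreover have "T (key p) mod ?B < ?B" using B0 by simp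
        ultimately show "?B * y \<le> T (key p) \<and> \<not> ?B * y + ?B \<le> T (key p)" by linarith
      qed
      also have "\<dots> \<longleftrightarrow> eval ?m p (cand_e rd h ks r) = F (key p)"
        using D(1) unfolding c F_def by simp
      finally show ?thesis using True by simp
    next
      case False
      then show ?thesis using gd[OF vw, of p] by simp
    qed
    have st: "\<forall>p<P. holds ?m p ?G \<longrightarrow>
      map (eval ?m p) (Lit h # ks) = h # key p \<and> eval ?m p (cand_e rd h ks r) = F (key p)"
      using G key[OF vw] by simp
    note S = store_correct[where m = ?m and P = P and g = ?G and as = "Lit h # ks" and F = F and key = key
        and v = "cand_e rd h ks r", OF st h, folded search_stmt_def]
    have so: "same_off {h} ?m (exec_stmt P (search_stmt rd h ks g pr r) ?m)"
      unfolding same_off_def using S(3) by simp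
    have val: "exec_stmt P (search_stmt rd h ks g pr r) ?m (cell (h # key p)) = F (key p)"
      if p: "p < P" "gd p" for p
    proof -
      \<comment> \<open>This is the digit of the current round; \<open>digits\<close> provides a
        processor of the same key that tries it.\<close>
      have "(T (key p) div ?B) mod D < D" using D by simp
      then obtain p' where p': "p' < P" "gd p'" "key p' = key p" "p' mod D = (T (key p) div ?B) mod D"
        using digits p by blast
      have "T (key p) div ?B' = T (key p) div ?B div D"
        unfolding B' by (metis div_mult2_eq mult.commute)
      then have "eval ?m p' (cand_e rd h ks r) = F (key p')"
        using cand[OF p'(1,2)] p' by (simp add: F_def)
      then show ?thesis using S(2)[OF p'(1)] G[OF p'(1)] p' by simp
    qed
    have bd: "exec_stmt P (search_stmt rd h ks g pr r) ?m x \<le> V"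
      if "\<forall>x. m x \<le> V" "D ^ rd \<le> V" for x
    proof (rule S(4))
      fix p assume p: "p < P" "holds ?m p ?G"
      have "F (key p) \<le> T (key p)" unfolding F_def by simp
      then show "F (key p) \<le> V" using T[of p] G[OF p(1)] p(2) that(2) by linarith
    qed (use IH(4) that in auto)
    show ?case
      unfolding pre_Suc all_consistent_append exec_append
      using IH(1) S(1) same_off_trans[OF IH(2) so] val bd by (simp add: F_def)
  qed
  have e: "pre rd = search_prog rd h ks g pr" by (simp add: pre_def search_prog_def)
  note M = main[OF order_refl, unfolded e]
  show "all_consistent P (search_prog rd h ks g pr) m"
    "same_off {h} m (exec P (search_prog rd h ks g pr) m)" using M by auto
  show "p < P \<Longrightarrow> gd p \<Longrightarrow> exec P (search_prog rd h ks g pr) m (cell (h # key p)) = T (key p)"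
    using M rd by simp
  show "(\<And>x. m x \<le> V) \<Longrightarrow> D ^ rd \<le> V \<Longrightarrow> exec P (search_prog rd h ks g pr) m x \<le> V"
    using M by simp
qed

subsection \<open>Tables in memory\<close>

context stack_machine
begin

definition opc :: "(nat \<times> nat) option \<Rightarrow> nat" where
  "opc z = (case z of None \<Rightarrow> 0 | Some (a, b) \<Rightarrow> Suc (a * cap + b))"

lemma opc_simps [simp]: "opc None = 0" "opc (Some (a, b)) = Suc (a * cap + b)"
  "opc z = 0 \<longleftrightarrow> z = None" "0 < opc z \<longleftrightarrow> z \<noteq> None"
  by (auto simp: opc_def split: option.splits)

text \<open>Every table is kept twice, and \<open>par\<close> tells which copy is current. Entries with \<open>i = k\<close>
  are not stored where they are trivial, so that the zero memory represents the empty string.\<close>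

definition tables :: "nat list \<Rightarrow> nat \<Rightarrow> memory \<Rightarrow> bool" where
  "tables w par m \<longleftrightarrow>
     (\<forall>j<length w. m (cell [8 + par, j]) = w ! j) \<and>
     (\<forall>i k q g. i < k \<longrightarrow> k \<le> length w \<longrightarrow> q < cap \<longrightarrow> g < cap \<longrightarrow>
        m (cell [10 + par, i, q, g, k]) = opc (cf w i q g k)) \<and>
     (\<forall>l q g. l \<le> length w \<longrightarrow> q < cap \<longrightarrow> g < cap \<longrightarrow>
        m (cell [12 + par, l, q, g]) = opc (pp w l q [g])) \<and>
     (\<forall>i k x q g. i \<le> x \<longrightarrow> x \<le> k \<longrightarrow> k \<le> length w \<longrightarrow> q < cap \<longrightarrow> g < cap \<longrightarrow> cf w i q g k \<noteq> None \<longrightarrow>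
        m (cell [14 + par, i, q, g, k, x]) = lastanc (ht w i q g) i k x) \<and>
     (\<forall>i k l q g p. i < k \<longrightarrow> k \<le> l \<longrightarrow> l \<le> length w \<longrightarrow> q < cap \<longrightarrow> g < cap \<longrightarrow> p < cap \<longrightarrow>
        cf w i q g k \<noteq> None \<longrightarrow>
        m (cell [16 + par, i, q, g, k, l, p]) = opc (pp w l p (rest w i q g k)))"

section \<open>Operations on coded options and table lookups\<close>

definition "some_e A B = plus_e (plus_e (times_e A (Lit cap)) B) (Lit 1)"
definition "fst_e e = Op Div (minus_e e (Lit 1)) (Lit cap)"
definition "snd_e e = mod_e (minus_e e (Lit 1)) (Lit cap)"
text \<open>The continuation receives expressions, so \<open>e\<close> is copied wherever a
  component of its value is used. This enlarges the program, but independently of the length of the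
  string.\<close>

definition "bind_e e f = if_e e (f (fst_e e) (snd_e e)) (Lit 0)"
definition "early_e e E = and_e e (le_e (fst_e e) E)"
text \<open>The heads of the tables are even and \<open>par\<close> is 0 or 1; so the two copies of
  a table have the heads \<open>h\<close> and \<open>h + 1\<close>.\<close>

definition "old_e h es = Cell (addr (plus_e (Lit h) par_e # es))"
definition "let_e J = old_e 8 [J]"
definition "cf_e I Q G K = if_e (eq_e K I) (some_e Q G) (old_e 10 [I, Q, G, K])"
definition "pp_e L Q G = old_e 12 [L, Q, G]"
definition "an_e I Q G K X = old_e 14 [I, Q, G, K, X]"
definition "fu_e I Q G K L P = if_e (eq_e K I) (some_e L P) (old_e 16 [I, Q, G, K, L, P])"

lemma eval_some_e [simp]: "eval m p (some_e A B) = Suc (eval m p A * cap + eval m p B)"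
  by (simp add: some_e_def)

lemma eval_fst_snd:
  assumes "eval m p e = opc z" "z = Some (a, b)" "b < cap"
  shows "eval m p (fst_e e) = a" "eval m p (snd_e e) = b" "holds m p e"
  using assms by (auto simp: fst_e_def snd_e_def holds_def)

lemma eval_bind_e:
  assumes "eval m p e = opc z" "\<And>a b. z = Some (a, b) \<Longrightarrow> b < cap"
    and "z = None \<Longrightarrow> r = 0"
    and "\<And>a b. z = Some (a, b) \<Longrightarrow> b < cap \<Longrightarrow> eval m p (fst_e e) = a \<Longrightarrow> eval m p (snd_e e) = b \<Longrightarrow>
      eval m p (f (fst_e e) (snd_e e)) = r"
  shows "eval m p (bind_e e f) = r"
proof (cases z)
  case None
  then show ?thesis using assms by (simp add: bind_e_def holds_def)
next
  case (Some y)
  obtain a b where y: "z = Some (a, b)" using Some by (cases y) auto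
  note E = eval_fst_snd[OF assms(1) y assms(2)[OF y]]
  show ?thesis using assms(4)[OF y assms(2)[OF y] E(1,2)] E(3) by (simp add: bind_e_def)
qed

lemma holds_bind_e:
  assumes "eval m p e = opc z" "\<And>a b. z = Some (a, b) \<Longrightarrow> b < cap"
    and "\<And>a b. z = Some (a, b) \<Longrightarrow> b < cap \<Longrightarrow> eval m p (fst_e e) = a \<Longrightarrow> eval m p (snd_e e) = b \<Longrightarrow>
      holds m p (f (fst_e e) (snd_e e)) \<longleftrightarrow> R a b"
  shows "holds m p (bind_e e f) \<longleftrightarrow> (\<exists>a b. z = Some (a, b) \<and> R a b)"
proof (cases z)
  case None
  then show ?thesis using assms by (simp add: bind_e_def holds_def)
next
  case (Some y)
  obtain a b where y: "z = Some (a, b)" using Some by (cases y) auto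
  note E = eval_fst_snd[OF assms(1) y assms(2)[OF y]]
  have "eval m p (bind_e e f) = eval m p (f (fst_e e) (snd_e e))" using E(3) by (simp add: bind_e_def)
  then have "holds m p (bind_e e f) \<longleftrightarrow> R a b"
    using assms(3)[OF y assms(2)[OF y] E(1,2)] by (simp add: holds_def)
  then show ?thesis using y by simp
qed

lemma holds_early_e:
  assumes "eval m p e = opc z" "\<And>a b. z = Some (a, b) \<Longrightarrow> b < cap" "eval m p E = k"
  shows "holds m p (early_e e E) \<longleftrightarrow> early z k"
proof (cases z)
  case None
  then show ?thesis using assms by (simp add: early_e_def holds_def[of m p e] early_def)
next
  case (Some y)
  obtain a b where y: "z = Some (a, b)" using Some by (cases y) auto
  note E = eval_fst_snd[OF assms(1) y assms(2)[OF y]]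
  show ?thesis using E assms(3) y by (simp add: early_e_def early_def)
qed

text \<open>0 means no transition, 1 a pop, 2 a replacement of the top symbol and 3 a push; the
  comparisons in \<open>resume_e\<close> and \<open>branch_e\<close> refer to these numbers.\<close>

definition kind :: "nat \<Rightarrow> nat \<Rightarrow> nat \<Rightarrow> nat" where
  "kind a q g = (case stp a q g of None \<Rightarrow> 0 | Some (q', \<alpha>) \<Rightarrow> Suc (length \<alpha>))"
definition nextq :: "nat \<Rightarrow> nat \<Rightarrow> nat \<Rightarrow> nat" where
  "nextq a q g = (case stp a q g of None \<Rightarrow> 0 | Some (q', \<alpha>) \<Rightarrow> q')"
definition nextg :: "nat \<Rightarrow> nat \<Rightarrow> nat \<Rightarrow> nat \<Rightarrow> nat" where
  "nextg j a q g = (case stp a q g of None \<Rightarrow> 0 | Some (q', \<alpha>) \<Rightarrow> \<alpha> ! j)"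

end

locale table_prog = stack_machine stp cap
  for stp :: "nat \<Rightarrow> nat \<Rightarrow> nat \<Rightarrow> (nat \<times> nat list) option" and cap :: nat +
  fixes al :: "nat list" and rd :: nat
  assumes rd: "0 < rd" and cap: "0 < cap"
begin

text \<open>A function of finitely many letters, states and symbols is built into the program as a
  cascade of conditionals, so the automaton itself occupies no memory.\<close>

definition tab_e :: "(nat \<Rightarrow> nat \<Rightarrow> nat \<Rightarrow> nat) \<Rightarrow> exp \<Rightarrow> exp \<Rightarrow> exp \<Rightarrow> exp" where
  "tab_e f A Q G = foldr (\<lambda>(a, q, g) e.
     if_e (and_e (eq_e A (Lit a)) (and_e (eq_e Q (Lit q)) (eq_e G (Lit g)))) (Lit (f a q g)) e)
     (List.product al (List.product [0..<cap] [0..<cap])) (Lit 0)"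

lemma eval_tab_e:
  assumes "eval m p A \<in> set al" "eval m p Q < cap" "eval m p G < cap"
  shows "eval m p (tab_e f A Q G) = f (eval m p A) (eval m p Q) (eval m p G)"
proof -
  have "eval m p (foldr (\<lambda>(a, q, g) e.
     if_e (and_e (eq_e A (Lit a)) (and_e (eq_e Q (Lit q)) (eq_e G (Lit g)))) (Lit (f a q g)) e) xs (Lit 0)) =
     (if (eval m p A, eval m p Q, eval m p G) \<in> set xs then f (eval m p A) (eval m p Q) (eval m p G) else 0)"
    for xs
  proof (induction xs)
    case (Cons x xs)
    obtain a q g where "x = (a, q, g)" by (cases x)
    then show ?case using Cons by simp
  qed simp
  then show ?thesis using assms unfolding tab_e_def by simp
qed

section \<open>Expressions for the entries after a change\<close>

definition "dn_e d X = minus_e (plus_e X (Lit d)) (Lit 1)"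
definition "up_e d X = minus_e (plus_e X (Lit 1)) (Lit d)"
definition "b_e d C = plus_e C (Lit d)"
definition "nl_e d = minus_e (plus_e len_e (Lit 1)) (Lit d)"
definition "sym_e = Cell (Lit 2)"
definition "kind_e = tab_e kind sym_e"
definition "nq_e = tab_e nextq sym_e"
definition "n1_e = tab_e (nextg 0) sym_e"
definition "n2_e = tab_e (nextg 1) sym_e"

definition "resume_e d C I Q G = bind_e (cf_e I Q G C) (\<lambda>A B.
  if_e (eq_e (kind_e A B) (Lit 0)) (Lit 0)
  (if_e (eq_e (kind_e A B) (Lit 1)) (some_e (b_e d C) (nq_e A B))
  (if_e (eq_e (kind_e A B) (Lit 2)) (pp_e (b_e d C) (nq_e A B) (n1_e A B))
  (bind_e (pp_e (b_e d C) (nq_e A B) (n1_e A B)) (\<lambda>L P. pp_e L P (n2_e A B))))))"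

definition "ok_e I Q G K L P E X = bind_e (cf_e I Q G (an_e I Q G K X)) (\<lambda>A B.
  bind_e (fu_e (an_e I Q G K X) A B K L P) (\<lambda>L1 P1. le_e L1 E))"

definition "le_cross_e I Q G K L P E X =
  and_e (le_e X K) (or_e (le_e X I) (not_e (ok_e I Q G K L P E (minus_e X (Lit 1)))))"

text \<open>A push replaces the top symbol by \<open>[g2, g']\<close>; index 1 is the symbol put
  below the top.\<close>

definition "pushed_e I Q G A = bind_e (cf_e I Q G A) (\<lambda>Q1 G1. tab_e (nextg 1) (let_e A) Q1 G1)"

text \<open>\<open>X\<close> is the result of the search for \<open>cross\<close>.\<close>

definition "cross_e X I Q G K L P f = if_e (lt_e I X) (bind_e (cf_e I Q G X) (\<lambda>A B.
  bind_e (fu_e X A B K L P) (\<lambda>L3 P3. f L3 P3 (pushed_e I Q G (minus_e X (Lit 1))) (minus_e X (Lit 1))))) (Lit 0)"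

definition "mapup_e d e = bind_e e (\<lambda>L P. some_e (up_e d L) P)"

text \<open>The five arguments of \<open>f\<close> stand for \<open>l\<close>, \<open>p\<close>, \<open>g1\<close>, \<open>\<beta>\<close> and \<open>a\<close> in \<open>decomp\<close>; \<open>\<beta>\<close> is
  given by its length and its element.\<close>

definition "branch_e d C I Q G K f A B =
  if_e (and_e (le_e (Lit 2) (kind_e A B)) (cf_e (b_e d C) (nq_e A B) (n1_e A B) (dn_e d K)))
    (f (b_e d C) (nq_e A B) (n1_e A B) (eq_e (kind_e A B) (Lit 3)) (n2_e A B) C)
  (if_e (and_e (eq_e (kind_e A B) (Lit 3))
      (and_e (early_e (pp_e (b_e d C) (nq_e A B) (n1_e A B)) (dn_e d K))
         (cf_e (fst_e (pp_e (b_e d C) (nq_e A B) (n1_e A B)))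
            (snd_e (pp_e (b_e d C) (nq_e A B) (n1_e A B))) (n2_e A B) (dn_e d K))))
    (f (fst_e (pp_e (b_e d C) (nq_e A B) (n1_e A B))) (snd_e (pp_e (b_e d C) (nq_e A B) (n1_e A B)))
       (n2_e A B) (Lit 0) (Lit 0) C)
  (if_e (early_e (resume_e d C I Q G) (dn_e d K))
    (cross_e (Cell (addr [Lit 6, I, Q, G, K])) I Q G C (fst_e (resume_e d C I Q G)) (snd_e (resume_e d C I Q G))
       (\<lambda>L3 P3 G3 A3. if_e (cf_e L3 P3 G3 (dn_e d K)) (f L3 P3 G3 (Lit 0) (Lit 0) A3) (Lit 0)))
    (Lit 0)))"

definition "decomp_e d C I Q G K f = bind_e (cf_e I Q G C) (branch_e d C I Q G K f)"

definition "new_let_e d C J = if_e (lt_e J C) (let_e J) (if_e (eq_e J C) sym_e (let_e (dn_e d J)))"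

definition "new_cf_e d C I Q G K = if_e (le_e K C) (cf_e I Q G K)
  (if_e (lt_e C I) (cf_e (dn_e d I) Q G (dn_e d K))
    (decomp_e d C I Q G K (\<lambda>L P G1 HB BV A. cf_e L P G1 (dn_e d K))))"

definition "new_pp_e d C L Q G = if_e (lt_e C L) (mapup_e d (pp_e (dn_e d L) Q G))
  (if_e (early_e (pp_e L Q G) C) (pp_e L Q G)
    (mapup_e d (bind_e (resume_e d C L Q G) (\<lambda>L2 P2. fu_e L Q G C L2 P2))))"

definition "min_e a b = if_e (le_e a b) a b"

definition "new_an_e d C I Q G K X = if_e (le_e K C) (an_e I Q G K X)
  (if_e (lt_e C I) (up_e d (an_e (dn_e d I) Q G (dn_e d K) (dn_e d X)))
    (decomp_e d C I Q G K (\<lambda>L P G1 HB BV A. if_e (le_e (up_e d L) X)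
       (up_e d (an_e L P G1 (dn_e d K) (dn_e d X))) (an_e I Q G A (min_e X A)))))"

text \<open>The branches locate the change relative to \<open>I <= K <= L\<close>. If
  \<open>L <= C\<close>, a pop finished by \<open>C\<close> is unchanged, and otherwise
  \<open>pp_rest_edit\<close> applies. The new pop of the single symbol is then computed by
  \<open>new_pp_e\<close> from the old tables and not read from the table under
  construction.\<close>

definition "new_fu_e d C I Q G K L P =
  if_e (lt_e C I) (mapup_e d (fu_e (dn_e d I) Q G (dn_e d K) (dn_e d L) P))
  (if_e (lt_e C K) (decomp_e d C I Q G K (\<lambda>L1 P1 G1 HB BV A. mapup_e d
     (bind_e (fu_e L1 P1 G1 (dn_e d K) (dn_e d L) P) (\<lambda>L2 P2.
        bind_e (if_e HB (pp_e L2 P2 BV) (some_e L2 P2)) (\<lambda>L3 P3. fu_e I Q G A L3 P3)))))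
  (if_e (lt_e C L) (mapup_e d (fu_e I Q G K (dn_e d L) P))
  (if_e (early_e (fu_e I Q G K L P) C) (fu_e I Q G K L P)
    (cross_e (Cell (addr [Lit 7, I, Q, G, K, L, P])) I Q G K L P (\<lambda>L3 P3 G3 A.
       bind_e (new_pp_e d C L3 P3 G3) (\<lambda>L4 P4. mapup_e d (fu_e I Q G A (dn_e d L4) P4)))))))"

end

section \<open>Correctness of these expressions\<close>

locale edit_view = edit stp cap w w' s c d b up dn + table_prog stp cap al rd
  for stp :: "nat \<Rightarrow> nat \<Rightarrow> nat \<Rightarrow> (nat \<times> nat list) option" and cap :: nat
    and w w' :: "nat list" and s c d b :: nat and up dn :: "nat \<Rightarrow> nat" and al :: "nat list" and rd :: nat +
  fixes C :: exp and par D :: nat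
  assumes letters: "set w \<subseteq> set al" "s \<in> set al"
begin

lemma c_le: "c \<le> length w" "b \<le> length w" "c \<le> b"
  using cd b by auto

lemma resume_range: "resume i q g = Some (l, p') \<Longrightarrow> p' < cap"
  by (auto simp: resume_def bind_eq_Some_conv dest: pp_range stp_range)

lemma resume_le: "resume i q g = Some (l, p') \<Longrightarrow> b \<le> l \<and> l \<le> length w"
  by (auto simp: resume_def bind_eq_Some_conv dest: pp_le)

definition view :: "memory \<Rightarrow> bool" where
  "view m \<longleftrightarrow> m (cell [5]) = par \<and> m (cell [4]) = length w \<and> m (cell [3]) = D \<and> m 2 = s \<and>
     tables w par m \<and> (\<forall>p. eval m p C = c)"

context
  fixes m :: memory and p :: nat
  assumes vw: "view m"
begin

lemma ev_basic [simp]: "eval m p C = c" "eval m p (old_e h es) = m (cell ((h + par) # map (eval m p) es))"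
  "eval m p sym_e = s" "eval m p (b_e d C) = b" "eval m p (nl_e d) = length w'"
  "eval m p (up_e d X) = up (eval m p X)"
  "eval m p len_e = length w" "eval m p D_e = D" "eval m p par_e = par"
  using vw len_edit by (auto simp: view_def old_e_def par_e_def sym_e_def b_e_def nl_e_def len_e_def up_e_def up b D_e_def)

text \<open>\<open>dn_e\<close> adds before it subtracts and \<open>dn\<close> subtracts first; at 0
  they differ if \<open>d\<close> is 1.\<close>

lemma ev_dn [simp]: "0 < eval m p X \<Longrightarrow> eval m p (dn_e d X) = dn (eval m p X)"
  by (auto simp: dn_e_def dn)

lemma ev_let: "eval m p J < length w \<Longrightarrow> eval m p (let_e J) = w ! eval m p J"
  using vw by (simp add: let_e_def view_def tables_def)

lemma ev_cf: "eval m p I \<le> eval m p K \<Longrightarrow> eval m p K \<le> length w \<Longrightarrow> eval m p Q < cap \<Longrightarrow> eval m p G < cap \<Longrightarrow>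
  eval m p (cf_e I Q G K) = opc (cf w (eval m p I) (eval m p Q) (eval m p G) (eval m p K))"
  using vw by (auto simp: cf_e_def view_def tables_def)

lemma ev_pp: "eval m p L \<le> length w \<Longrightarrow> eval m p Q < cap \<Longrightarrow> eval m p G < cap \<Longrightarrow>
  eval m p (pp_e L Q G) = opc (pp w (eval m p L) (eval m p Q) [eval m p G])"
  using vw by (simp add: pp_e_def view_def tables_def)

lemma ev_an: "eval m p I \<le> eval m p X \<Longrightarrow> eval m p X \<le> eval m p K \<Longrightarrow> eval m p K \<le> length w \<Longrightarrow>
  eval m p Q < cap \<Longrightarrow> eval m p G < cap \<Longrightarrow>
  cf w (eval m p I) (eval m p Q) (eval m p G) (eval m p K) \<noteq> None \<Longrightarrow>
  eval m p (an_e I Q G K X) =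
    lastanc (ht w (eval m p I) (eval m p Q) (eval m p G)) (eval m p I) (eval m p K) (eval m p X)"
  using vw by (simp add: an_e_def view_def tables_def)

lemma ev_fu: "eval m p I \<le> eval m p K \<Longrightarrow> eval m p K \<le> eval m p L \<Longrightarrow> eval m p L \<le> length w \<Longrightarrow>
  eval m p Q < cap \<Longrightarrow> eval m p G < cap \<Longrightarrow> eval m p P < cap \<Longrightarrow>
  cf w (eval m p I) (eval m p Q) (eval m p G) (eval m p K) \<noteq> None \<Longrightarrow>
  eval m p (fu_e I Q G K L P) = opc (pp w (eval m p L) (eval m p P)
    (rest w (eval m p I) (eval m p Q) (eval m p G) (eval m p K)))"
  using vw by (auto simp: fu_e_def view_def tables_def)

lemma ev_mapup:
  assumes "eval m p e = opc z" "\<And>a b. z = Some (a, b) \<Longrightarrow> b < cap"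
  shows "eval m p (mapup_e d e) = opc (mapup z)"
  unfolding mapup_e_def
  by (rule eval_bind_e[OF assms(1)]) (use assms(2) in auto)

lemma ev_tabs:
  assumes "stp s q1 g1 = Some (q2, \<alpha>)" "eval m p A = q1" "eval m p B = g1" "q1 < cap" "g1 < cap"
  shows "eval m p (kind_e A B) = Suc (length \<alpha>)" "eval m p (nq_e A B) = q2"
    "eval m p (n1_e A B) = \<alpha> ! 0" "eval m p (n2_e A B) = \<alpha> ! 1"
  using assms letters by (simp_all add: kind_e_def nq_e_def n1_e_def n2_e_def eval_tab_e kind_def nextq_def nextg_def)

lemma ev_kind_None:
  assumes "stp s q1 g1 = None" "eval m p A = q1" "eval m p B = g1" "q1 < cap" "g1 < cap"
  shows "eval m p (kind_e A B) = 0"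
  using assms letters by (simp add: kind_e_def eval_tab_e kind_def)

lemma ev_resume:
  assumes "eval m p I = i" "eval m p Q = q" "eval m p G = g" "i \<le> c" "q < cap" "g < cap"
  shows "eval m p (resume_e d C I Q G) = opc (resume i q g)"
proof -
  have *: "eval m p (cf_e I Q G C) = opc (cf w i q g c)" using assms c_le by (simp add: ev_cf)
  show ?thesis unfolding resume_e_def
  proof (rule eval_bind_e[OF *])
    show "g' < cap" if "cf w i q g c = Some (q', g')" for q' g' using cf_range[OF that] assms by simp
    show "opc (resume i q g) = 0" if "cf w i q g c = None" using that by (simp add: resume_def)
    fix q1 g1 assume 1: "cf w i q g c = Some (q1, g1)" "g1 < cap"
      "eval m p (fst_e (cf_e I Q G C)) = q1" "eval m p (snd_e (cf_e I Q G C)) = g1"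
    let ?A = "fst_e (cf_e I Q G C)" and ?B = "snd_e (cf_e I Q G C)"
    have q1: "q1 < cap" using cf_range[OF 1(1)] assms by simp
    show "eval m p (if_e (eq_e (kind_e ?A ?B) (Lit 0)) (Lit 0)
      (if_e (eq_e (kind_e ?A ?B) (Lit 1)) (some_e (b_e d C) (nq_e ?A ?B))
      (if_e (eq_e (kind_e ?A ?B) (Lit 2)) (pp_e (b_e d C) (nq_e ?A ?B) (n1_e ?A ?B))
      (bind_e (pp_e (b_e d C) (nq_e ?A ?B) (n1_e ?A ?B)) (\<lambda>L P. pp_e L P (n2_e ?A ?B)))))) =
      opc (resume i q g)" (is "eval m p ?e = _")
    proof (cases "stp s q1 g1")
      case None
      then show ?thesis using ev_kind_None[OF None 1(3,4) q1 1(2)] 1(1) by (simp add: resume_def)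
    next
      case (Some y)
      obtain q2 \<alpha> where y: "stp s q1 g1 = Some (q2, \<alpha>)" using Some by (cases y) auto
      note T = ev_tabs[OF y 1(3,4) q1 1(2)]
      have r: "resume i q g = pp w b q2 \<alpha>" using 1(1) y by (simp add: resume_def)
      have rg: "q2 < cap" "set \<alpha> \<subseteq> {..<cap}" using stp_range[OF y] by auto
      consider "\<alpha> = []" | a where "\<alpha> = [a]" | a a' where "\<alpha> = [a, a']"
        using stp_length[OF y] by (cases \<alpha>; cases "tl \<alpha>") auto
      then show ?thesis
      proof cases
        case 1
        then show ?thesis using T r c_le by simp
      next
        case (2 a)
        then show ?thesis using T r c_le rg by (simp add: ev_pp)
      next
        case (3 a a')
        have pe: "eval m p (pp_e (b_e d C) (nq_e ?A ?B) (n1_e ?A ?B)) = opc (pp w b q2 [a])"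
          using T 3 c_le rg by (simp add: ev_pp)
        have "eval m p (bind_e (pp_e (b_e d C) (nq_e ?A ?B) (n1_e ?A ?B)) (\<lambda>L P. pp_e L P (n2_e ?A ?B))) =
          opc (pp w b q2 \<alpha>)"
        proof (rule eval_bind_e[OF pe])
          have al: "pp w b q2 \<alpha> = Option.bind (pp w b q2 [a]) (\<lambda>(l', q'). pp w l' q' [a'])"
            using pp_append[of w b q2 "[a]" "[a']"] 3 by simp
          show "q' < cap" if "pp w b q2 [a] = Some (l', q')" for l' q' using pp_range[OF that rg(1)] .
          show "opc (pp w b q2 \<alpha>) = 0" if "pp w b q2 [a] = None" using that al by simp
          fix l1 p1 assume l1: "pp w b q2 [a] = Some (l1, p1)" "p1 < cap"
            "eval m p (fst_e (pp_e (b_e d C) (nq_e ?A ?B) (n1_e ?A ?B))) = l1"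
            "eval m p (snd_e (pp_e (b_e d C) (nq_e ?A ?B) (n1_e ?A ?B))) = p1"
          show "eval m p (pp_e (fst_e (pp_e (b_e d C) (nq_e ?A ?B) (n1_e ?A ?B)))
             (snd_e (pp_e (b_e d C) (nq_e ?A ?B) (n1_e ?A ?B))) (n2_e ?A ?B)) = opc (pp w b q2 \<alpha>)"
            using T 3 rg l1 pp_le[OF l1(1)] al by (simp add: ev_pp)
        qed
        then show ?thesis using T r 3 by simp
      qed
    qed
  qed
qed

lemma holds_ok:
  assumes "eval m p I = i" "eval m p Q = q" "eval m p G = g" "eval m p K = k" "eval m p L = l"
    "eval m p P = p0" "eval m p E = e" "eval m p X = x"
    and "q < cap" "g < cap" "p0 < cap" "i \<le> x" "x \<le> k" "k \<le> l" "l \<le> length w" and al: "cf w i q g k = Some y"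
  shows "holds m p (ok_e I Q G K L P E X) \<longleftrightarrow> ok w i q g k l p0 e x"
proof -
  let ?a = "lastanc (ht w i q g) i k x"
  have a: "eval m p (an_e I Q G K X) = ?a" using assms by (simp add: ev_an)
  have a_le: "i \<le> ?a" "?a \<le> x" "anc (ht w i q g) k ?a"
    using lastanc_props[OF anc_start[OF al], of x] assms by auto
  have cfa: "eval m p (cf_e I Q G (an_e I Q G K X)) = opc (cf w i q g ?a)"
    using assms a a_le by (simp add: ev_cf)
  obtain qk gk where y: "y = (qk, gk)" by (cases y)
  have "holds m p (ok_e I Q G K L P E X) \<longleftrightarrow>
    (\<exists>qa ga. cf w i q g ?a = Some (qa, ga) \<and> early (pp w l p0 (rest w ?a qa ga k)) e)"
    unfolding ok_e_def
  proof (rule holds_bind_e[OF cfa])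
    show "g' < cap" if "cf w i q g ?a = Some (q', g')" for q' g' using cf_range[OF that] assms by simp
    fix qa ga assume 1: "cf w i q g ?a = Some (qa, ga)" "ga < cap"
      "eval m p (fst_e (cf_e I Q G (an_e I Q G K X))) = qa"
      "eval m p (snd_e (cf_e I Q G (an_e I Q G K X))) = ga"
    let ?A = "fst_e (cf_e I Q G (an_e I Q G K X))" and ?B = "snd_e (cf_e I Q G (an_e I Q G K X))"
    have qa: "qa < cap" using cf_range[OF 1(1)] assms by simp
    have "cf w ?a qa ga k = Some (qk, gk)"
      using cf_segment_anc(1)[OF al[unfolded y] a_le(1) _ _ a_le(3) 1(1)] a_le assms by simp
    then have fu: "eval m p (fu_e (an_e I Q G K X) ?A ?B K L P) = opc (pp w l p0 (rest w ?a qa ga k))"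
      using 1 a a_le assms qa by (simp add: ev_fu)
    have "holds m p (bind_e (fu_e (an_e I Q G K X) ?A ?B K L P) (\<lambda>L1 P1. le_e L1 E)) \<longleftrightarrow>
      (\<exists>l1 p1. pp w l p0 (rest w ?a qa ga k) = Some (l1, p1) \<and> l1 \<le> e)"
      by (rule holds_bind_e[OF fu]) (use pp_range assms in auto)
    then show "holds m p (bind_e (fu_e (an_e I Q G K X) ?A ?B K L P) (\<lambda>L1 P1. le_e L1 E)) \<longleftrightarrow>
      early (pp w l p0 (rest w ?a qa ga k)) e"
      by (simp add: early_def)
  qed
  also have "\<dots> \<longleftrightarrow> ok w i q g k l p0 e x"
    by (cases "cf w i q g ?a") (auto simp: ok_def reach_def early_def)
  finally show ?thesis .
qed

lemma holds_le_cross: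
  assumes ev: "eval m p I = i" "eval m p Q = q" "eval m p G = g" "eval m p K = k" "eval m p L = l"
    "eval m p P = p0" "eval m p E = e"
    and rg: "q < cap" "g < cap" "p0 < cap" and le: "i \<le> k" "k \<le> l" "l \<le> e" "e \<le> length w"
    and al: "cf w i q g k = Some y"
  shows "holds m p (le_cross_e I Q G K L P E X) \<longleftrightarrow> eval m p X \<le> cross w i q g k l p0 e"
proof -
  have kw: "k \<le> length w" using le by simp
  have "holds m p (ok_e I Q G K L P E (minus_e X (Lit 1))) \<longleftrightarrow> ok w i q g k l p0 e (eval m p X - 1)"
    if "i < eval m p X" "eval m p X \<le> k"
    by (rule holds_ok[OF ev(1-7) _ rg]) (use that le al in auto)
  then show ?thesis
    unfolding le_cross_iff[OF al le(1) kw le(3,4)] le_cross_e_def using ev by auto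
qed

text \<open>The result \<open>r\<close> is left open because two computations use this: the
  decomposition of a run, with \<open>e\<close> the end \<open>dn k\<close> of the run, and the pop
  of a rest, with \<open>e\<close> the change \<open>c\<close>.\<close>

lemma eval_cross_e:
  assumes ev: "eval m p I = i" "eval m p Q = q" "eval m p G = g" "eval m p K = k" "eval m p L = l"
    "eval m p P = p0" and X: "eval m p X = cross w i q g k l p0 e"
    and rg: "q < cap" "g < cap" "p0 < cap" and le: "i \<le> k" "k \<le> l" "l \<le> e" "e \<le> length w"
    and al: "cf w i q g k = Some y"
    and r0: "cross w i q g k l p0 e = i \<Longrightarrow> r = 0"
    and r: "\<And>L3 P3 G3 A a x1 x2 y1 y2 g' l3 p3. \<lbrakk>cross w i q g k l p0 e = Suc a; i \<le> a; a < k;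
      cf w i q g (Suc a) = Some (x1, x2); cf w i q g a = Some (y1, y2);
      stp (w ! a) y1 y2 = Some (x1, [x2, g']);
      pp w l p0 (rest w (Suc a) x1 x2 k) = Some (l3, p3); l \<le> l3; l3 \<le> e; p3 < cap; g' < cap;
      eval m p L3 = l3; eval m p P3 = p3; eval m p G3 = g'; eval m p A = a\<rbrakk> \<Longrightarrow> eval m p (f L3 P3 G3 A) = r"
  shows "eval m p (cross_e X I Q G K L P f) = r"
proof -
  have kw: "k \<le> length w" using le by simp
  note pr = cross_props[OF al le(1) kw le(3,4), of p0]
  show ?thesis
  proof (cases "cross w i q g k l p0 e = i")
    case True
    then show ?thesis using r0 X ev by (simp add: cross_e_def)
  next
    case False
    then have lt: "i < cross w i q g k l p0 e" using pr(1) by simp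
    obtain qk gk where y: "y = (qk, gk)" by (cases y)
    show ?thesis
    proof (cases rule: cross_push[OF al le(1) kw le(3,4) lt, consumes 0, case_names 1])
      case (1 a y1 y2 x1 x2 g' l3 p3)
      have xr: "x1 < cap" "x2 < cap" using cf_range[OF 1(6)] rg by auto
      have yr: "y1 < cap" "y2 < cap" using cf_range[OF 1(4)] rg by auto
      have cX: "eval m p (cf_e I Q G X) = opc (cf w i q g (Suc a))"
        using ev X 1 rg kw by (simp add: ev_cf)
      note E = eval_fst_snd[OF cX 1(6) xr(2)]
      \<comment> \<open>The height at \<open>Suc a\<close> is one more than at \<open>a\<close>, and
        all later heights up to \<open>k\<close> exceed that at \<open>a\<close>.\<close>
      have "anc (ht w i q g) k (Suc a)"
        unfolding anc_def
      proof (intro allI impI)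
        obtain \<alpha> where "stp (w ! a) y1 y2 = Some (x1, \<alpha>)" "ht w i q g (Suc a) + 1 = ht w i q g a + length \<alpha>"
          using ht_Suc[OF 1(4,2) _ 1(6)] 1(3) kw by auto
        then have h: "ht w i q g (Suc a) = Suc (ht w i q g a)" using 1(5) by auto
        fix j assume "Suc a \<le> j \<and> j \<le> k"
        then show "ht w i q g (Suc a) \<le> ht w i q g j" using 1(11)[of j] h by simp
      qed
      then have "cf w (Suc a) x1 x2 k = Some (qk, gk)"
        using cf_segment_anc(1)[OF al[unfolded y] _ _ kw _ 1(6)] 1(2,3) by simp
      then have fu: "eval m p (fu_e X (fst_e (cf_e I Q G X)) (snd_e (cf_e I Q G X)) K L P) =
          opc (pp w l p0 (rest w (Suc a) x1 x2 k))"
        using ev X 1 rg kw le E xr by (simp add: ev_fu)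
      have p3: "p3 < cap" using pp_range[OF 1(7) rg(3)] .
      note F = eval_fst_snd[OF fu 1(7) p3]
      define M where "M = minus_e X (Lit 1)"
      have eM: "eval m p M = a" using X 1(1) by (simp add: M_def)
      have ca: "eval m p (cf_e I Q G M) = opc (cf w i q g a)"
        using ev eM 1 rg kw by (simp add: ev_cf)
      note H = eval_fst_snd[OF ca 1(4) yr(2)]
      have aw: "a < length w" using 1(3) kw by simp
      have lM: "eval m p (let_e M) = w ! a" using ev_let[of M] eM aw by simp
      have "w ! a \<in> set al" using letters(1) nth_mem[OF aw] by auto
      then have "eval m p (tab_e (nextg 1) (let_e M) (fst_e (cf_e I Q G M)) (snd_e (cf_e I Q G M))) = nextg 1 (w ! a) y1 y2"
        using eval_tab_e[of m p "let_e M" "fst_e (cf_e I Q G M)" "snd_e (cf_e I Q G M)" "nextg 1"] H lM yr by simp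
      then have pe: "eval m p (pushed_e I Q G M) = g'"
        using H(3) 1(5) by (simp add: pushed_e_def bind_e_def nextg_def)
      have "g' < cap" using stp_range[OF 1(5)] by auto
      then show ?thesis
        using r[OF 1(1-3,6,4,5,7) _ 1(8) p3 _ F(1,2) pe eM] pp_le[OF 1(7)] E(3) F(3) X ev 1(1,2)
        by (simp add: cross_e_def bind_e_def M_def)
    qed
  qed
qed

lemma ev_new_pp:
  assumes ev: "eval m p L = l" "eval m p Q = q" "eval m p G = g" and rg: "q < cap" "g < cap"
    and lw: "l \<le> length w'"
  shows "eval m p (new_pp_e d C L Q G) = opc (pp w' l q [g])"
proof (cases "c < l")
  case True
  have "eval m p (pp_e (dn_e d L) Q G) = opc (pp w (dn l) q [g])"
    using ev rg True dn_le[OF lw True] by (simp add: ev_pp)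
  then have "eval m p (mapup_e d (pp_e (dn_e d L) Q G)) = opc (mapup (pp w (dn l) q [g]))"
    by (rule ev_mapup) (use pp_range rg in auto)
  then show ?thesis using True ev pp_edit_suffix[OF True] by (simp add: new_pp_e_def)
next
  case False
  then have lc: "l \<le> c" by simp
  have e: "eval m p (pp_e L Q G) = opc (pp w l q [g])" using ev rg lc c_le by (simp add: ev_pp)
  have ee: "holds m p (early_e (pp_e L Q G) C) \<longleftrightarrow> early (pp w l q [g]) c"
    by (rule holds_early_e[OF e]) (use pp_range rg in auto)
  show ?thesis
  proof (cases "early (pp w l q [g]) c")
    case True
    then show ?thesis using False ee e ev pp_edit_early by (simp add: new_pp_e_def)
  next
    case late: False
    let ?z = "Option.bind (resume l q g) (\<lambda>(l2, q2). pp w l2 q2 (rest w l q g c))"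
    have re: "eval m p (resume_e d C L Q G) = opc (resume l q g)" using ev_resume[OF ev lc rg] .
    have "eval m p (bind_e (resume_e d C L Q G) (\<lambda>L2 P2. fu_e L Q G C L2 P2)) = opc ?z"
    proof (rule eval_bind_e[OF re])
      show "q' < cap" if "resume l q g = Some (l', q')" for l' q' using resume_range[OF that] .
      fix l2 p2 assume 1: "resume l q g = Some (l2, p2)" "p2 < cap"
        "eval m p (fst_e (resume_e d C L Q G)) = l2" "eval m p (snd_e (resume_e d C L Q G)) = p2"
      have "cf w l q g c \<noteq> None" using 1(1) by (auto simp: resume_def bind_eq_Some_conv)
      then show "eval m p (fu_e L Q G C (fst_e (resume_e d C L Q G)) (snd_e (resume_e d C L Q G))) = opc ?z"
        using 1 ev lc rg c_le resume_le[OF 1(1)] by (simp add: ev_fu)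
    qed auto
    then have "eval m p (mapup_e d (bind_e (resume_e d C L Q G) (\<lambda>L2 P2. fu_e L Q G C L2 P2))) = opc (mapup ?z)"
      by (rule ev_mapup) (auto simp: bind_eq_Some_conv dest: resume_range pp_range)
    then show ?thesis using False late ee ev pp_edit_symbol[OF lc late] by (simp add: new_pp_e_def)
  qed
qed

text \<open>The tests follow \<open>decomp_top\<close>, \<open>decomp_second\<close> and
  \<open>decomp_cross\<close>; when all fail, \<open>edit_dead\<close> shows that the entry is
  undefined, which accounts for \<open>r0\<close>. \<open>S1\<close> is the outcome of the search
  carried out beforehand.\<close>

lemma eval_decomp_e:
  assumes ev: "eval m p I = i" "eval m p Q = q" "eval m p G = g" "eval m p K = k"
    and rg: "q < cap" "g < cap" and le: "i \<le> c" "c < k" "k \<le> length w'"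
    and S1: "\<And>l2 p2. resume i q g = Some (l2, p2) \<Longrightarrow> l2 \<le> dn k \<Longrightarrow>
      m (cell [6, i, q, g, k]) = cross w i q g c l2 p2 (dn k)"
    and r0: "cf w' i q g k = None \<Longrightarrow> r = 0"
    and r: "\<And>L P G1 HB BV A l p0 g1 \<beta> a. \<lbrakk>decomp i q g k l p0 g1 \<beta> a; p0 < cap; g1 < cap; set \<beta> \<subseteq> {..<cap};
      eval m p L = l; eval m p P = p0; eval m p G1 = g1; holds m p HB \<longleftrightarrow> \<beta> \<noteq> [];
      \<beta> \<noteq> [] \<Longrightarrow> \<beta> = [eval m p BV]; eval m p A = a\<rbrakk> \<Longrightarrow> eval m p (f L P G1 HB BV A) = r"
  shows "eval m p (decomp_e d C I Q G K f) = r"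
proof -
  have cfc: "eval m p (cf_e I Q G C) = opc (cf w i q g c)" using ev rg le c_le by (simp add: ev_cf)
  have k0: "eval m p (dn_e d K) = dn k" using ev le by simp
  have kw: "dn k \<le> length w" using dn_le le by simp
  have bk: "b \<le> dn k" using up_dn(3)[OF le(2)] .
  show ?thesis unfolding decomp_e_def
  proof (rule eval_bind_e[OF cfc])
    show "g' < cap" if "cf w i q g c = Some (q', g')" for q' g' using cf_range[OF that] rg by simp
    \<comment> \<open>A run alive at \<open>k\<close> was alive at \<open>c\<close>, where the old
      and the new run agree.\<close>
    show "r = 0" if n: "cf w i q g c = None"
    proof (rule r0, rule ccontr)
      assume "cf w' i q g k \<noteq> None"
      then obtain z where "cf w' i q g k = Some z" by auto
      then have "cf w' i q g c \<noteq> None" using cf_alive_ex[of w' i q g k z c] le by auto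
      then show False using n cf_edit_prefix(1)[of c i q g] by simp
    qed
    fix q1 g1 assume 1: "cf w i q g c = Some (q1, g1)" "g1 < cap"
      "eval m p (fst_e (cf_e I Q G C)) = q1" "eval m p (snd_e (cf_e I Q G C)) = g1"
    have q1: "q1 < cap" using cf_range[OF 1(1)] rg by simp
    define A where "A = fst_e (cf_e I Q G C)"
    define B where "B = snd_e (cf_e I Q G C)"
    have AB: "eval m p A = q1" "eval m p B = g1" using 1 by (simp_all add: A_def B_def)
    define Z where "Z = pp_e (b_e d C) (nq_e A B) (n1_e A B)"
    define R where "R = resume_e d C I Q G"
    define X where "X = Cell (addr [Lit 6, I, Q, G, K])"
    have Xv: "eval m p X = m (cell [6, i, q, g, k])" using ev by (simp add: X_def)
    have "eval m p (if_e (and_e (le_e (Lit 2) (kind_e A B)) (cf_e (b_e d C) (nq_e A B) (n1_e A B) (dn_e d K)))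
          (f (b_e d C) (nq_e A B) (n1_e A B) (eq_e (kind_e A B) (Lit 3)) (n2_e A B) C)
        (if_e (and_e (eq_e (kind_e A B) (Lit 3))
            (and_e (early_e Z (dn_e d K)) (cf_e (fst_e Z) (snd_e Z) (n2_e A B) (dn_e d K))))
          (f (fst_e Z) (snd_e Z) (n2_e A B) (Lit 0) (Lit 0) C)
        (if_e (early_e R (dn_e d K))
          (cross_e X I Q G C (fst_e R) (snd_e R)
             (\<lambda>L3 P3 G3 A3. if_e (cf_e L3 P3 G3 (dn_e d K)) (f L3 P3 G3 (Lit 0) (Lit 0) A3) (Lit 0)))
          (Lit 0)))) = r"
    proof (cases "stp s q1 g1")
      case None
      have "cf w' i q g k = None"
      proof -
        have "run w' i k (q, [g]) = None"
          using run_edit_across[OF le(1,2), of "(q, [g])"] 1(1) None by (simp add: cf_eq_Some)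
        then show ?thesis by (simp add: cf_def)
      qed
      moreover have "\<not> holds m p (early_e R (dn_e d K))"
        using holds_early_e[OF ev_resume[OF ev(1-3) le(1) rg] resume_range k0] 1(1) None
        by (simp add: R_def resume_def early_def)
      ultimately show ?thesis using r0 ev_kind_None[OF None AB q1 1(2)] by simp
    next
      case (Some y)
      obtain q2 \<alpha> where y: "stp s q1 g1 = Some (q2, \<alpha>)" using Some by (cases y) auto
      note T = ev_tabs[OF y AB q1 1(2)]
      have rga: "q2 < cap" "set \<alpha> \<subseteq> {..<cap}" using stp_range[OF y] by auto
      have rs: "resume i q g = pp w b q2 \<alpha>" using 1(1) y by (simp add: resume_def)
      have Re: "eval m p R = opc (pp w b q2 \<alpha>)" using ev_resume[OF ev(1-3) le(1) rg] rs by (simp add: R_def)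
      have prg: "p' < cap" if "pp w b q2 \<gamma> = Some (l', p')" for \<gamma> l' p' using pp_range[OF that rga(1)] .
      note ED = edit_dead[OF le(1,2,3) 1(1) y]
      have c1: "holds m p (and_e (le_e (Lit 2) (kind_e A B)) (cf_e (b_e d C) (nq_e A B) (n1_e A B) (dn_e d K))) \<longleftrightarrow>
        (\<exists>\<alpha>1 \<beta>. \<alpha> = \<alpha>1 # \<beta> \<and> cf w b q2 \<alpha>1 (dn k) \<noteq> None)"
      proof (cases \<alpha>)
        case Nil
        then show ?thesis using T by simp
      next
        case (Cons a1 \<beta>)
        then have "eval m p (cf_e (b_e d C) (nq_e A B) (n1_e A B) (dn_e d K)) = opc (cf w b q2 a1 (dn k))"
          using T rga bk kw k0 by (simp add: ev_cf)
        then show ?thesis using T Cons by (simp add: holds_def[of m p "cf_e _ _ _ _"])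
      qed
      show ?thesis
      proof (rule eval_if_e)
        assume "holds m p (and_e (le_e (Lit 2) (kind_e A B)) (cf_e (b_e d C) (nq_e A B) (n1_e A B) (dn_e d K)))"
        then obtain a1 \<beta> where a: "\<alpha> = a1 # \<beta>" "cf w b q2 a1 (dn k) \<noteq> None" using c1 by blast
        have dc: "decomp i q g k b q2 a1 \<beta> c" using decomp_top[OF le 1(1) y a] .
        have "length \<beta> \<le> 1" using stp_length[OF y] a by simp
        then have \<beta>: "\<beta> \<noteq> [] \<Longrightarrow> \<beta> = [eval m p (n2_e A B)]"
          "holds m p (eq_e (kind_e A B) (Lit 3)) \<longleftrightarrow> \<beta> \<noteq> []"
          using a T by (cases \<beta>; simp)+
        show "eval m p (f (b_e d C) (nq_e A B) (n1_e A B) (eq_e (kind_e A B) (Lit 3)) (n2_e A B) C) = r"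
          by (rule r[OF dc _ _ _ _ _ _ \<beta>(2,1)]) (use T a rga in auto)
      next
        assume n1: "\<not> holds m p (and_e (le_e (Lit 2) (kind_e A B)) (cf_e (b_e d C) (nq_e A B) (n1_e A B) (dn_e d K)))"
        have c2: "holds m p (and_e (eq_e (kind_e A B) (Lit 3))
            (and_e (early_e Z (dn_e d K)) (cf_e (fst_e Z) (snd_e Z) (n2_e A B) (dn_e d K)))) \<longleftrightarrow>
          (\<exists>\<alpha>1 \<alpha>2 l1 p1. \<alpha> = [\<alpha>1, \<alpha>2] \<and> pp w b q2 [\<alpha>1] = Some (l1, p1) \<and> l1 \<le> dn k \<and>
             cf w l1 p1 \<alpha>2 (dn k) \<noteq> None \<and> eval m p (fst_e Z) = l1 \<and> eval m p (snd_e Z) = p1)"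
        proof (cases "length \<alpha> = 2")
          case False
          then show ?thesis using T by auto
        next
          case True
          then obtain a1 a2 where a: "\<alpha> = [a1, a2]" by (auto simp: length_Suc_conv numeral_2_eq_2)
          have Ze: "eval m p Z = opc (pp w b q2 [a1])"
            using T a rga c_le by (simp add: Z_def ev_pp)
          have he: "holds m p (early_e Z (dn_e d K)) \<longleftrightarrow> early (pp w b q2 [a1]) (dn k)"
            by (rule holds_early_e[OF Ze prg k0])
          show ?thesis
          proof (cases "early (pp w b q2 [a1]) (dn k)")
            case False
            then show ?thesis using he a by (auto simp: early_def)
          next
            case True
            then obtain l1 p1 where l1: "pp w b q2 [a1] = Some (l1, p1)" "l1 \<le> dn k" by (auto simp: early_def)
            note E = eval_fst_snd[OF Ze l1(1) prg[OF l1(1)]]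
            have "eval m p (cf_e (fst_e Z) (snd_e Z) (n2_e A B) (dn_e d K)) = opc (cf w l1 p1 a2 (dn k))"
              using E T a rga l1 kw k0 prg[OF l1(1)] by (simp add: ev_cf)
            then show ?thesis using he True T a l1 E by (simp add: holds_def[of m p "cf_e _ _ _ _"])
          qed
        qed
        show "eval m p (if_e (and_e (eq_e (kind_e A B) (Lit 3))
            (and_e (early_e Z (dn_e d K)) (cf_e (fst_e Z) (snd_e Z) (n2_e A B) (dn_e d K))))
          (f (fst_e Z) (snd_e Z) (n2_e A B) (Lit 0) (Lit 0) C)
        (if_e (early_e R (dn_e d K))
          (cross_e X I Q G C (fst_e R) (snd_e R)
             (\<lambda>L3 P3 G3 A3. if_e (cf_e L3 P3 G3 (dn_e d K)) (f L3 P3 G3 (Lit 0) (Lit 0) A3) (Lit 0)))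
          (Lit 0))) = r"
        proof (rule eval_if_e)
          assume "holds m p (and_e (eq_e (kind_e A B) (Lit 3))
            (and_e (early_e Z (dn_e d K)) (cf_e (fst_e Z) (snd_e Z) (n2_e A B) (dn_e d K))))"
          then obtain a1 a2 l1 p1 where a: "\<alpha> = [a1, a2]" "pp w b q2 [a1] = Some (l1, p1)" "l1 \<le> dn k"
            "cf w l1 p1 a2 (dn k) \<noteq> None" "eval m p (fst_e Z) = l1" "eval m p (snd_e Z) = p1"
            using c2 by blast
          show "eval m p (f (fst_e Z) (snd_e Z) (n2_e A B) (Lit 0) (Lit 0) C) = r"
            by (rule r[OF decomp_second[OF le 1(1) y a(1-4)]])
              (use T a rga prg[OF a(2)] in \<open>auto simp: holds_def\<close>)
        next
          assume n2: "\<not> holds m p (and_e (eq_e (kind_e A B) (Lit 3))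
            (and_e (early_e Z (dn_e d K)) (cf_e (fst_e Z) (snd_e Z) (n2_e A B) (dn_e d K))))"
          have he: "holds m p (early_e R (dn_e d K)) \<longleftrightarrow> early (pp w b q2 \<alpha>) (dn k)"
            by (rule holds_early_e[OF Re prg k0])
          have no2: "\<not> (\<exists>\<alpha>1 \<alpha>2 l1 p1. \<alpha> = [\<alpha>1, \<alpha>2] \<and> pp w b q2 [\<alpha>1] = Some (l1, p1) \<and> l1 \<le> dn k \<and>
             cf w l1 p1 \<alpha>2 (dn k) \<noteq> None)"
          proof
            assume "\<exists>\<alpha>1 \<alpha>2 l1 p1. \<alpha> = [\<alpha>1, \<alpha>2] \<and> pp w b q2 [\<alpha>1] = Some (l1, p1) \<and> l1 \<le> dn k \<and>
             cf w l1 p1 \<alpha>2 (dn k) \<noteq> None"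
            then obtain a1 a2 l1 p1 where a: "\<alpha> = [a1, a2]" "pp w b q2 [a1] = Some (l1, p1)" "l1 \<le> dn k"
              "cf w l1 p1 a2 (dn k) \<noteq> None" by blast
            have "eval m p Z = opc (pp w b q2 [a1])" using T a rga c_le by (simp add: Z_def ev_pp)
            note E = eval_fst_snd[OF this a(2) prg[OF a(2)]]
            show False using n2 c2 a E by blast
          qed
          show "eval m p (if_e (early_e R (dn_e d K))
            (cross_e X I Q G C (fst_e R) (snd_e R)
             (\<lambda>L3 P3 G3 A3. if_e (cf_e L3 P3 G3 (dn_e d K)) (f L3 P3 G3 (Lit 0) (Lit 0) A3) (Lit 0)))
            (Lit 0)) = r"
          proof (rule eval_if_e)
            assume "\<not> holds m p (early_e R (dn_e d K))"
            then have "\<not> early (pp w b q2 \<alpha>) (dn k)" using he by simp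
            then have "cf w' i q g k = None" using ED c1 n1 no2 unfolding early_def by blast
            then show "eval m p (Lit 0) = r" using r0 by simp
          next
            assume "holds m p (early_e R (dn_e d K))"
            then obtain l2 p2 where l2: "pp w b q2 \<alpha> = Some (l2, p2)" "l2 \<le> dn k"
              using he by (auto simp: early_def)
            note E = eval_fst_snd[OF Re l2(1) prg[OF l2(1)]]
            have Xc: "eval m p X = cross w i q g c l2 p2 (dn k)" using S1[of l2 p2] Xv rs l2 by simp
            have cl2: "c \<le> l2" using pp_le[OF l2(1)] c_le by simp
            have eC: "eval m p C = c" by simp
            show "eval m p (cross_e X I Q G C (fst_e R) (snd_e R)
               (\<lambda>L3 P3 G3 A3. if_e (cf_e L3 P3 G3 (dn_e d K)) (f L3 P3 G3 (Lit 0) (Lit 0) A3) (Lit 0))) = r"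
            proof (rule eval_cross_e[OF ev(1-3) eC E(1,2) Xc rg prg[OF l2(1)] le(1) cl2 l2(2) kw 1(1)])
              assume ci: "cross w i q g c l2 p2 (dn k) = i"
              have "cf w' i q g k = None"
              proof (rule ccontr)
                assume "cf w' i q g k \<noteq> None"
                then show False using ED c1 n1 no2 l2 ci by auto
              qed
              then show "r = 0" using r0 by simp
            next
              fix L3 P3 G3 A3 a x1 x2 y1 y2 g' l3 p3
              assume h: "cross w i q g c l2 p2 (dn k) = Suc a" "i \<le> a" "a < c"
                "cf w i q g (Suc a) = Some (x1, x2)" "cf w i q g a = Some (y1, y2)"
                "stp (w ! a) y1 y2 = Some (x1, [x2, g'])"
                "pp w l2 p2 (rest w (Suc a) x1 x2 c) = Some (l3, p3)" "l2 \<le> l3" "l3 \<le> dn k" "p3 < cap" "g' < cap"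
                "eval m p L3 = l3" "eval m p P3 = p3" "eval m p G3 = g'" "eval m p A3 = a"
              have ce: "eval m p (cf_e L3 P3 G3 (dn_e d K)) = opc (cf w l3 p3 g' (dn k))"
                using h kw k0 by (simp add: ev_cf)
              show "eval m p (if_e (cf_e L3 P3 G3 (dn_e d K)) (f L3 P3 G3 (Lit 0) (Lit 0) A3) (Lit 0)) = r"
              proof (rule eval_if_e)
                assume "holds m p (cf_e L3 P3 G3 (dn_e d K))"
                then have ne: "cf w l3 p3 g' (dn k) \<noteq> None" using ce by (simp add: holds_def)
                show "eval m p (f L3 P3 G3 (Lit 0) (Lit 0) A3) = r"
                  by (rule r[OF decomp_cross(1)[OF le 1(1) y l2 h(1,2,4,5,6,7) ne]])
                    (use h in \<open>auto simp: holds_def\<close>)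
              next
                assume "\<not> holds m p (cf_e L3 P3 G3 (dn_e d K))"
                then have nn: "cf w l3 p3 g' (dn k) = None"
                  using ce by (cases "cf w l3 p3 g' (dn k)") (auto simp: holds_def)
                have "cf w' i q g k = None"
                proof (rule ccontr)
                  assume "cf w' i q g k \<noteq> None"
                  from ED[OF this] c1 n1 no2 l2 have "\<forall>a x1 x2 y1 y2 z1 z2 g' l3 p3. cross w i q g c l2 p2 (dn k) = Suc a \<longrightarrow>
                    cf w i q g (Suc a) = Some (x1, x2) \<longrightarrow> cf w i q g a = Some (y1, y2) \<longrightarrow>
                    stp (w ! a) y1 y2 = Some (z1, [z2, g']) \<longrightarrow>
                    pp w l2 p2 (rest w (Suc a) x1 x2 c) = Some (l3, p3) \<longrightarrow> cf w l3 p3 g' (dn k) \<noteq> None"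
                    by auto
                  then show False using h nn by blast
                qed
                then show "eval m p (Lit 0) = r" using r0 by simp
              qed
            qed
          qed
        qed
      qed
    qed
    then show "eval m p (branch_e d C I Q G K f (fst_e (cf_e I Q G C)) (snd_e (cf_e I Q G C))) = r"
      unfolding branch_e_def A_def B_def Z_def R_def X_def .
  qed
qed

end

end

context edit_view
begin

context
  fixes m :: memory and p :: nat
  assumes vw: "view m"
begin

lemmas ev = ev_basic[OF vw] ev_dn[OF vw]

lemma ev_new_let:
  assumes "eval m p J = j" "j < length w'"
  shows "eval m p (new_let_e d C J) = w' ! j"
proof -
  consider "j < c" | "j = c" | "c < j" by linarith
  then show ?thesis
  proof cases
    case 1
    then show ?thesis using assms nth_edit_prefix[OF 1] c_le by (simp add: new_let_e_def ev ev_let[OF vw])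
  next
    case 2
    then show ?thesis using assms cd by (simp add: new_let_e_def ev w' nth_append)
  next
    case 3
    have "dn j < length w" using assms(2) 3 len_edit d by (auto simp: up dn)
    moreover have "w' ! j = w ! dn j"
      using 3 cd by (simp add: w' nth_append dn nth_Cons' add.commute)
    ultimately show ?thesis using assms 3 by (simp add: new_let_e_def ev ev_let[OF vw])
  qed
qed

context
  fixes I Q G K :: exp and i q g k :: nat
  assumes e: "eval m p I = i" "eval m p Q = q" "eval m p G = g" "eval m p K = k"
    and rg: "q < cap" "g < cap" and ik: "i \<le> k" and kw: "k \<le> length w'"
    and S1: "\<And>l2 p2. i \<le> c \<Longrightarrow> c < k \<Longrightarrow> resume i q g = Some (l2, p2) \<Longrightarrow> l2 \<le> dn k \<Longrightarrow>
      m (cell [6, i, q, g, k]) = cross w i q g c l2 p2 (dn k)"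
begin

lemma dn_bounds: "c < i \<Longrightarrow> dn i \<le> dn k" "c < k \<Longrightarrow> dn k \<le> length w"
  using up_dn(5)[OF ik] dn_le[OF kw] ik by auto

lemma ev_new_cf: "eval m p (new_cf_e d C I Q G K) = opc (cf w' i q g k)"
proof -
  consider "k \<le> c" | "c < i" "c < k" | "i \<le> c" "c < k" using ik by linarith
  then show ?thesis
  proof cases
    case 1
    then show ?thesis using e rg ik c_le cf_edit_prefix(1)[OF 1]
      by (simp add: new_cf_e_def ev ev_cf[OF vw])
  next
    case 2
    then show ?thesis using e rg ik dn_bounds cf_edit_suffix(1)[OF 2(1)]
      by (simp add: new_cf_e_def ev ev_cf[OF vw])
  next
    case 3
    have "eval m p (decomp_e d C I Q G K (\<lambda>L P G1 HB BV A. cf_e L P G1 (dn_e d K))) = opc (cf w' i q g k)"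
    proof (rule eval_decomp_e[OF vw e rg 3 kw S1[OF 3]])
      fix L P G1 HB BV A l p0 g1 \<beta> a
      assume h: "decomp i q g k l p0 g1 \<beta> a" "p0 < cap" "g1 < cap"
        "eval m p L = l" "eval m p P = p0" "eval m p G1 = g1"
      have "l \<le> dn k" using h(1) by (simp add: decomp_def)
      then show "eval m p (cf_e L P G1 (dn_e d K)) = opc (cf w' i q g k)"
        using h decomp_props(1)[OF h(1) 3] e 3 dn_bounds by (simp add: ev ev_cf[OF vw])
    qed auto
    then show ?thesis using 3 e by (simp add: new_cf_e_def ev)
  qed
qed

lemma ev_new_an:
  assumes al: "cf w' i q g k = Some y" and x: "eval m p X = x" "i \<le> x" "x \<le> k"
  shows "eval m p (new_an_e d C I Q G K X) = lastanc (ht w' i q g) i k x"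
proof -
  consider "k \<le> c" | "c < i" "c < k" | "i \<le> c" "c < k" using ik by linarith
  then show ?thesis
  proof cases
    case 1
    have "lastanc (ht w' i q g) i k x = lastanc (ht w i q g) i k x"
      by (rule lastanc_cong) (use 1 x cf_edit_prefix(3) in auto)
    moreover have "cf w i q g k = Some y" using al cf_edit_prefix(1)[OF 1] by simp
    ultimately show ?thesis using e rg ik c_le 1 x
      by (simp add: new_an_e_def ev ev_an[OF vw])
  next
    case 2
    have "dn i \<le> dn x" "dn x \<le> dn k" using up_dn(5) x by auto
    moreover have "cf w (dn i) q g (dn k) = Some y" using al cf_edit_suffix(1)[OF 2(1)] by simp
    ultimately show ?thesis using e rg ik dn_bounds 2 x lastanc_edit_suffix[OF 2(1) al x(2,3)]
      by (simp add: new_an_e_def ev ev_an[OF vw])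
  next
    case 3
    have "eval m p (decomp_e d C I Q G K (\<lambda>L P G1 HB BV A. if_e (le_e (up_e d L) X)
       (up_e d (an_e L P G1 (dn_e d K) (dn_e d X))) (an_e I Q G A (min_e X A)))) = lastanc (ht w' i q g) i k x"
    proof (rule eval_decomp_e[OF vw e rg 3 kw S1[OF 3]])
      fix L P G1 HB BV A l p0 g1 \<beta> a
      assume h: "decomp i q g k l p0 g1 \<beta> a" "p0 < cap" "g1 < cap"
        "eval m p L = l" "eval m p P = p0" "eval m p G1 = g1" "eval m p A = a"
      have h': "l \<le> dn k" "b \<le> l" "i \<le> a" "a \<le> c" "cf w i q g a \<noteq> None" "cf w l p0 g1 (dn k) \<noteq> None"
        using h(1) by (auto simp: decomp_def)
      show "eval m p (if_e (le_e (up_e d L) X)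
       (up_e d (an_e L P G1 (dn_e d K) (dn_e d X))) (an_e I Q G A (min_e X A))) = lastanc (ht w' i q g) i k x"
      proof (rule eval_if_e)
        assume "holds m p (le_e (up_e d L) X)"
        then have ux: "up l \<le> x" using h x by (simp add: ev)
        then have "c < x" using up_dn(4)[OF h'(2)] by simp
        then have dx: "l \<le> dn x" "dn x \<le> dn k" using ux up_dn(5)[OF ux] up_dn(2)[OF h'(2)] up_dn(5)[OF x(3)] by auto
        show "eval m p (up_e d (an_e L P G1 (dn_e d K) (dn_e d X))) = lastanc (ht w' i q g) i k x"
          using ux dx \<open>c < x\<close> h h' decomp_props(3)[OF h(1) 3 x(2,3)] e x 3 dn_bounds
          by (simp add: ev ev_an[OF vw])
      next
        assume "\<not> holds m p (le_e (up_e d L) X)"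
        then have ux: "\<not> up l \<le> x" using h x by (simp add: ev)
        have "eval m p (min_e X A) = min x a" using h x by (simp add: min_e_def)
        then show "eval m p (an_e I Q G A (min_e X A)) = lastanc (ht w' i q g) i k x"
          using ux h h' decomp_props(3)[OF h(1) 3 x(2,3)] e rg x c_le
          by (simp add: ev_an[OF vw])
      qed
    qed (use al in auto)
    then show ?thesis using 3 e by (simp add: new_an_e_def ev)
  qed
qed

lemma ev_new_fu:
  assumes al: "cf w' i q g k = Some y"
    and l: "eval m p L = l" "k \<le> l" "l \<le> length w'" and p0: "eval m p P = p0" "p0 < cap"
    and S2: "k \<le> l \<Longrightarrow> l \<le> c \<Longrightarrow> cf w i q g k \<noteq> None \<Longrightarrow>
      m (cell [7, i, q, g, k, l, p0]) = cross w i q g k l p0 c"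
  shows "eval m p (new_fu_e d C I Q G K L P) = opc (pp w' l p0 (rest w' i q g k))"
proof -
  have prg: "p' < cap" if "pp u x p0 \<gamma> = Some (l', p')" for u x \<gamma> l' p' using pp_range[OF that p0(2)] .
  consider "c < i" | "i \<le> c" "c < k" | "k \<le> c" "c < l" | "l \<le> c" using ik l by linarith
  then show ?thesis
  proof cases
    case 1
    have "dn k \<le> dn l" "dn l \<le> length w" using up_dn(5)[OF l(2)] dn_le[OF l(3)] 1 ik l by auto
    then have "eval m p (fu_e (dn_e d I) Q G (dn_e d K) (dn_e d L) P) = opc (pp w (dn l) p0 (rest w (dn i) q g (dn k)))"
      using e l p0 1 ik dn_bounds al cf_edit_suffix(1)[OF 1] rg by (simp add: ev ev_fu[OF vw])
    then have "eval m p (mapup_e d (fu_e (dn_e d I) Q G (dn_e d K) (dn_e d L) P)) =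
      opc (mapup (pp w (dn l) p0 (rest w (dn i) q g (dn k))))"
      by (rule ev_mapup[OF vw]) (rule prg)
    then show ?thesis using 1 ik l e pp_edit_suffix[of l] cf_edit_suffix(2)[OF 1]
      by (simp add: new_fu_e_def ev)
  next
    case 2
    have cl: "c < l" using 2 l by simp
    have dl: "dn k \<le> dn l" "dn l \<le> length w" using up_dn(5)[OF l(2)] dn_le[OF l(3)] cl by auto
    have "eval m p (decomp_e d C I Q G K (\<lambda>L1 P1 G1 HB BV A. mapup_e d
     (bind_e (fu_e L1 P1 G1 (dn_e d K) (dn_e d L) P) (\<lambda>L2 P2.
        bind_e (if_e HB (pp_e L2 P2 BV) (some_e L2 P2)) (\<lambda>L3 P3. fu_e I Q G A L3 P3))))) =
      opc (pp w' l p0 (rest w' i q g k))"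
    proof (rule eval_decomp_e[OF vw e rg 2 kw S1[OF 2]])
      fix L1 P1 G1 HB BV A l1 p1 g1 \<beta> a
      assume h: "decomp i q g k l1 p1 g1 \<beta> a" "p1 < cap" "g1 < cap" "set \<beta> \<subseteq> {..<cap}"
        "eval m p L1 = l1" "eval m p P1 = p1" "eval m p G1 = g1" "holds m p HB \<longleftrightarrow> \<beta> \<noteq> []"
        "\<beta> \<noteq> [] \<Longrightarrow> \<beta> = [eval m p BV]" "eval m p A = a"
      have h': "l1 \<le> dn k" "b \<le> l1" "i \<le> a" "a \<le> c" "cf w i q g a \<noteq> None" "cf w l1 p1 g1 (dn k) \<noteq> None"
        using h(1) by (auto simp: decomp_def)
      let ?z1 = "pp w (dn l) p0 (rest w l1 p1 g1 (dn k))"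
      let ?z2 = "\<lambda>(l2, p2). pp w l2 p2 \<beta>" and ?z3 = "\<lambda>(l3, p3). pp w l3 p3 (rest w i q g a)"
      have e1: "eval m p (fu_e L1 P1 G1 (dn_e d K) (dn_e d L) P) = opc ?z1"
        using e l p0 2 cl dl h h' by (simp add: ev ev_fu[OF vw])
      have "eval m p (bind_e (fu_e L1 P1 G1 (dn_e d K) (dn_e d L) P) (\<lambda>L2 P2.
        bind_e (if_e HB (pp_e L2 P2 BV) (some_e L2 P2)) (\<lambda>L3 P3. fu_e I Q G A L3 P3))) =
        opc (Option.bind (Option.bind ?z1 ?z2) ?z3)"
      proof (rule eval_bind_e[OF e1])
        fix l2 p2 assume 1: "?z1 = Some (l2, p2)" "p2 < cap"
          "eval m p (fst_e (fu_e L1 P1 G1 (dn_e d K) (dn_e d L) P)) = l2"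
          "eval m p (snd_e (fu_e L1 P1 G1 (dn_e d K) (dn_e d L) P)) = p2"
        let ?L2 = "fst_e (fu_e L1 P1 G1 (dn_e d K) (dn_e d L) P)"
        let ?P2 = "snd_e (fu_e L1 P1 G1 (dn_e d K) (dn_e d L) P)"
        have l2: "dn l \<le> l2" "l2 \<le> length w" using pp_le[OF 1(1)] by auto
        have e2: "eval m p (if_e HB (pp_e ?L2 ?P2 BV) (some_e ?L2 ?P2)) = opc (pp w l2 p2 \<beta>)"
        proof (rule eval_if_e)
          assume "holds m p HB"
          then have "\<beta> = [eval m p BV]" using h by auto
          moreover have "eval m p BV < cap" using h(4) calculation by (metis insert_subset lessThan_iff list.simps(15))
          ultimately show "eval m p (pp_e ?L2 ?P2 BV) = opc (pp w l2 p2 \<beta>)"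
            using 1 l2 ev_pp[OF vw, of p ?L2 ?P2 BV] by simp
        next
          assume "\<not> holds m p HB"
          then show "eval m p (some_e ?L2 ?P2) = opc (pp w l2 p2 \<beta>)" using h 1 l2 by simp
        qed
        show "eval m p (bind_e (if_e HB (pp_e ?L2 ?P2 BV) (some_e ?L2 ?P2)) (\<lambda>L3 P3. fu_e I Q G A L3 P3)) =
          opc (Option.bind (Option.bind ?z1 ?z2) ?z3)"
        proof (rule eval_bind_e[OF e2])
          show "p' < cap" if "pp w l2 p2 \<beta> = Some (l', p')" for l' p' using pp_range[OF that 1(2)] .
          fix l3 p3 assume 3: "pp w l2 p2 \<beta> = Some (l3, p3)" "p3 < cap"
            "eval m p (fst_e (if_e HB (pp_e ?L2 ?P2 BV) (some_e ?L2 ?P2))) = l3"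
            "eval m p (snd_e (if_e HB (pp_e ?L2 ?P2 BV) (some_e ?L2 ?P2))) = p3"
          have "l2 \<le> l3" "l3 \<le> length w" using pp_le[OF 3(1)] by auto
          \<comment> \<open>Popping the rest at \<open>a\<close> is tabulated only for starting
            positions from \<open>a\<close> on.\<close>
          moreover have "a \<le> l3" using \<open>l2 \<le> l3\<close> l2 h' dl c_le by linarith
          ultimately show "eval m p (fu_e I Q G A (fst_e (if_e HB (pp_e ?L2 ?P2 BV) (some_e ?L2 ?P2)))
            (snd_e (if_e HB (pp_e ?L2 ?P2 BV) (some_e ?L2 ?P2)))) = opc (Option.bind (Option.bind ?z1 ?z2) ?z3)"
            using 1 3 h h' e rg by (simp add: ev_fu[OF vw])
        qed (use 1 in auto)
      qed (use prg in auto)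
      then have "eval m p (mapup_e d (bind_e (fu_e L1 P1 G1 (dn_e d K) (dn_e d L) P) (\<lambda>L2 P2.
        bind_e (if_e HB (pp_e L2 P2 BV) (some_e L2 P2)) (\<lambda>L3 P3. fu_e I Q G A L3 P3)))) =
        opc (mapup (Option.bind (Option.bind ?z1 ?z2) ?z3))"
        by (rule ev_mapup[OF vw]) (auto simp: bind_eq_Some_conv dest!: prg pp_range)
      moreover have "pp w' l p0 (rest w' i q g k) = mapup (Option.bind (Option.bind ?z1 ?z2) ?z3)"
        unfolding pp_edit_suffix[OF cl] decomp_props(2)[OF h(1) 2]
        by (simp add: pp_append case_prod_unfold)
      ultimately show "eval m p (mapup_e d (bind_e (fu_e L1 P1 G1 (dn_e d K) (dn_e d L) P) (\<lambda>L2 P2.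
        bind_e (if_e HB (pp_e L2 P2 BV) (some_e L2 P2)) (\<lambda>L3 P3. fu_e I Q G A L3 P3)))) =
        opc (pp w' l p0 (rest w' i q g k))" by simp
    qed (use al in auto)
    then show ?thesis using 2 e by (simp add: new_fu_e_def ev)
  next
    case 3
    have dl: "k \<le> dn l" "dn l \<le> length w" using dn_le[OF l(3)] up_dn(3)[OF 3(2)] c_le 3 by auto
    have "eval m p (fu_e I Q G K (dn_e d L) P) = opc (pp w (dn l) p0 (rest w i q g k))"
      using e l p0 3 dl ik al cf_edit_prefix(1)[OF 3(1)] rg by (simp add: ev ev_fu[OF vw])
    then have "eval m p (mapup_e d (fu_e I Q G K (dn_e d L) P)) = opc (mapup (pp w (dn l) p0 (rest w i q g k)))"
      by (rule ev_mapup[OF vw]) (rule prg)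
    then show ?thesis using 3 ik l e pp_edit_suffix[of l] cf_edit_prefix(2)[OF 3(1)]
      by (simp add: new_fu_e_def ev)
  next
    case 4
    have kc: "k \<le> c" using l 4 by simp
    have alo: "cf w i q g k = Some y" using al cf_edit_prefix(1)[OF kc] by simp
    have eo: "eval m p (fu_e I Q G K L P) = opc (pp w l p0 (rest w i q g k))"
      using e l p0 4 ik alo rg c_le by (simp add: ev_fu[OF vw])
    have he: "holds m p (early_e (fu_e I Q G K L P) C) \<longleftrightarrow> early (pp w l p0 (rest w i q g k)) c"
      by (rule holds_early_e[OF eo prg ev_basic(1)[OF vw]])
    have rw: "rest w' i q g k = rest w i q g k" using cf_edit_prefix(2)[OF kc] .
    show ?thesis
    proof (cases "early (pp w l p0 (rest w i q g k)) c")
      case True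
      then show ?thesis using 4 kc ik e l he eo rw pp_edit_early by (simp add: new_fu_e_def ev)
    next
      case late: False
      let ?r = "opc (pp w' l p0 (rest w i q g k))"
      have X: "eval m p (Cell (addr [Lit 7, I, Q, G, K, L, P])) = cross w i q g k l p0 c"
        using S2 l 4 alo e p0 by simp
      have "eval m p (cross_e (Cell (addr [Lit 7, I, Q, G, K, L, P])) I Q G K L P (\<lambda>L3 P3 G3 A.
         bind_e (new_pp_e d C L3 P3 G3) (\<lambda>L4 P4. mapup_e d (fu_e I Q G A (dn_e d L4) P4)))) = ?r"
      proof (rule eval_cross_e[OF vw e l(1) p0(1) X rg p0(2) ik l(2) 4 c_le(1) alo])
        assume "cross w i q g k l p0 c = i"
        then show "?r = 0" using cross_start[OF alo ik _ 4 c_le(1)] late kc c_le by simp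
      next
        fix L3 P3 G3 A a x1 x2 y1 y2 g' l3 p3
        assume h: "cross w i q g k l p0 c = Suc a" "i \<le> a" "a < k"
          "cf w i q g (Suc a) = Some (x1, x2)" "cf w i q g a = Some (y1, y2)"
          "stp (w ! a) y1 y2 = Some (x1, [x2, g'])"
          "pp w l p0 (rest w (Suc a) x1 x2 k) = Some (l3, p3)" "l \<le> l3" "l3 \<le> c" "p3 < cap" "g' < cap"
          "eval m p L3 = l3" "eval m p P3 = p3" "eval m p G3 = g'" "eval m p A = a"
        note PR = pp_rest_edit[OF alo ik l(2) 4 late h(1,4,5,6,7)]
        have "l3 \<le> length w'" using h(9) len_edit by simp
        note N = ev_new_pp[OF vw h(12,13,14,10,11) this]
        show "eval m p (bind_e (new_pp_e d C L3 P3 G3) (\<lambda>L4 P4. mapup_e d (fu_e I Q G A (dn_e d L4) P4))) = ?r"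
        proof (rule eval_bind_e[OF N])
          show "p' < cap" if "pp w' l3 p3 [g'] = Some (l', p')" for l' p' using pp_range[OF that h(10)] .
          show "?r = 0" if "pp w' l3 p3 [g'] = None" using PR(1) that by simp
          fix l4 p4 assume f: "pp w' l3 p3 [g'] = Some (l4, p4)" "p4 < cap"
            "eval m p (fst_e (new_pp_e d C L3 P3 G3)) = l4" "eval m p (snd_e (new_pp_e d C L3 P3 G3)) = p4"
          have "\<not> early (pp w' l3 p3 [g']) c" using PR(3) early_edit by simp
          then have cl: "c < l4" using f by (simp add: early_def)
          have lw: "l4 \<le> length w'" using pp_le[OF f(1)] by simp
          have "eval m p (fu_e I Q G A (dn_e d (fst_e (new_pp_e d C L3 P3 G3))) (snd_e (new_pp_e d C L3 P3 G3))) =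
            opc (pp w (dn l4) p4 (rest w i q g a))"
            using f e rg h cl dn_le[OF lw cl] up_dn(3)[OF cl] c_le kc by (simp add: ev ev_fu[OF vw])
          then have "eval m p (mapup_e d (fu_e I Q G A (dn_e d (fst_e (new_pp_e d C L3 P3 G3))) (snd_e (new_pp_e d C L3 P3 G3)))) =
            opc (mapup (pp w (dn l4) p4 (rest w i q g a)))"
            by (rule ev_mapup[OF vw]) (use pp_range f in auto)
          then show "eval m p (mapup_e d (fu_e I Q G A (dn_e d (fst_e (new_pp_e d C L3 P3 G3))) (snd_e (new_pp_e d C L3 P3 G3)))) = ?r"
            using PR(1) f(1) by simp
        qed
      qed
      then show ?thesis using 4 kc ik e l he late rw by (simp add: new_fu_e_def ev)
    qed
  qed
qed

end

end

end

subsection \<open>The update program\<close>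

context table_prog
begin

abbreviation "I \<equiv> fi rd"
abbreviation "K \<equiv> fk rd"
abbreviation "L \<equiv> fl rd"
abbreviation "Q \<equiv> fq rd cap"
abbreviation "G \<equiv> fg rd cap"
abbreviation "S \<equiv> fp rd cap"

text \<open>This is the copy that \<open>old_e\<close> does not read. All statements see the old
  tables until the last scalar flips \<open>par\<close>.\<close>

definition "new_head h = minus_e (Lit (h + 1)) par_e"

definition "nprocs_e = times_e D_e (times_e (pow_e D_e rd) (times_e (pow_e D_e rd) (times_e (pow_e D_e rd)
  (Lit (cap * (cap * cap))))))"

text \<open>Head 6 stores the threshold for the symbol under way at the end \<open>dn K\<close> of a
  run that crosses the change, head 7 the one for the symbol under way at the change while a stack
  left before it is popped.\<close>

definition "search6 d C = search_prog rd 6 [I, Q, G, K]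
  (and_e (le_e I C) (and_e (lt_e C K) (and_e (le_e K (nl_e d)) (early_e (resume_e d C I Q G) (dn_e d K)))))
  (le_cross_e I Q G C (fst_e (resume_e d C I Q G)) (snd_e (resume_e d C I Q G)) (dn_e d K))"

definition "search7 C = search_prog rd 7 [I, Q, G, K, L, S]
  (and_e (le_e I K) (and_e (le_e K L) (and_e (le_e L C) (cf_e I Q G K))))
  (le_cross_e I Q G K L S C)"

definition "store_let d C = store (lt_e I (nl_e d)) [new_head 8, I] (new_let_e d C I)"
definition "store_cf d C = store (and_e (lt_e I K) (le_e K (nl_e d)))
  [new_head 10, I, Q, G, K] (new_cf_e d C I Q G K)"
definition "store_pp d C = store (le_e L (nl_e d)) [new_head 12, L, Q, G] (new_pp_e d C L Q G)"
text \<open>The third position field plays the part of \<open>x\<close> here.\<close>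

definition "store_an d C = store (and_e (le_e I L) (and_e (le_e L K) (and_e (le_e K (nl_e d))
  (new_cf_e d C I Q G K)))) [new_head 14, I, Q, G, K, L] (new_an_e d C I Q G K L)"
definition "store_fu d C = store (and_e (lt_e I K) (and_e (le_e K L) (and_e (le_e L (nl_e d))
  (new_cf_e d C I Q G K)))) [new_head 16, I, Q, G, K, L, S] (new_fu_e d C I Q G K L S)"

text \<open>The order matters: the radix is chosen by the new length, the number of processors by
  the new radix, and the parity is flipped last.\<close>

definition "scalars d = [(Lit (cell [4]), nl_e d),
  (Lit (cell [3]), if_e (lt_e (pow_e D_e rd) (times_e (Lit 4) (plus_e len_e (Lit 1)))) (times_e (Lit 2) D_e) D_e),
  (Lit 0, nprocs_e), (Lit (cell [5]), minus_e (Lit 1) par_e)]"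

definition "update_prog d C = search6 d C @ search7 C @
  [store_let d C, store_cf d C, store_pp d C, store_an d C, store_fu d C] @ scalars d"

end

text \<open>\<open>stable\<close> says that \<open>C\<close> depends only on the argument cell 1 and
  the stored length, so it keeps its value while tables are written. \<open>V\<close> bounds
  whatever an update stores in tables and search cells.\<close>

locale update = edit_view stp cap w w' s c d b up dn al rd C par D
  for stp :: "nat \<Rightarrow> nat \<Rightarrow> nat \<Rightarrow> (nat \<times> nat list) option" and cap :: nat
    and w w' :: "nat list" and s c d b :: nat and up dn :: "nat \<Rightarrow> nat" and al :: "nat list" and rd :: nat
    and C :: exp and par D :: nat +
  fixes V :: nat
  assumes capV: "cap * cap \<le> V" and par: "par \<le> 1" and size: "length w' < D ^ rd" and D0: "0 < D"
    and stable: "\<And>m m' p. m 1 = m' 1 \<Longrightarrow> m (cell [4]) = m' (cell [4]) \<Longrightarrow> eval m p C = eval m' p C"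
    and V: "(length w' + 1) * cap \<le> V" "D ^ rd \<le> V" "\<And>a. a \<in> set al \<Longrightarrow> a \<le> V"
begin

abbreviation P where "P \<equiv> nprocs rd cap D"
definition "npar = 1 - par"

lemma new_head_eval: "view m \<Longrightarrow> eval m p (new_head h) = h + npar"
  using par ev_basic(9)[of m p] by (simp add: new_head_def npar_def)

text \<open>The fields read no cell but \<open>cell [3]\<close>, which holds \<open>D\<close>;
  evaluating them in the constant memory \<open>D\<close> turns them into functions of the processor
  number alone.\<close>

definition "xf e p = eval (\<lambda>_. D) p e"

abbreviation "xi \<equiv> xf I"
abbreviation "xk \<equiv> xf K"
abbreviation "xl \<equiv> xf L"
abbreviation "xq \<equiv> xf Q"
abbreviation "xg \<equiv> xf G"
abbreviation "xs \<equiv> xf S"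

lemma fields: assumes "view m" shows "eval m p I = xi p" "eval m p K = xk p" "eval m p L = xl p"
  "eval m p Q = xq p" "eval m p G = xg p" "eval m p S = xs p"
  using assms by (simp_all add: view_def xf_def field_defs)

lemma field_bounds: "xq p < cap" "xg p < cap" "xs p < cap" "xi p < D ^ rd" "xk p < D ^ rd" "xl p < D ^ rd"
  using D0 cap by (simp_all add: xf_def fq_def fg_def fp_def fi_def fk_def fl_def D_e_def)

lemma fields_ex:
  assumes "a < D" "i < D ^ rd" "k < D ^ rd" "l < D ^ rd" "q < cap" "g < cap" "x < cap"
  shows "\<exists>p<P. xi p = i \<and> xk p = k \<and> xl p = l \<and> xq p = q \<and> xg p = g \<and> xs p = x \<and> p mod D = a"
proof -
  obtain p where p: "p < P" "\<And>m. m (cell [3]) = D \<Longrightarrow> eval m p fa = a \<and> eval m p (fi rd) = i \<and> eval m p (fk rd) = k \<and>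
       eval m p (fl rd) = l \<and> eval m p (fq rd cap) = q \<and> eval m p (fg rd cap) = g \<and> eval m p (fp rd cap) = x"
    using fields_surj[OF assms] by metis
  show ?thesis using p(1) p(2)[of "\<lambda>_. D"] by (intro exI[of _ p]) (simp add: xf_def fa_def D_e_def)
qed

lemma radix_pos: "0 < D ^ rd"
  using D0 by simp

lemma P0: "0 < P"
  using D0 cap by (simp add: nprocs_def)

definition "heads = {6, 7, 8 + npar, 10 + npar, 12 + npar, 14 + npar, 16 + npar}"

text \<open>\<open>heads\<close> lists the search results and the copies not in use; the old view
  reads none of them. So the old tables stay legible until all new entries are stored.\<close>

lemma view_same_off:
  assumes "view m" "same_off heads m m'"
  shows "view m'"
proof -
  have np: "npar = 0 \<and> par = 1 \<or> npar = 1 \<and> par = 0" using par by (auto simp: npar_def)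
  have eq: "m' (cell (h # \<kappa>)) = m (cell (h # \<kappa>))" if "h \<noteq> 2" "h \<notin> heads" for h \<kappa>
  proof -
    have "cell (h # \<kappa>) \<noteq> cell [2]" "\<forall>h'\<in>heads. \<forall>\<kappa>'. cell (h # \<kappa>) \<noteq> cell (h' # \<kappa>')"
      using that by auto
    then show ?thesis using assms(2) unfolding same_off_def by blast
  qed
  have low: "m' x = m x" if "x \<le> 3" for x
  proof -
    have "x \<noteq> cell (h # \<kappa>)" if "2 \<le> h" for h \<kappa> using cell_gt_3[OF that, of \<kappa>] \<open>x \<le> 3\<close> by simp
    moreover have "\<forall>h\<in>heads. 2 \<le> h" by (auto simp: heads_def)
    ultimately show ?thesis using assms(2) unfolding same_off_def by simp
  qed
  have "8 + par \<notin> heads" "10 + par \<notin> heads" "12 + par \<notin> heads" "14 + par \<notin> heads" "16 + par \<notin> heads"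
    using np by (auto simp: heads_def)
  then have "tables w par m'"
    using assms(1) unfolding view_def tables_def by (simp add: eq)
  moreover have "eval m' p C = c" for p
    using stable[of m' m p] assms(1) low[of 1] eq[of 4 "[]"] by (auto simp: view_def heads_def)
  ultimately show ?thesis
    using assms(1) low[of 2] eq[of 3 "[]"] eq[of 4 "[]"] eq[of 5 "[]"] np
    by (auto simp: view_def heads_def)
qed

lemma view_off1: "view m \<Longrightarrow> same_off {h} m m' \<Longrightarrow> h \<in> heads \<Longrightarrow> view m'"
  using view_same_off same_off_mono[of "{h}" m m' heads] by blast

section \<open>The two searches of an update\<close>

definition "cross6 \<kappa> = (case resume (\<kappa> ! 0) (\<kappa> ! 1) (\<kappa> ! 2) of None \<Rightarrow> 0
  | Some (l2, p2) \<Rightarrow> cross w (\<kappa> ! 0) (\<kappa> ! 1) (\<kappa> ! 2) c l2 p2 (dn (\<kappa> ! 3)))"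

definition "gd6 p \<longleftrightarrow> xi p \<le> c \<and> c < xk p \<and> xk p \<le> length w' \<and> early (resume (xi p) (xq p) (xg p)) (dn (xk p))"

lemma c_size: "c < D ^ rd" "length w < D ^ rd"
  using len_edit size d by (auto simp: up)

lemma search6_correct:
  assumes "view m" "\<And>x. m x \<le> V"
  shows "all_consistent P (search6 d C) m" "same_off {6} m (exec P (search6 d C) m)"
    "exec P (search6 d C) m x \<le> V"
    "i \<le> c \<Longrightarrow> c < k \<Longrightarrow> k \<le> length w' \<Longrightarrow> q < cap \<Longrightarrow> g < cap \<Longrightarrow> resume i q g = Some (l2, p2) \<Longrightarrow> l2 \<le> dn k \<Longrightarrow>
     exec P (search6 d C) m (cell [6, i, q, g, k]) = cross w i q g c l2 p2 (dn k)"
proof -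
  let ?R = "resume_e d C I Q G" and ?key = "\<lambda>p. [xi p, xq p, xg p, xk p]"
  let ?gd = "and_e (le_e I C) (and_e (lt_e C K) (and_e (le_e K (nl_e d)) (early_e ?R (dn_e d K))))"
  have gd: "holds m' p ?gd \<longleftrightarrow> gd6 p" if v: "view m'" for m' p
  proof (cases "xi p \<le> c \<and> c < xk p")
    case True
    have "eval m' p ?R = opc (resume (xi p) (xq p) (xg p))"
      by (rule ev_resume[OF v]) (use fields[OF v] field_bounds True in auto)
    then have "holds m' p (early_e ?R (dn_e d K)) \<longleftrightarrow> early (resume (xi p) (xq p) (xg p)) (dn (xk p))"
      by (rule holds_early_e) (use resume_range fields[OF v] True ev_dn[OF v] in auto)
    then show ?thesis using True fields[OF v] ev_basic[OF v] by (simp add: gd6_def)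
  next
    case False
    then show ?thesis using fields[OF v] ev_basic[OF v] by (auto simp: gd6_def)
  qed
  have main: "gd6 p \<Longrightarrow> \<exists>y l2 p2. cf w (xi p) (xq p) (xg p) c = Some y \<and> resume (xi p) (xq p) (xg p) = Some (l2, p2) \<and>
     b \<le> l2 \<and> l2 \<le> dn (xk p) \<and> dn (xk p) \<le> length w \<and> p2 < cap" for p
  proof -
    assume g: "gd6 p"
    obtain l2 p2 where r: "resume (xi p) (xq p) (xg p) = Some (l2, p2)" "l2 \<le> dn (xk p)"
      using g by (auto simp: gd6_def early_def)
    obtain y where "cf w (xi p) (xq p) (xg p) c = Some y"
      using r(1) by (auto simp: resume_def bind_eq_Some_conv)
    then show ?thesis
      using r resume_le[OF r(1)] resume_range[OF r(1)] dn_le[of "xk p"] g by (simp add: gd6_def)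
  qed
  have pr: "holds m' p (le_cross_e I Q G C (fst_e ?R) (snd_e ?R) (dn_e d K) X) \<longleftrightarrow> eval m' p X \<le> cross6 (?key p)"
    if v: "view m'" and g: "gd6 p" for m' p X
  proof -
    obtain y l2 p2 where y: "cf w (xi p) (xq p) (xg p) c = Some y" "resume (xi p) (xq p) (xg p) = Some (l2, p2)"
     "b \<le> l2" "l2 \<le> dn (xk p)" "dn (xk p) \<le> length w" "p2 < cap" using main[OF g] by blast
    have gg: "xi p \<le> c" "c < xk p" using g by (auto simp: gd6_def)
    have "eval m' p ?R = opc (resume (xi p) (xq p) (xg p))"
      by (rule ev_resume[OF v]) (use fields[OF v] field_bounds gg in auto)
    note E = eval_fst_snd[OF this y(2,6)]
    have "eval m' p (dn_e d K) = dn (xk p)" using ev_dn[OF v] fields[OF v] gg by simp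
    then show ?thesis
      using holds_le_cross[OF v fields(1,4,5)[OF v] ev_basic(1)[OF v] E(1,2) _ field_bounds(1,2) y(6) gg(1) _ y(4,5,1)]
        y c_le by (simp add: cross6_def)
  qed
  note SC = search_correct[where Vw = view and m = m and h = 6 and D = D and ks = "[I, Q, G, K]" and key = ?key
      and g = ?gd and gd = gd6 and pr = "le_cross_e I Q G C (fst_e ?R) (snd_e ?R) (dn_e d K)" and T = cross6
      and rd = rd and P = P, folded search6_def]
  have T: "cross6 (?key p) < D ^ rd" if g: "gd6 p" for p
  proof -
    obtain y l2 p2 where y: "cf w (xi p) (xq p) (xg p) c = Some y" "resume (xi p) (xq p) (xg p) = Some (l2, p2)"
     "b \<le> l2" "l2 \<le> dn (xk p)" "dn (xk p) \<le> length w" using main[OF g] by blast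
    have "xi p \<le> c" using g by (auto simp: gd6_def)
    then show ?thesis using cross_props(2)[OF y(1) _ c_le(1) y(4,5), of p2] c_size y(2) by (simp add: cross6_def)
  qed
  \<comment> \<open>The digit is a field of its own, so it varies freely while key and guard stay
    fixed.\<close>
  have dg: "\<exists>p'<P. gd6 p' \<and> ?key p' = ?key p \<and> p' mod D = a" if pa: "p < P" "gd6 p" "a < D" for p a
  proof -
    obtain p' where p': "p' < P" "xi p' = xi p" "xk p' = xk p" "xl p' = xl p" "xq p' = xq p" "xg p' = xg p" "p' mod D = a"
      using fields_ex[OF pa(3) field_bounds(4,5,6,1,2,3), of p p p p p p] by blast
    then have "gd6 p'" using pa by (simp add: gd6_def)
    then show ?thesis using p' by auto
  qed
  have vo: "same_off {6} m m' \<Longrightarrow> view m'" for m' using view_off1[OF assms(1), of 6] by (simp add: heads_def)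
  have Dv: "view m' \<Longrightarrow> m' (cell [3]) = D" for m' by (simp add: view_def)
  have ky: "view m' \<Longrightarrow> map (eval m' p) [I, Q, G, K] = ?key p" for m' p using fields by simp
  show "all_consistent P (search6 d C) m"
    by (rule SC(1)) (use vo Dv ky gd pr T dg rd D0 in auto)
  show "same_off {6} m (exec P (search6 d C) m)"
    by (rule SC(2)) (use vo Dv ky gd pr T dg rd D0 in auto)
  show "exec P (search6 d C) m x \<le> V"
    by (rule SC(4)) (use vo Dv ky gd pr T dg rd D0 assms(2) V(2) in auto)
  show "exec P (search6 d C) m (cell [6, i, q, g, k]) = cross w i q g c l2 p2 (dn k)"
    if h: "i \<le> c" "c < k" "k \<le> length w'" "q < cap" "g < cap" "resume i q g = Some (l2, p2)" "l2 \<le> dn k"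
  proof -
    obtain p where p: "p < P" "xi p = i" "xk p = k" "xl p = 0" "xq p = q" "xg p = g"
      using fields_ex[OF D0 le_less_trans[OF h(1) c_size(1)] le_less_trans[OF h(3) size] radix_pos h(4,5) cap] by blast
    have "gd6 p" using p h by (simp add: gd6_def early_def)
    have "exec P (search6 d C) m (cell (6 # ?key p)) = cross6 (?key p)"
      by (rule SC(3)[OF _ _ _ _ _ _ _ _ _ _ p(1) \<open>gd6 p\<close>]) (use vo Dv ky gd pr T dg rd D0 in auto)
    then show ?thesis using p h by (simp add: cross6_def)
  qed
qed

definition "cross7 \<kappa> = cross w (\<kappa> ! 0) (\<kappa> ! 1) (\<kappa> ! 2) (\<kappa> ! 3) (\<kappa> ! 4) (\<kappa> ! 5) c"

definition "gd7 p \<longleftrightarrow> xi p \<le> xk p \<and> xk p \<le> xl p \<and> xl p \<le> c \<and> cf w (xi p) (xq p) (xg p) (xk p) \<noteq> None"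

lemma search7_correct:
  assumes "view m" "\<And>x. m x \<le> V"
  shows "all_consistent P (search7 C) m" "same_off {7} m (exec P (search7 C) m)"
    "exec P (search7 C) m x \<le> V"
    "i \<le> k \<Longrightarrow> k \<le> l \<Longrightarrow> l \<le> c \<Longrightarrow> q < cap \<Longrightarrow> g < cap \<Longrightarrow> p0 < cap \<Longrightarrow> cf w i q g k \<noteq> None \<Longrightarrow>
     exec P (search7 C) m (cell [7, i, q, g, k, l, p0]) = cross w i q g k l p0 c"
proof -
  let ?key = "\<lambda>p. [xi p, xq p, xg p, xk p, xl p, xs p]"
  let ?gd = "and_e (le_e I K) (and_e (le_e K L) (and_e (le_e L C) (cf_e I Q G K)))"
  have gd: "holds m' p ?gd \<longleftrightarrow> gd7 p" if v: "view m'" for m' p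
  proof (cases "xi p \<le> xk p \<and> xk p \<le> xl p \<and> xl p \<le> c")
    case True
    then have "eval m' p (cf_e I Q G K) = opc (cf w (xi p) (xq p) (xg p) (xk p))"
      using ev_cf[OF v, of p I K Q G] fields[OF v] field_bounds c_le by simp
    then show ?thesis using True fields[OF v] ev_basic[OF v] by (simp add: gd7_def holds_def[of m' p "cf_e _ _ _ _"])
  next
    case False
    then show ?thesis using fields[OF v] ev_basic[OF v] by (auto simp: gd7_def)
  qed
  have pr: "holds m' p (le_cross_e I Q G K L S C X) \<longleftrightarrow> eval m' p X \<le> cross7 (?key p)"
    if v: "view m'" and g: "gd7 p" for m' p X
  proof -
    obtain y where y: "cf w (xi p) (xq p) (xg p) (xk p) = Some y" using g by (auto simp: gd7_def)
    show ?thesis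
      using holds_le_cross[OF v fields(1,4,5,2,3,6)[OF v] ev_basic(1)[OF v] field_bounds(1,2,3) _ _ _ c_le(1) y] g
      by (simp add: cross7_def gd7_def)
  qed
  note SC = search_correct[where Vw = view and m = m and h = 7 and D = D and ks = "[I, Q, G, K, L, S]" and key = ?key
      and g = ?gd and gd = gd7 and pr = "le_cross_e I Q G K L S C" and T = cross7
      and rd = rd and P = P, folded search7_def]
  have T: "cross7 (?key p) < D ^ rd" if g: "gd7 p" for p
  proof -
    obtain y where y: "cf w (xi p) (xq p) (xg p) (xk p) = Some y" using g by (auto simp: gd7_def)
    have "xk p \<le> length w" using g c_le by (auto simp: gd7_def)
    then show ?thesis using cross_props(2)[OF y _ _ _ c_le(1), of "xl p" "xs p"] c_size g by (simp add: cross7_def gd7_def)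
  qed
  have dg: "\<exists>p'<P. gd7 p' \<and> ?key p' = ?key p \<and> p' mod D = a" if pa: "p < P" "gd7 p" "a < D" for p a
  proof -
    obtain p' where p': "p' < P" "xi p' = xi p" "xk p' = xk p" "xl p' = xl p" "xq p' = xq p" "xg p' = xg p"
      "xs p' = xs p" "p' mod D = a"
      using fields_ex[OF pa(3) field_bounds(4,5,6,1,2,3), of p p p p p p] by blast
    then have "gd7 p'" using pa by (simp add: gd7_def)
    then show ?thesis using p' by auto
  qed
  have vo: "same_off {7} m m' \<Longrightarrow> view m'" for m' using view_off1[OF assms(1), of 7] by (simp add: heads_def)
  have Dv: "view m' \<Longrightarrow> m' (cell [3]) = D" for m' by (simp add: view_def)
  have ky: "view m' \<Longrightarrow> map (eval m' p) [I, Q, G, K, L, S] = ?key p" for m' p using fields by simp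
  show "all_consistent P (search7 C) m"
    by (rule SC(1)) (use vo Dv ky gd pr T dg rd D0 in auto)
  show "same_off {7} m (exec P (search7 C) m)"
    by (rule SC(2)) (use vo Dv ky gd pr T dg rd D0 in auto)
  show "exec P (search7 C) m x \<le> V"
    by (rule SC(4)) (use vo Dv ky gd pr T dg rd D0 assms(2) V(2) in auto)
  show "exec P (search7 C) m (cell [7, i, q, g, k, l, p0]) = cross w i q g k l p0 c"
    if h: "i \<le> k" "k \<le> l" "l \<le> c" "q < cap" "g < cap" "p0 < cap" "cf w i q g k \<noteq> None"
  proof -
    have n: "i < D ^ rd" "k < D ^ rd" "l < D ^ rd" using h c_size by auto
    obtain p where p: "p < P" "xi p = i" "xk p = k" "xl p = l" "xq p = q" "xg p = g" "xs p = p0"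
      using fields_ex[OF D0 n h(4,5,6)] by blast
    have "gd7 p" using p h by (simp add: gd7_def)
    have "exec P (search7 C) m (cell (7 # ?key p)) = cross7 (?key p)"
      by (rule SC(3)[OF _ _ _ _ _ _ _ _ _ _ p(1) \<open>gd7 p\<close>]) (use vo Dv ky gd pr T dg rd D0 in auto)
    then show ?thesis using p h by (simp add: cross7_def)
  qed
qed

section \<open>Storing the new tables\<close>

definition ready :: "memory \<Rightarrow> bool" where
  "ready m \<longleftrightarrow> view m \<and> (\<forall>x. m x \<le> V) \<and>
    (\<forall>i k q g l2 p2. i \<le> c \<longrightarrow> c < k \<longrightarrow> k \<le> length w' \<longrightarrow> q < cap \<longrightarrow> g < cap \<longrightarrow> resume i q g = Some (l2, p2) \<longrightarrow>
       l2 \<le> dn k \<longrightarrow> m (cell [6, i, q, g, k]) = cross w i q g c l2 p2 (dn k)) \<and>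
    (\<forall>i k l q g p0. i \<le> k \<longrightarrow> k \<le> l \<longrightarrow> l \<le> c \<longrightarrow> q < cap \<longrightarrow> g < cap \<longrightarrow> p0 < cap \<longrightarrow> cf w i q g k \<noteq> None \<longrightarrow>
       m (cell [7, i, q, g, k, l, p0]) = cross w i q g k l p0 c)"

lemma ready_searches:
  assumes "view m" "\<And>x. m x \<le> V"
  shows "all_consistent P (search6 d C @ search7 C) m" "ready (exec P (search6 d C @ search7 C) m)"
proof -
  let ?m6 = "exec P (search6 d C) m"
  note A = search6_correct[OF assms]
  have v6: "view ?m6" using view_off1[OF assms(1) A(2)] by (simp add: heads_def)
  note B = search7_correct[OF v6 A(3)]
  have v7: "view (exec P (search7 C) ?m6)" using view_off1[OF v6 B(2)] by (simp add: heads_def)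
  have "exec P (search7 C) ?m6 (cell (6 # \<kappa>)) = ?m6 (cell (6 # \<kappa>))" for \<kappa>
    using B(2) by (simp add: same_off_def)
  then show "ready (exec P (search6 d C @ search7 C) m)"
    using v7 A(4) B(3,4) by (simp add: ready_def exec_append)
  show "all_consistent P (search6 d C @ search7 C) m" using A(1) B(1) by (simp add: all_consistent_append)
qed

lemma ready_same_off:
  assumes "ready m" "same_off {h} m m'" "h \<in> heads" "h \<noteq> 6" "h \<noteq> 7" "\<And>x. m' x \<le> V"
  shows "ready m'"
proof -
  have "m' (cell (6 # \<kappa>)) = m (cell (6 # \<kappa>))" "m' (cell (7 # \<kappa>)) = m (cell (7 # \<kappa>))" for \<kappa>
    using assms(2,4,5) by (auto simp: same_off_def)
  then show ?thesis using assms view_off1[OF _ assms(2,3)] unfolding ready_def by simp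
qed

lemma readyD:
  assumes "ready m"
  shows "view m" "m x \<le> V"
    "k \<le> length w' \<Longrightarrow> q < cap \<Longrightarrow> g < cap \<Longrightarrow> i \<le> c \<Longrightarrow> c < k \<Longrightarrow> resume i q g = Some (l2, p2) \<Longrightarrow>
       l2 \<le> dn k \<Longrightarrow> m (cell [6, i, q, g, k]) = cross w i q g c l2 p2 (dn k)"
    "i \<le> k \<Longrightarrow> q < cap \<Longrightarrow> g < cap \<Longrightarrow> p0 < cap \<Longrightarrow> k \<le> l \<Longrightarrow> l \<le> c \<Longrightarrow> cf w i q g k \<noteq> None \<Longrightarrow>
       m (cell [7, i, q, g, k, l, p0]) = cross w i q g k l p0 c"
  using assms unfolding ready_def by auto

lemma opc_le:
  assumes "\<And>l q. z = Some (l, q) \<Longrightarrow> l \<le> length w' \<and> q < cap"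
  shows "opc z \<le> V"
proof (cases z)
  case (Some y)
  obtain l q where y: "z = Some (l, q)" using Some by (cases y) auto
  have "l * cap + q < (l + 1) * cap" using assms[OF y] by simp
  also have "\<dots> \<le> (length w' + 1) * cap" using assms[OF y] by (intro mult_le_mono1) simp
  finally show ?thesis using y V(1) by simp
qed simp

lemma cf_le: "q < cap \<Longrightarrow> g < cap \<Longrightarrow> opc (cf u i q g k) \<le> V"
proof (cases "cf u i q g k")
  case (Some y)
  assume qg: "q < cap" "g < cap"
  obtain q' g' where y: "cf u i q g k = Some (q', g')" using Some by (cases y) auto
  have r: "q' < cap" "g' < cap" using cf_range[OF y qg] by auto
  have "q' * cap + g' < (q' + 1) * cap" using r by simp
  also have "\<dots> \<le> cap * cap" using r by (intro mult_le_mono1) simp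
  finally show ?thesis using y capV by simp
qed simp

lemma len_V: "length w' \<le> V" using size V(2) by simp

lemma table_store:
  assumes r: "ready m" and h: "h \<in> {8, 10, 12, 14, 16}"
    and as: "\<And>p. map (eval m p) as = key p"
    and gd: "\<And>p. holds m p g \<longleftrightarrow> gd p"
    and v: "\<And>p. gd p \<Longrightarrow> eval m p v = F (key p) \<and> F (key p) \<le> V"
  shows "consistent P (store g (new_head h # as) v) m"
    "ready (exec_stmt P (store g (new_head h # as) v) m)"
    "same_off {h + npar} m (exec_stmt P (store g (new_head h # as) v) m)"
    "p < P \<Longrightarrow> gd p \<Longrightarrow> exec_stmt P (store g (new_head h # as) v) m (cell ((h + npar) # key p)) = F (key p)"
proof -
  have F: "\<forall>p<P. holds m p g \<longrightarrow> map (eval m p) (new_head h # as) = (h + npar) # key p \<and> eval m p v = F (key p)"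
    using as gd v new_head_eval[OF readyD(1)[OF r]] by simp
  have h2: "h + npar \<noteq> 2" using h by auto
  note SC = store_correct[where P = P and g = g and as = "new_head h # as" and v = v and F = F and key = key, OF F h2]
  show "consistent P (store g (new_head h # as) v) m" using SC(1) .
  show so: "same_off {h + npar} m (exec_stmt P (store g (new_head h # as) v) m)"
    using SC(3) by (simp add: same_off_def)
  show "p < P \<Longrightarrow> gd p \<Longrightarrow> exec_stmt P (store g (new_head h # as) v) m (cell ((h + npar) # key p)) = F (key p)"
    using SC(2) gd by simp
  have bd: "exec_stmt P (store g (new_head h # as) v) m x \<le> V" for x
    by (rule SC(4)) (use v gd readyD(2)[OF r] in auto)
  show "ready (exec_stmt P (store g (new_head h # as) v) m)"
    by (rule ready_same_off[OF r so _ _ _ bd]) (use h in \<open>auto simp: heads_def\<close>)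
qed

lemma new_cf_fields:
  assumes "ready m" "xi p \<le> xk p" "xk p \<le> length w'"
  shows "eval m p (new_cf_e d C I Q G K) = opc (cf w' (xi p) (xq p) (xg p) (xk p))"
  by (rule ev_new_cf[OF readyD(1)[OF assms(1)] fields(1,4,5,2)[OF readyD(1)[OF assms(1)]] field_bounds(1,2) assms(2,3)])
    (rule readyD(3)[OF assms(1,3) field_bounds(1,2)])

lemma store_let_correct:
  assumes r: "ready m"
  shows "consistent P (store_let d C) m" "ready (exec_stmt P (store_let d C) m)"
    "same_off {8 + npar} m (exec_stmt P (store_let d C) m)"
    "j < length w' \<Longrightarrow> exec_stmt P (store_let d C) m (cell [8 + npar, j]) = w' ! j"
proof -
  note v = readyD(1)[OF r]
  have gd: "holds m p (lt_e I (nl_e d)) \<longleftrightarrow> xi p < length w'" for p using fields[OF v] ev_basic[OF v] by simp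
  have "set w' \<subseteq> set al"
    using letters set_take_subset[of c w] set_drop_subset[of "c + d" w] by (auto simp: w')
  then have al: "j < length w' \<Longrightarrow> w' ! j \<le> V" for j using V(3) nth_mem by blast
  note T = table_store[where key = "\<lambda>p. [xi p]" and F = "\<lambda>\<kappa>. w' ! (\<kappa> ! 0)" and gd = "\<lambda>p. xi p < length w'", OF r _ _ gd, of 8,
      folded store_let_def]
  have a: "map (eval m p) [I] = [xi p]" for p using fields[OF v] by simp
  have f: "eval m p (new_let_e d C I) = w' ! ([xi p] ! 0) \<and> w' ! ([xi p] ! 0) \<le> V" if "xi p < length w'" for p
    using ev_new_let[OF v fields(1)[OF v] that] al[OF that] by simp
  show "consistent P (store_let d C) m" unfolding store_let_def by (rule T(1)[OF _ a f]) auto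
  show "ready (exec_stmt P (store_let d C) m)" unfolding store_let_def by (rule T(2)[OF _ a f]) auto
  show "same_off {8 + npar} m (exec_stmt P (store_let d C) m)" unfolding store_let_def by (rule T(3)[OF _ a f]) auto
  show "exec_stmt P (store_let d C) m (cell [8 + npar, j]) = w' ! j" if jw: "j < length w'"
  proof -
    obtain p where p: "p < P" "xi p = j" using fields_ex[OF D0 less_trans[OF jw size] radix_pos radix_pos cap cap cap] by blast
    have "exec_stmt P (store_let d C) m (cell ((8 + npar) # [xi p])) = w' ! ([xi p] ! 0)"
      unfolding store_let_def by (rule T(4)[OF _ a f]) (use p jw in auto)
    then show ?thesis using p by simp
  qed
qed

lemma store_cf_correct:
  assumes r: "ready m"
  shows "consistent P (store_cf d C) m" "ready (exec_stmt P (store_cf d C) m)"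
    "same_off {10 + npar} m (exec_stmt P (store_cf d C) m)"
    "i < k \<Longrightarrow> k \<le> length w' \<Longrightarrow> q < cap \<Longrightarrow> g < cap \<Longrightarrow>
       exec_stmt P (store_cf d C) m (cell [10 + npar, i, q, g, k]) = opc (cf w' i q g k)"
proof -
  note v = readyD(1)[OF r]
  let ?F = "\<lambda>\<kappa>. opc (cf w' (\<kappa> ! 0) (\<kappa> ! 1) (\<kappa> ! 2) (\<kappa> ! 3))" and ?key = "\<lambda>p. [xi p, xq p, xg p, xk p]"
  have gd: "holds m p (and_e (lt_e I K) (le_e K (nl_e d))) \<longleftrightarrow> xi p < xk p \<and> xk p \<le> length w'" for p
    using fields[OF v] ev_basic[OF v] by simp
  note T = table_store[where key = ?key and F = ?F and gd = "\<lambda>p. xi p < xk p \<and> xk p \<le> length w'", OF r _ _ gd, of 10]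
  have a: "map (eval m p) [I, Q, G, K] = ?key p" for p using fields[OF v] by simp
  have f: "eval m p (new_cf_e d C I Q G K) = ?F (?key p) \<and> ?F (?key p) \<le> V" if "xi p < xk p \<and> xk p \<le> length w'" for p
    using new_cf_fields[OF r, of p] that cf_le field_bounds by simp
  show "consistent P (store_cf d C) m" unfolding store_cf_def by (rule T(1)[OF _ a f]) auto
  show "ready (exec_stmt P (store_cf d C) m)" unfolding store_cf_def by (rule T(2)[OF _ a f]) auto
  show "same_off {10 + npar} m (exec_stmt P (store_cf d C) m)" unfolding store_cf_def by (rule T(3)[OF _ a f]) auto
  show "exec_stmt P (store_cf d C) m (cell [10 + npar, i, q, g, k]) = opc (cf w' i q g k)"
    if h: "i < k" "k \<le> length w'" "q < cap" "g < cap"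
  proof -
    have n: "i < D ^ rd" "k < D ^ rd" using h size by auto
    obtain p where p: "p < P" "xi p = i" "xk p = k" "xq p = q" "xg p = g"
      using fields_ex[OF D0 n radix_pos h(3,4) cap] by blast
    have "exec_stmt P (store_cf d C) m (cell ((10 + npar) # ?key p)) = ?F (?key p)"
      unfolding store_cf_def by (rule T(4)[OF _ a f]) (use p h in auto)
    then show ?thesis using p by simp
  qed
qed

lemma store_pp_correct:
  assumes r: "ready m"
  shows "consistent P (store_pp d C) m" "ready (exec_stmt P (store_pp d C) m)"
    "same_off {12 + npar} m (exec_stmt P (store_pp d C) m)"
    "l \<le> length w' \<Longrightarrow> q < cap \<Longrightarrow> g < cap \<Longrightarrow>
       exec_stmt P (store_pp d C) m (cell [12 + npar, l, q, g]) = opc (pp w' l q [g])"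
proof -
  note v = readyD(1)[OF r]
  let ?F = "\<lambda>\<kappa>. opc (pp w' (\<kappa> ! 0) (\<kappa> ! 1) [\<kappa> ! 2])" and ?key = "\<lambda>p. [xl p, xq p, xg p]"
  have gd: "holds m p (le_e L (nl_e d)) \<longleftrightarrow> xl p \<le> length w'" for p
    using fields[OF v] ev_basic[OF v] by simp
  note T = table_store[where key = ?key and F = ?F and gd = "\<lambda>p. xl p \<le> length w'", OF r _ _ gd, of 12]
  have a: "map (eval m p) [L, Q, G] = ?key p" for p using fields[OF v] by simp
  have f: "eval m p (new_pp_e d C L Q G) = ?F (?key p) \<and> ?F (?key p) \<le> V" if "xl p \<le> length w'" for p
    using ev_new_pp[OF v fields(3,4,5)[OF v] field_bounds(1,2) that]
      opc_le[of "pp w' (xl p) (xq p) [xg p]"] pp_le pp_range[OF _ field_bounds(1)] by (simp; blast)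
  show "consistent P (store_pp d C) m" unfolding store_pp_def by (rule T(1)[OF _ a f]) auto
  show "ready (exec_stmt P (store_pp d C) m)" unfolding store_pp_def by (rule T(2)[OF _ a f]) auto
  show "same_off {12 + npar} m (exec_stmt P (store_pp d C) m)" unfolding store_pp_def by (rule T(3)[OF _ a f]) auto
  show "exec_stmt P (store_pp d C) m (cell [12 + npar, l, q, g]) = opc (pp w' l q [g])"
    if h: "l \<le> length w'" "q < cap" "g < cap"
  proof -
    have n: "l < D ^ rd" using h size by auto
    obtain p where p: "p < P" "xl p = l" "xq p = q" "xg p = g"
      using fields_ex[OF D0 radix_pos radix_pos n h(2,3) cap] by blast
    have "exec_stmt P (store_pp d C) m (cell ((12 + npar) # ?key p)) = ?F (?key p)"
      unfolding store_pp_def by (rule T(4)[OF _ a f]) (use p h in auto)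
    then show ?thesis using p by simp
  qed
qed

lemma store_an_correct:
  assumes r: "ready m"
  shows "consistent P (store_an d C) m" "ready (exec_stmt P (store_an d C) m)"
    "same_off {14 + npar} m (exec_stmt P (store_an d C) m)"
    "i \<le> x \<Longrightarrow> x \<le> k \<Longrightarrow> k \<le> length w' \<Longrightarrow> q < cap \<Longrightarrow> g < cap \<Longrightarrow> cf w' i q g k \<noteq> None \<Longrightarrow>
       exec_stmt P (store_an d C) m (cell [14 + npar, i, q, g, k, x]) = lastanc (ht w' i q g) i k x"
proof -
  note v = readyD(1)[OF r]
  let ?F = "\<lambda>\<kappa>. lastanc (ht w' (\<kappa> ! 0) (\<kappa> ! 1) (\<kappa> ! 2)) (\<kappa> ! 0) (\<kappa> ! 3) (\<kappa> ! 4)"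
  let ?key = "\<lambda>p. [xi p, xq p, xg p, xk p, xl p]"
  let ?gd = "\<lambda>p. xi p \<le> xl p \<and> xl p \<le> xk p \<and> xk p \<le> length w' \<and> cf w' (xi p) (xq p) (xg p) (xk p) \<noteq> None"
  have gd: "holds m p (and_e (le_e I L) (and_e (le_e L K) (and_e (le_e K (nl_e d)) (new_cf_e d C I Q G K)))) \<longleftrightarrow> ?gd p" for p
    using fields[OF v] ev_basic[OF v] new_cf_fields[OF r, of p]
    by (auto simp: holds_def[of m p "new_cf_e _ _ _ _ _ _"])
  note T = table_store[where key = ?key and F = ?F and gd = ?gd, OF r _ _ gd, of 14]
  have a: "map (eval m p) [I, Q, G, K, L] = ?key p" for p using fields[OF v] by simp
  have f: "eval m p (new_an_e d C I Q G K L) = ?F (?key p) \<and> ?F (?key p) \<le> V" if g: "?gd p" for p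
  proof -
    obtain y where y: "cf w' (xi p) (xq p) (xg p) (xk p) = Some y" using g by auto
    have ik: "xi p \<le> xk p" "xk p \<le> length w'" using g by auto
    have "eval m p (new_an_e d C I Q G K L) = lastanc (ht w' (xi p) (xq p) (xg p)) (xi p) (xk p) (xl p)"
    proof (rule ev_new_an[OF v fields(1,4,5,2)[OF v] field_bounds(1,2) ik _ y fields(3)[OF v]])
    qed (use g in \<open>auto intro: readyD(3)[OF r ik(2) field_bounds(1,2)]\<close>)
    then have "eval m p (new_an_e d C I Q G K L) = ?F (?key p)" by simp
    moreover have "?F (?key p) \<le> xl p" using lastanc_props(2)[OF anc_start[OF y]] g by simp
    ultimately show ?thesis using g len_V by linarith
  qed
  show "consistent P (store_an d C) m" unfolding store_an_def by (rule T(1)[OF _ a f]) auto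
  show "ready (exec_stmt P (store_an d C) m)" unfolding store_an_def by (rule T(2)[OF _ a f]) auto
  show "same_off {14 + npar} m (exec_stmt P (store_an d C) m)" unfolding store_an_def by (rule T(3)[OF _ a f]) auto
  show "exec_stmt P (store_an d C) m (cell [14 + npar, i, q, g, k, x]) = lastanc (ht w' i q g) i k x"
    if h: "i \<le> x" "x \<le> k" "k \<le> length w'" "q < cap" "g < cap" "cf w' i q g k \<noteq> None"
  proof -
    have n: "i < D ^ rd" "k < D ^ rd" "x < D ^ rd" using h size by auto
    obtain p where p: "p < P" "xi p = i" "xk p = k" "xl p = x" "xq p = q" "xg p = g"
      using fields_ex[OF D0 n h(4,5) cap] by blast
    have "exec_stmt P (store_an d C) m (cell ((14 + npar) # ?key p)) = ?F (?key p)"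
      unfolding store_an_def by (rule T(4)[OF _ a f]) (use p h in auto)
    then show ?thesis using p by simp
  qed
qed

lemma store_fu_correct:
  assumes r: "ready m"
  shows "consistent P (store_fu d C) m" "ready (exec_stmt P (store_fu d C) m)"
    "same_off {16 + npar} m (exec_stmt P (store_fu d C) m)"
    "i < k \<Longrightarrow> k \<le> l \<Longrightarrow> l \<le> length w' \<Longrightarrow> q < cap \<Longrightarrow> g < cap \<Longrightarrow> p0 < cap \<Longrightarrow> cf w' i q g k \<noteq> None \<Longrightarrow>
       exec_stmt P (store_fu d C) m (cell [16 + npar, i, q, g, k, l, p0]) = opc (pp w' l p0 (rest w' i q g k))"
proof -
  note v = readyD(1)[OF r]
  let ?F = "\<lambda>\<kappa>. opc (pp w' (\<kappa> ! 4) (\<kappa> ! 5) (rest w' (\<kappa> ! 0) (\<kappa> ! 1) (\<kappa> ! 2) (\<kappa> ! 3)))"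
  let ?key = "\<lambda>p. [xi p, xq p, xg p, xk p, xl p, xs p]"
  let ?gd = "\<lambda>p. xi p < xk p \<and> xk p \<le> xl p \<and> xl p \<le> length w' \<and> cf w' (xi p) (xq p) (xg p) (xk p) \<noteq> None"
  have gd: "holds m p (and_e (lt_e I K) (and_e (le_e K L) (and_e (le_e L (nl_e d)) (new_cf_e d C I Q G K)))) \<longleftrightarrow> ?gd p" for p
    using fields[OF v] ev_basic[OF v] new_cf_fields[OF r, of p]
    by (auto simp: holds_def[of m p "new_cf_e _ _ _ _ _ _"])
  note T = table_store[where key = ?key and F = ?F and gd = ?gd, OF r _ _ gd, of 16]
  have a: "map (eval m p) [I, Q, G, K, L, S] = ?key p" for p using fields[OF v] by simp
  have f: "eval m p (new_fu_e d C I Q G K L S) = ?F (?key p) \<and> ?F (?key p) \<le> V" if g: "?gd p" for p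
  proof -
    obtain y where y: "cf w' (xi p) (xq p) (xg p) (xk p) = Some y" using g by auto
    have ik: "xi p \<le> xk p" "xk p \<le> length w'" "xk p \<le> xl p" "xl p \<le> length w'" using g by auto
    have "eval m p (new_fu_e d C I Q G K L S) = opc (pp w' (xl p) (xs p) (rest w' (xi p) (xq p) (xg p) (xk p)))"
    proof (rule ev_new_fu[OF v fields(1,4,5,2)[OF v] field_bounds(1,2) ik(1,2) _ y
          fields(3)[OF v] ik(3,4) fields(6)[OF v] field_bounds(3)])
    qed (auto intro: readyD(3)[OF r ik(2) field_bounds(1,2)] readyD(4)[OF r ik(1) field_bounds(1,2,3)])
    then have "eval m p (new_fu_e d C I Q G K L S) = ?F (?key p)" by (simp add: eval_nat_numeral)
    moreover have "opc (pp w' (xl p) (xs p) \<gamma>) \<le> V" for \<gamma>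
      by (rule opc_le) (use pp_le pp_range field_bounds in blast)
    ultimately show ?thesis by simp
  qed
  show "consistent P (store_fu d C) m" unfolding store_fu_def by (rule T(1)[OF _ a f]) auto
  show "ready (exec_stmt P (store_fu d C) m)" unfolding store_fu_def by (rule T(2)[OF _ a f]) auto
  show "same_off {16 + npar} m (exec_stmt P (store_fu d C) m)" unfolding store_fu_def by (rule T(3)[OF _ a f]) auto
  show "exec_stmt P (store_fu d C) m (cell [16 + npar, i, q, g, k, l, p0]) = opc (pp w' l p0 (rest w' i q g k))"
    if h: "i < k" "k \<le> l" "l \<le> length w'" "q < cap" "g < cap" "p0 < cap" "cf w' i q g k \<noteq> None"
  proof -
    have n: "i < D ^ rd" "k < D ^ rd" "l < D ^ rd" using h size by auto
    obtain p where p: "p < P" "xi p = i" "xk p = k" "xl p = l" "xq p = q" "xg p = g" "xs p = p0"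
      using fields_ex[OF D0 n h(4,5,6)] by blast
    have "exec_stmt P (store_fu d C) m (cell ((16 + npar) # ?key p)) = ?F (?key p)"
      unfolding store_fu_def by (rule T(4)[OF _ a f]) (use p h in auto)
    then show ?thesis using p by simp
  qed
qed

definition "next_D = (if D ^ rd < 4 * (length w' + 1) then 2 * D else D)"

text \<open>Cell 0 is exempt from the last bound: it receives the next number of processors, against
  which \<open>inv\<close> measures all other cells.\<close>

lemma update_correct:
  assumes "view m" "\<And>x. m x \<le> V"
  defines "m' \<equiv> exec P (update_prog d C) m"
  shows "all_consistent P (update_prog d C) m" "tables w' npar m'" "m' (cell [5]) = npar"
    "m' (cell [4]) = length w'" "m' (cell [3]) = next_D" "m' 0 = nprocs rd cap next_D"
    "x \<noteq> 0 \<Longrightarrow> m' x \<le> max V next_D"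
proof -
  define m1 where "m1 = exec P (search6 d C @ search7 C) m"
  define m2 where "m2 = exec_stmt P (store_let d C) m1"
  define m3 where "m3 = exec_stmt P (store_cf d C) m2"
  define m4 where "m4 = exec_stmt P (store_pp d C) m3"
  define m5 where "m5 = exec_stmt P (store_an d C) m4"
  define m6 where "m6 = exec_stmt P (store_fu d C) m5"
  note R = ready_searches[OF assms(1,2), folded m1_def]
  note A2 = store_let_correct[OF R(2), folded m2_def]
  note A3 = store_cf_correct[OF A2(2), folded m3_def]
  note A4 = store_pp_correct[OF A3(2), folded m4_def]
  note A5 = store_an_correct[OF A4(2), folded m5_def]
  note A6 = store_fu_correct[OF A5(2), folded m6_def]
  have np: "npar \<le> 1" by (simp add: npar_def)
  have keep: "m'' (cell (h # \<kappa>)) = m (cell (h # \<kappa>))" if "same_off {h'} m m''" "h \<noteq> h'" "h \<noteq> 2" for h h' \<kappa> m m''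
    using that by (auto simp: same_off_def)
  have t6: "tables w' npar m6" unfolding tables_def
    using np by (auto simp: keep[OF A6(3)] keep[OF A5(3)] keep[OF A4(3)] keep[OF A3(3)] A2(4) A3(4) A4(4) A5(4) A6(4))
  note v6 = readyD(1)[OF A6(2)]
  define m7 where "m7 = m6(cell [4] := length w')"
  define m8 where "m8 = m7(cell [3] := next_D)"
  define m9 where "m9 = m8(0 := nprocs rd cap next_D)"
  have c0: "cell (h # \<kappa>) \<noteq> 0" for h \<kappa> by (simp add: cell.simps(2))
  have e4: "eval m6 p (nl_e d) = length w'" for p using ev_basic[OF v6] by simp
  have e3: "eval m7 p (if_e (lt_e (pow_e D_e rd) (times_e (Lit 4) (plus_e len_e (Lit 1)))) (times_e (Lit 2) D_e) D_e) = next_D" for p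
    using v6 by (simp add: m7_def D_e_def len_e_def view_def next_D_def)
  have e0: "eval m8 p nprocs_e = nprocs rd cap next_D" for p
    by (simp add: nprocs_e_def m8_def D_e_def nprocs_def)
  have e5: "eval m9 p (minus_e (Lit 1) par_e) = npar" for p
    using v6 by (simp add: c0 m9_def m8_def m7_def par_e_def view_def npar_def)
  have s: "exec_stmt P (Lit (cell [4]), nl_e d) m6 = m7"
    "exec_stmt P (Lit (cell [3]), if_e (lt_e (pow_e D_e rd) (times_e (Lit 4) (plus_e len_e (Lit 1))))
       (times_e (Lit 2) D_e) D_e) m7 = m8"
    "exec_stmt P (Lit 0, nprocs_e) m8 = m9"
    "exec_stmt P (Lit (cell [5]), minus_e (Lit 1) par_e) m9 = m9(cell [5] := npar)"
    unfolding m7_def m8_def m9_def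
    by (rule exec_scalar(2)[OF P0 e4] exec_scalar(2)[OF P0 e3, unfolded m7_def]
        exec_scalar(2)[OF P0 e0, unfolded m7_def m8_def] exec_scalar(2)[OF P0 e5, unfolded m7_def m8_def m9_def])+
  have sc: "exec P (scalars d) m6 = m9(cell [5] := npar)" "all_consistent P (scalars d) m6"
    unfolding scalars_def exec_Cons exec_Nil all_consistent.simps s
    using exec_scalar(1)[OF P0 e4] exec_scalar(1)[OF P0 e3] exec_scalar(1)[OF P0 e0] exec_scalar(1)[OF P0 e5]
    by blast+
  have m': "m' = m9(cell [5] := npar)"
    unfolding m'_def sc(1)[symmetric]
    by (simp add: update_prog_def exec_append m6_def m5_def m4_def m3_def m2_def m1_def)
  show "all_consistent P (update_prog d C) m"
    using R(1) A2(1) A3(1) A4(1) A5(1) A6(1) sc(2)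
    by (simp add: update_prog_def all_consistent_append exec_append m6_def m5_def m4_def m3_def m2_def m1_def)
  show "tables w' npar m'"
    using t6 np unfolding tables_def m' m9_def m8_def m7_def by (simp add: c0)
  show "m' (cell [5]) = npar" "m' (cell [4]) = length w'" "m' (cell [3]) = next_D" "m' 0 = nprocs rd cap next_D"
    by (simp_all add: c0 c0[THEN not_sym] m' m9_def m8_def m7_def)
  show "m' x \<le> max V next_D" if "x \<noteq> 0"
  proof -
    have "D \<le> D ^ rd" using rd D0 by (cases rd) auto
    then have "1 \<le> V" using D0 V(2) by linarith
    then have "npar \<le> V" using np by linarith
    then show ?thesis
      using that readyD(2)[OF A6(2), of x] len_V by (auto simp: m' m9_def m8_def m7_def le_max_iff_disj)
  qed
qed

end

section \<open>The invariant between operations\<close>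

lemma pram_run_mono: "pram_run prog P m B t k m' \<Longrightarrow> B \<le> B' \<Longrightarrow> pram_run prog P m B' t k m'"
  unfolding pram_run_def by (meson order_trans)

text \<open>\<open>2 <= rd\<close> allows the algorithm to start with \<open>D = 2\<close>, as then
  \<open>4 * (0 + 1) <= D ^ rd\<close> for the empty string. \<open>E\<close> bounds the codes of
  the letters, which are unrelated to the size of the string.\<close>

locale dynamic = table_prog stp cap al rd
  for stp :: "nat \<Rightarrow> nat \<Rightarrow> nat \<Rightarrow> (nat \<times> nat list) option" and cap :: nat and al :: "nat list" and rd :: nat +
  fixes q0 g0 E :: nat and fin :: "nat \<Rightarrow> bool"
  assumes rd2: "2 \<le> rd" and q0: "q0 < cap" and g0: "g0 < cap" and E: "\<And>a. a \<in> set al \<Longrightarrow> a \<le> E"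
begin

definition accept :: "nat list \<Rightarrow> bool" where
  "accept u \<longleftrightarrow> (\<exists>q \<gamma>. runs stp u (q0, [g0]) = Some (q, \<gamma>) \<and> fin q)"

text \<open>The lower bound on \<open>D ^ rd\<close> leaves room for the string to grow by one
  letter during an operation. The upper bound, which limits the work, has the factor
  \<open>2 ^ rd\<close> because doubling \<open>D\<close> multiplies \<open>D ^ rd\<close> by that
  much.\<close>

definition inv :: "nat list \<Rightarrow> memory \<Rightarrow> bool" where
  "inv v m \<longleftrightarrow> set v \<subseteq> set al \<and> (\<forall>x. m x \<le> m 0 + E) \<and> (\<exists>par D. par \<le> 1 \<and> 2 \<le> D \<and>
     m (cell [5]) = par \<and> m (cell [4]) = length v \<and> m (cell [3]) = D \<and> m 0 = nprocs rd cap D \<and>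
     tables v par m \<and> 4 * (length v + 1) \<le> D ^ rd \<and> D ^ rd \<le> 4 * 2 ^ rd * (length v + 1))"

lemma nprocs_ge:
  assumes "1 \<le> D"
  shows "D ^ rd * cap \<le> nprocs rd cap D" "cap * cap \<le> nprocs rd cap D" "D \<le> nprocs rd cap D"
    "D ^ rd \<le> nprocs rd cap D"
proof -
  have N: "1 \<le> D ^ rd" "1 \<le> cap" using assms cap by auto
  have c3: "cap * cap \<le> cap * (cap * cap)" "cap \<le> cap * cap" using N by auto
  have "1 * (1 * (1 * (D ^ rd * (cap * (cap * cap))))) \<le> nprocs rd cap D"
    unfolding nprocs_def by (intro mult_le_mono assms N order_refl)
  then have *: "D ^ rd * (cap * (cap * cap)) \<le> nprocs rd cap D" by simp
  have "D ^ rd * cap \<le> D ^ rd * (cap * (cap * cap))" using c3 by (intro mult_le_mono) auto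
  then show "D ^ rd * cap \<le> nprocs rd cap D" using * by linarith
  moreover have "D ^ rd * 1 \<le> D ^ rd * cap" by (intro mult_le_mono2 N)
  ultimately show "D ^ rd \<le> nprocs rd cap D" unfolding mult_1_right by (rule order_trans[rotated])
  have "1 * (cap * cap) \<le> D ^ rd * (cap * (cap * cap))" using N c3 by (intro mult_le_mono) auto
  then show "cap * cap \<le> nprocs rd cap D" using * by linarith
  have "1 \<le> D ^ rd * (D ^ rd * (D ^ rd * (cap * (cap * cap))))" using N by simp
  then show "D \<le> nprocs rd cap D" unfolding nprocs_def by simp
qed

lemma nprocs_mono: "D \<le> D' \<Longrightarrow> nprocs rd cap D \<le> nprocs rd cap D'"
  unfolding nprocs_def by (intro mult_le_mono power_mono) auto

lemma cell_neq [simp]: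
  "2 \<le> h \<Longrightarrow> cell (h # \<kappa>) \<noteq> 0" "2 \<le> h \<Longrightarrow> cell (h # \<kappa>) \<noteq> Suc 0" "2 \<le> h \<Longrightarrow> cell (h # \<kappa>) \<noteq> 2"
  "2 \<le> h \<Longrightarrow> cell (h # \<kappa>) \<noteq> 3"
  using cell_gt_3[of h \<kappa>] by auto

lemma tables_cong:
  assumes "tables v par m" "\<And>h \<kappa>. 8 \<le> h \<Longrightarrow> m' (cell (h # \<kappa>)) = m (cell (h # \<kappa>))"
  shows "tables v par m'"
  using assms(1) unfolding tables_def by (simp add: assms(2))

lemma update_step:
  assumes inv: "inv v m" and d: "d \<le> 1" and cd: "c + d \<le> length v" and s: "s \<in> set al" and i: "i \<le> length v + 1"
    and stable: "\<And>m m' p. m 1 = m' 1 \<Longrightarrow> m (cell [4]) = m' (cell [4]) \<Longrightarrow> eval m p C = eval m' p C"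
    and C: "\<And>m p. m 1 = i \<Longrightarrow> m (cell [4]) = length v \<Longrightarrow> eval m p C = c"
  defines "v' \<equiv> take c v @ s # drop (c + d) v"
  defines "m1 \<equiv> m(1 := i, 2 := s)"
  shows "all_consistent (m 0) (update_prog d C) m1" "inv v' (exec (m 0) (update_prog d C) m1)"
proof -
  obtain par D where h: "set v \<subseteq> set al" "\<forall>x. m x \<le> m 0 + E" "par \<le> 1" "2 \<le> D"
     "m (cell [5]) = par" "m (cell [4]) = length v" "m (cell [3]) = D" "m 0 = nprocs rd cap D"
     "tables v par m" "4 * (length v + 1) \<le> D ^ rd" "D ^ rd \<le> 4 * 2 ^ rd * (length v + 1)"
    using inv unfolding inv_def by blast
  let ?V = "nprocs rd cap D + E"
  have lv: "length v' + d = length v + 1" using cd by (simp add: v'_def)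
  have D1: "1 \<le> D" using h by simp
  note NP = nprocs_ge[OF D1]
  have "length v' \<le> length v + 1" using lv by simp
  then have lN: "length v' + 1 \<le> D ^ rd" "length v' < D ^ rd" using h(10) by simp_all
  have lc: "(length v' + 1) * cap \<le> D ^ rd * cap" using lN(1) by (rule mult_le_mono1)
  interpret U: update stp cap v v' s c d "c + d" "\<lambda>j. j + 1 - d" "\<lambda>j. j - 1 + d" al rd C par D ?V
  proof unfold_locales
    show "eval m p C = eval m' p C" if "m 1 = m' 1" "m (cell [4]) = m' (cell [4])" for m m' p
      using stable that .
  qed (use d cd v'_def h(1,3,4) s NP lc lN E in \<open>auto intro: trans_le_add2\<close>)
  have view: "U.view m1"
    using h tables_cong[OF h(9), of m1] C[of m1] by (simp add: U.view_def m1_def)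
  have iN: "i \<le> D ^ rd" using i h(10) by simp
  have bd: "m1 x \<le> ?V" for x
    using h(2)[rule_format, of x] iN NP(4) E[OF s] h(8) by (auto simp: m1_def intro: trans_le_add1 trans_le_add2)
  note UC = U.update_correct[OF view bd, folded h(8)]
  show "all_consistent (m 0) (update_prog d C) m1" using UC(1) .
  let ?m = "exec (m 0) (update_prog d C) m1"
  have D': "D \<le> U.next_D" "U.next_D \<le> 2 * D" by (auto simp: U.next_D_def)
  have bd': "?m x \<le> ?m 0 + E" for x
  proof (cases "x = 0")
    case False
    have "?m x \<le> max ?V U.next_D" using UC(7)[OF False] h(8) by simp
    moreover have "?V \<le> nprocs rd cap U.next_D + E" using nprocs_mono[OF D'(1)] by simp
    moreover have "U.next_D \<le> nprocs rd cap U.next_D" using nprocs_ge(3)[of U.next_D] D' D1 by linarith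
    ultimately show ?thesis using UC(6) by simp
  qed simp
  \<comment> \<open>One doubling suffices, as the string grows by at most one letter while
    \<open>D ^ rd\<close> at least doubles. It takes place only if \<open>D ^ rd\<close> is below
    \<open>4 * (length v' + 1)\<close>, which gives the upper bound.\<close>
  have "4 * (length v' + 1) \<le> U.next_D ^ rd \<and> U.next_D ^ rd \<le> 4 * 2 ^ rd * (length v' + 1)"
  proof (cases "D ^ rd < 4 * (length v' + 1)")
    case True
    have n: "U.next_D ^ rd = 2 ^ rd * D ^ rd" using True by (simp add: U.next_D_def power_mult_distrib)
    show ?thesis unfolding n
    proof
      have "4 * (length v' + 1) \<le> 2 * D ^ rd" using h(10) \<open>length v' \<le> length v + 1\<close> by simp
      also have "\<dots> \<le> 2 ^ rd * D ^ rd" using rd2 power_increasing[of 1 rd "2::nat"] by (intro mult_le_mono1) simp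
      finally show "4 * (length v' + 1) \<le> 2 ^ rd * D ^ rd" .
      have "2 ^ rd * D ^ rd \<le> 2 ^ rd * (4 * (length v' + 1))" using True by (intro mult_le_mono2) simp
      then show "2 ^ rd * D ^ rd \<le> 4 * 2 ^ rd * (length v' + 1)" by (simp only: mult_ac)
    qed
  next
    case False
    have "length v \<le> length v'" using lv d by linarith
    then have "4 * 2 ^ rd * (length v + 1) \<le> 4 * 2 ^ rd * (length v' + 1)" by (intro mult_le_mono2) simp
    moreover have "U.next_D = D" unfolding U.next_D_def using False by (rule if_not_P)
    ultimately show ?thesis using False le_trans[OF h(11)] by (simp only: not_less)
  qed
  moreover have "set v' \<subseteq> set al"
    using h(1) s set_take_subset[of c v] set_drop_subset[of "c + d" v] by (auto simp: v'_def)
  moreover have "U.npar \<le> 1" by (simp add: U.npar_def)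
  moreover have "2 \<le> U.next_D" using D' h(4) by linarith
  ultimately show "inv v' ?m"
    unfolding inv_def using bd' UC(2-6) by blast
qed

definition "fin_e A = foldr (\<lambda>q e. if_e (eq_e A (Lit q)) (Lit 1) e) (filter fin [0..<cap]) (Lit 0)"

lemma eval_fin_e: "eval m p A < cap \<Longrightarrow> eval m p (fin_e A) = of_bool (fin (eval m p A))"
proof -
  have "eval m p (foldr (\<lambda>q e. if_e (eq_e A (Lit q)) (Lit 1) e) qs (Lit 0)) = of_bool (eval m p A \<in> set qs)" for qs
    by (induction qs) auto
  then show "eval m p A < cap \<Longrightarrow> ?thesis" by (simp add: fin_e_def)
qed

text \<open>Operations count letters from 1: letter \<open>i\<close> lies between the gaps
  \<open>i - 1\<close> and \<open>i\<close>. So \<open>i - 1\<close> is where a query starts and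
  where a relabelling of, or an insertion before, letter \<open>i\<close> takes place.\<close>

definition "from_e = minus_e (Cell (Lit 1)) (Lit 1)"
definition "upto_e = Cell (Lit 2)"

text \<open>The stack may run empty exactly at the end of the queried substring.\<close>

definition "query_e = if_e (cf_e from_e (Lit q0) (Lit g0) upto_e)
  (fin_e (fst_e (cf_e from_e (Lit q0) (Lit g0) upto_e)))
  (if_e (and_e (pp_e from_e (Lit q0) (Lit g0)) (eq_e (fst_e (pp_e from_e (Lit q0) (Lit g0))) upto_e))
    (fin_e (snd_e (pp_e from_e (Lit q0) (Lit g0)))) (Lit 0))"

lemma query_step:
  assumes inv: "inv v m" and ij: "1 \<le> i" "i \<le> j" "j \<le> length v"
  defines "m1 \<equiv> m(1 := i, 2 := j)"
  shows "all_consistent (m 0) [(Lit 3, query_e)] m1" "inv v (exec (m 0) [(Lit 3, query_e)] m1)"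
    "exec (m 0) [(Lit 3, query_e)] m1 3 = of_bool (accept (drop (i - 1) (take j v)))"
proof -
  obtain par D where h: "set v \<subseteq> set al" "\<forall>x. m x \<le> m 0 + E" "par \<le> 1" "2 \<le> D"
     "m (cell [5]) = par" "m (cell [4]) = length v" "m (cell [3]) = D" "m 0 = nprocs rd cap D"
     "tables v par m" "4 * (length v + 1) \<le> D ^ rd" "D ^ rd \<le> 4 * 2 ^ rd * (length v + 1)"
    using inv unfolding inv_def by blast
  define i0 where "i0 = i - 1"
  have i0: "i0 < j" using ij by (simp add: i0_def)
  have m1: "m1 (cell (h # \<kappa>)) = m (cell (h # \<kappa>))" if "2 \<le> h" for h \<kappa> using that by (simp add: m1_def)
  have e: "eval m1 p from_e = i0" "eval m1 p upto_e = j" for p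
    by (simp_all add: from_e_def upto_e_def m1_def i0_def)
  have cfe: "eval m1 p (cf_e from_e (Lit q0) (Lit g0) upto_e) = opc (cf v i0 q0 g0 j)" for p
    using h(5,9) i0 ij q0 g0 by (simp add: cf_e_def old_e_def par_e_def e m1 tables_def)
  have ppe: "eval m1 p (pp_e from_e (Lit q0) (Lit g0)) = opc (pp v i0 q0 [g0])" for p
    using h(5,9) i0 ij q0 g0 by (simp add: pp_e_def old_e_def par_e_def e m1 tables_def)
  have acc: "accept (drop i0 (take j v)) \<longleftrightarrow> (case cf v i0 q0 g0 j of Some (q, g) \<Rightarrow> fin q
     | None \<Rightarrow> (\<exists>q. pp v i0 q0 [g0] = Some (j, q) \<and> fin q))"
  proof (cases "cf v i0 q0 g0 j")
    case None
    have "run v i0 j (q0, [g0]) = Some (q, \<gamma>) \<longleftrightarrow> \<gamma> = [] \<and> pp v i0 q0 [g0] = Some (j, q)" for q \<gamma>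
      using None i0 ij by (cases \<gamma>) (auto simp: cf_def pp_eq_Some popped_def)
    then show ?thesis using None by (simp add: accept_def run_def)
  next
    case (Some y)
    obtain q g where y: "y = (q, g)" by (cases y)
    then have "run v i0 j (q0, [g0]) = Some (q, g # rest v i0 q0 g0 j)" using Some by (simp add: cf_eq_Some)
    then show ?thesis using Some y by (simp add: accept_def run_def)
  qed
  have q: "eval m1 p query_e = of_bool (accept (drop i0 (take j v)))" for p
  proof (cases "cf v i0 q0 g0 j")
    case (Some y)
    obtain q g where y: "cf v i0 q0 g0 j = Some (q, g)" using Some by (cases y) auto
    have r: "q < cap" "g < cap" using cf_range[OF y q0 g0] by auto
    note F = eval_fst_snd[OF cfe y r(2)]
    show ?thesis using F(1,3) r y acc by (simp add: query_e_def eval_fin_e)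
  next
    case None
    have n: "\<not> holds m1 p (cf_e from_e (Lit q0) (Lit g0) upto_e)" using cfe[of p] None by (simp add: holds_def)
    show ?thesis
    proof (cases "pp v i0 q0 [g0]")
      case N: None
      then have "\<not> holds m1 p (pp_e from_e (Lit q0) (Lit g0))" using ppe[of p] by (simp add: holds_def)
      then show ?thesis using n None N acc by (simp add: query_e_def)
    next
      case (Some y)
      obtain l q where y: "pp v i0 q0 [g0] = Some (l, q)" using Some by (cases y) auto
      have r: "q < cap" using pp_range[OF y q0] .
      note F = eval_fst_snd[OF ppe y r]
      show ?thesis using F r y acc n None e by (simp add: query_e_def eval_fin_e)
    qed
  qed
  have P0: "0 < m 0" using nprocs_ge(3)[of D] h by simp
  note S = exec_scalar[OF P0 q, of 3]
  show "all_consistent (m 0) [(Lit 3, query_e)] m1" using S(1) by simp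
  have ex: "exec (m 0) [(Lit 3, query_e)] m1 = m1(3 := of_bool (accept (drop i0 (take j v))))"
    using S(2) by simp
  show "exec (m 0) [(Lit 3, query_e)] m1 3 = of_bool (accept (drop (i - 1) (take j v)))"
    using ex by (simp add: i0_def)
  let ?m = "m1(3 := of_bool (accept (drop i0 (take j v))))"
  have eq: "?m (cell (h # \<kappa>)) = m (cell (h # \<kappa>))" if "2 \<le> h" for h \<kappa> using that by (simp add: m1_def)
  have "i \<le> m 0" "j \<le> m 0" using ij h(8,10) nprocs_ge(4)[of D] h(4) by auto
  then have bd: "?m x \<le> ?m 0 + E" for x using h(2)[rule_format, of x] P0 by (auto simp: m1_def)
  have "tables v par ?m" by (rule tables_cong[OF h(9)]) (simp add: m1)
  moreover have "?m 0 = m 0" by (simp add: m1_def)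
  ultimately show "inv v (exec (m 0) [(Lit 3, query_e)] m1)"
    unfolding ex inv_def using h bd by (simp only: eq[of 5 "[]"] eq[of 4 "[]"] eq[of 3 "[]"]) (auto intro!: exI[of _ par])
qed

text \<open>Everything else is right when zero: length, parity and all entries that
  \<open>tables\<close> demands for the empty string.\<close>

definition "init_stmts = [(Lit (cell [3]), Lit 2), (Lit 0, Lit (nprocs rd cap 2))]"

lemma init_step:
  "all_consistent 1 init_stmts ((\<lambda>_. 0)(0 := 1))" "inv [] (exec 1 init_stmts ((\<lambda>_. 0)(0 := 1)))"
proof -
  let ?x = "(\<lambda>_. 0)(0 := 1 :: nat)"
  let ?y = "?x(cell [3] := 2)"
  let ?z = "?y(0 := nprocs rd cap 2)"
  have s1: "consistent 1 (Lit (cell [3]), Lit 2) ?x" "exec_stmt 1 (Lit (cell [3]), Lit 2) ?x = ?y"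
    by (rule exec_scalar(1), simp, simp, rule exec_scalar(2), simp, simp)
  have s2: "consistent 1 (Lit 0, Lit (nprocs rd cap 2)) ?y"
    "exec_stmt 1 (Lit 0, Lit (nprocs rd cap 2)) ?y = ?z"
    by (rule exec_scalar(1), simp, simp, rule exec_scalar(2), simp, simp)
  show "all_consistent 1 init_stmts ?x"
    unfolding init_stmts_def all_consistent.simps s1(2) using s1(1) s2(1) by blast
  have ex: "exec 1 init_stmts ?x = ?z"
    unfolding init_stmts_def exec_Cons exec_Nil s1(2) s2(2) ..
  \<comment> \<open>Without input a nonempty stack is never popped, so the entry has the code
    0.\<close>
  have pn: "pp [] 0 q [g] = None" for q g
  proof (cases "pp [] 0 q [g]")
    case (Some y)
    then show ?thesis by (cases y) (auto simp: pp_eq_Some popped_def run_def)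
  qed simp
  have la: "lastanc h 0 0 0 = 0" for h by (rule lastanc_self) auto
  have "tables [] 0 ?z" unfolding tables_def by (auto simp: pn la)
  moreover have "4 \<le> (2::nat) ^ rd" using power_increasing[OF rd2, of "2::nat"] by simp
  moreover have "2 \<le> nprocs rd cap 2" using nprocs_ge(3)[of 2] by simp
  ultimately show "inv [] (exec 1 init_stmts ?x)"
    unfolding ex inv_def by (auto intro!: exI[of _ 2])
qed

text \<open>The first argument of \<open>update_prog\<close> is the number of replaced letters. An
  insertion after \<open>i\<close> happens at gap \<open>i\<close>, but on the empty string
  \<open>i = 1\<close> has to mean gap 0; hence the minimum with the length.\<close>

fun op_stmts :: "'a oper \<Rightarrow> stmt list" where
  "op_stmts (Relabel i \<sigma>) = update_prog 1 from_e"
| "op_stmts (InsertPositionBefore i \<sigma>) = update_prog 0 from_e"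
| "op_stmts (InsertPositionAfter i \<sigma>) = update_prog 0 (min_e (Cell (Lit 1)) len_e)"
| "op_stmts (Query i j) = [(Lit 3, query_e)]"

definition alg :: dyn_alg where
  "alg = \<lparr>init_prog = compile_prog init_stmts,
     relabel_prog = compile_prog (update_prog 1 from_e),
     before_prog = compile_prog (update_prog 0 from_e),
     after_prog = compile_prog (update_prog 0 (min_e (Cell (Lit 1)) len_e)),
     query_prog = compile_prog [(Lit 3, query_e)]\<rparr>"

lemma oper_prog_alg: "oper_prog alg f = compile_prog (op_stmts f)"
  by (cases f) (simp_all add: alg_def)

lemma oper_step:
  fixes enc :: "'a \<Rightarrow> nat"
  assumes inv: "inv (map enc w) m" and f: "valid_oper \<Sigma> w f" and al: "enc ` \<Sigma> \<subseteq> set al"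
  shows "all_consistent (m 0) (op_stmts f) (load_args enc f m)"
    "inv (map enc (apply_oper f w)) (exec (m 0) (op_stmts f) (load_args enc f m))"
    "f = Query i j \<Longrightarrow> exec (m 0) (op_stmts f) (load_args enc f m) 3 = of_bool (accept (map enc (substring w i j)))"
proof -
  have "all_consistent (m 0) (op_stmts f) (load_args enc f m) \<and>
    inv (map enc (apply_oper f w)) (exec (m 0) (op_stmts f) (load_args enc f m)) \<and>
    (\<forall>i j. f = Query i j \<longrightarrow>
       exec (m 0) (op_stmts f) (load_args enc f m) 3 = of_bool (accept (map enc (substring w i j))))"
  proof (cases f)
    case (Relabel i \<sigma>)
    have v: "1 \<le> i" "i \<le> length w" "\<sigma> \<in> \<Sigma>" using f Relabel by auto
    have e: "map enc (apply_oper f w) = take (i - 1) (map enc w) @ enc \<sigma> # drop (i - 1 + 1) (map enc w)"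
      using v Relabel by (simp add: upd_conv_take_nth_drop take_map drop_map)
    show ?thesis
      using update_step[OF inv, of 1 "i - 1" "enc \<sigma>" i from_e] v al Relabel e by (auto simp: from_e_def)
  next
    case (InsertPositionBefore i \<sigma>)
    have v: "1 \<le> i" "i \<le> length w + 1" "\<sigma> \<in> \<Sigma>" "i - 1 \<le> length w" using f InsertPositionBefore by auto
    have e: "map enc (apply_oper f w) = take (i - 1) (map enc w) @ enc \<sigma> # drop (i - 1 + 0) (map enc w)"
      using v InsertPositionBefore by (simp add: take_map drop_map)
    show ?thesis
      using update_step[OF inv, of 0 "i - 1" "enc \<sigma>" i from_e] v al InsertPositionBefore e by (auto simp: from_e_def)
  next
    case (InsertPositionAfter i \<sigma>)
    have v: "1 \<le> i" "i \<le> length w + 1" "\<sigma> \<in> \<Sigma>" using f InsertPositionAfter by auto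
    have e: "map enc (apply_oper f w) =
        take (min i (length w)) (map enc w) @ enc \<sigma> # drop (min i (length w) + 0) (map enc w)"
      using v InsertPositionAfter by (simp add: take_map drop_map min_def)
    show ?thesis
      using update_step[OF inv, of 0 "min i (length w)" "enc \<sigma>" i "min_e (Cell (Lit 1)) len_e"] v al InsertPositionAfter e
      by (auto simp: min_e_def len_e_def)
  next
    case (Query i j)
    then show ?thesis
      using query_step[OF inv, of i j] f by (simp add: substring_def take_map drop_map)
  qed
  then show "all_consistent (m 0) (op_stmts f) (load_args enc f m)"
    "inv (map enc (apply_oper f w)) (exec (m 0) (op_stmts f) (load_args enc f m))"
    "f = Query i j \<Longrightarrow> exec (m 0) (op_stmts f) (load_args enc f m) 3 = of_bool (accept (map enc (substring w i j)))"
    by auto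
qed

text \<open>A common exponent is needed because one constant has to bound the numbers in all
  operations.\<close>

lemma programs_run:
  assumes "finite SS"
  shows "\<exists>k. \<forall>ss\<in>SS. \<forall>P m V. 2 \<le> V \<longrightarrow> P \<le> V \<longrightarrow> (\<forall>x. m x \<le> V) \<longrightarrow> all_consistent P ss m \<longrightarrow>
     pram_run (compile_prog ss) P m (V ^ k) (length (compile_prog ss)) (P * length (compile_prog ss)) (exec P ss m)"
  using assms
proof induction
  case (insert ss SS)
  obtain k1 where k1: "\<And>P m V. 2 \<le> V \<Longrightarrow> P \<le> V \<Longrightarrow> (\<forall>x. m x \<le> V) \<Longrightarrow> all_consistent P ss m \<Longrightarrow>
     pram_run (compile_prog ss) P m (V ^ k1) (length (compile_prog ss)) (P * length (compile_prog ss)) (exec P ss m)"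
    using compile_prog_run_poly[of ss] by blast
  obtain k2 where k2: "\<And>ss P m V. ss \<in> SS \<Longrightarrow> 2 \<le> V \<Longrightarrow> P \<le> V \<Longrightarrow> (\<forall>x. m x \<le> V) \<Longrightarrow> all_consistent P ss m \<Longrightarrow>
     pram_run (compile_prog ss) P m (V ^ k2) (length (compile_prog ss)) (P * length (compile_prog ss)) (exec P ss m)"
    using insert.IH by blast
  have mono: "V ^ k1 \<le> V ^ (k1 + k2)" "V ^ k2 \<le> V ^ (k1 + k2)" if "2 \<le> V" for V :: nat
    by (intro power_mono_exp[OF that]; simp)+
  show ?case
  proof (rule exI[of _ "k1 + k2"], intro ballI allI impI)
    fix ss' P m V
    assume h: "ss' \<in> insert ss SS" "2 \<le> V" "P \<le> V" "\<forall>x. m x \<le> V" "all_consistent P ss' m"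
    show "pram_run (compile_prog ss') P m (V ^ (k1 + k2)) (length (compile_prog ss'))
      (P * length (compile_prog ss')) (exec P ss' m)"
    proof (cases "ss' = ss")
      case True
      show ?thesis using pram_run_mono[OF k1[OF h(2,3,4)] mono(1)[OF h(2)]] h(5) True by simp
    next
      case False
      then have "ss' \<in> SS" using h(1) by simp
      from pram_run_mono[OF k2[OF this h(2-5)] mono(2)[OF h(2)]] show ?thesis .
    qed
  qed
qed auto

text \<open>This combines the bound \<open>4 * 2 ^ rd * (length v + 1)\<close> of \<open>inv\<close>
  with \<open>length v + 1 <= 2 * n\<close>.\<close>

definition M :: nat where "M = 8 * 2 ^ rd"

lemma inv_size:
  assumes "inv v m" "length v \<le> n" "1 \<le> n"
  obtains D where "2 \<le> D" "m 0 = nprocs rd cap D" "D ^ rd \<le> M * n" "length v + 1 \<le> m 0"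
proof -
  obtain par D where h: "2 \<le> D" "m 0 = nprocs rd cap D" "4 * (length v + 1) \<le> D ^ rd"
    "D ^ rd \<le> 4 * 2 ^ rd * (length v + 1)" using assms(1) unfolding inv_def by blast
  have "4 * 2 ^ rd * (length v + 1) \<le> 4 * 2 ^ rd * (2 * n)" using assms by (intro mult_le_mono2) simp
  also have "\<dots> = M * n" by (simp add: M_def)
  finally have "D ^ rd \<le> M * n" using h(4) by (rule le_trans[rotated])
  moreover have "length v + 1 \<le> m 0" using h nprocs_ge(4)[of D] by simp
  ultimately show ?thesis using that h by blast
qed

lemma nprocs_poly:
  assumes "2 \<le> D" "D ^ rd \<le> X"
  shows "nprocs rd cap D \<le> cap ^ 3 * X ^ 4"
proof -
  have "D \<le> D ^ rd" using rd assms(1) self_le_power[of D rd] by simp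
  then have "nprocs rd cap D \<le> X * (X * (X * (X * (cap * (cap * cap)))))"
    unfolding nprocs_def using assms(2) by (intro mult_le_mono order_refl) auto
  also have "\<dots> = cap ^ 3 * X ^ 4" by (simp add: eval_nat_numeral)
  finally show ?thesis .
qed

text \<open>The digit field contributes \<open>D = (D ^ rd) powr (1 / rd)\<close>, the positions
  contribute three factors \<open>D ^ rd\<close>. The cruder \<open>nprocs_poly\<close> serves only
  to bound the size of numbers.\<close>

lemma nprocs_powr:
  assumes "2 \<le> D" "D ^ rd \<le> X"
  shows "real (nprocs rd cap D) \<le> real (cap ^ 3) * real X powr (3 + 1 / real rd)"
proof -
  have D: "0 < real D" using assms by simp
  have "real D = (real D ^ rd) powr (1 / real rd)"
    using D rd by (simp add: powr_realpow[symmetric] powr_powr)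
  moreover have "(real D ^ rd) * ((real D ^ rd) * (real D ^ rd)) = (real D ^ rd) powr 3"
    using D by (simp add: powr_numeral eval_nat_numeral)
  ultimately have "real (nprocs rd cap D) = real (cap ^ 3) * ((real D ^ rd) powr (1 / real rd) * (real D ^ rd) powr 3)"
    unfolding nprocs_def by (simp add: mult.assoc eval_nat_numeral)
  also have "\<dots> = real (cap ^ 3) * (real (D ^ rd) powr (3 + 1 / real rd))"
    by (simp add: powr_add mult.commute)
  also have "\<dots> \<le> real (cap ^ 3) * real X powr (3 + 1 / real rd)"
    using assms by (intro mult_left_mono powr_mono2) (auto simp del: of_nat_power)
  finally show ?thesis .
qed

theorem dynamic_algorithm:
  fixes enc :: "'a \<Rightarrow> nat"
  assumes al: "enc ` \<Sigma> \<subseteq> set al"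
    and Lang: "\<And>w. set w \<subseteq> \<Sigma> \<Longrightarrow> w \<in> Lang \<longleftrightarrow> accept (map enc w)"
  shows "\<exists>r. constant_time_dynamic_algorithm alg \<Sigma> enc Lang (\<lambda>n. nat \<lfloor>r * real n powr (3 + 1 / real rd)\<rfloor>) \<and> 0 \<le> r"
proof -
  define SS where "SS = {init_stmts, update_prog 1 from_e, update_prog 0 from_e,
    update_prog 0 (min_e (Cell (Lit 1)) len_e), [(Lit 3, query_e)]}"
  have fin: "finite SS" by (simp add: SS_def)
  have op_SS: "op_stmts f \<in> SS" for f :: "'a oper" by (cases f) (auto simp: SS_def)
  obtain k where run: "\<And>ss P m V. ss \<in> SS \<Longrightarrow> 2 \<le> V \<Longrightarrow> P \<le> V \<Longrightarrow> (\<forall>x. m x \<le> V) \<Longrightarrow> all_consistent P ss m \<Longrightarrow>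
     pram_run (compile_prog ss) P m (V ^ k) (length (compile_prog ss)) (P * length (compile_prog ss)) (exec P ss m)"
    using programs_run[OF fin] by blast
  define T where "T = Max ((\<lambda>ss. length (compile_prog ss)) ` SS)"
  have T: "length (compile_prog ss) \<le> T" if "ss \<in> SS" for ss
    unfolding T_def using fin that by (intro Max_ge) auto
  \<comment> \<open>By \<open>nprocs_poly\<close> and \<open>D ^ rd <= M * n\<close>,
    \<open>A * n ^ 4\<close> is at least \<open>m 0 + E + 2\<close>, which bounds the
    memory.\<close>
  define A where "A = cap ^ 3 * M ^ 4 + E + 2"
  \<comment> \<open>The bound on numbers has a single constant as factor and exponent. In
    \<open>(A * n ^ 4) ^ k\<close> these are \<open>A ^ k\<close> and \<open>4 * k\<close>, and the
    sum dominates both.\<close>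
  define Kb where "Kb = A ^ k + 4 * k"
  define r where "r = real T * (real (cap ^ 3) * real M powr (3 + 1 / real rd))"
  define W where "W n = nat \<lfloor>r * real n powr (3 + 1 / real rd)\<rfloor>" for n
  have A2: "2 \<le> A" by (simp add: A_def)
  have bound: "V ^ k \<le> Kb * n ^ Kb" if "V \<le> A * n ^ 4" "1 \<le> n" for V n
  proof -
    have "V ^ k \<le> (A * n ^ 4) ^ k" using that by (intro power_mono) auto
    also have "\<dots> = A ^ k * n ^ (4 * k)" by (simp add: power_mult_distrib power_mult)
    also have "\<dots> \<le> Kb * n ^ Kb" using that by (intro mult_le_mono power_increasing) (auto simp: Kb_def)
    finally show ?thesis .
  qed
  have step: "oper_run alg enc f m (Kb * n ^ Kb) (length (compile_prog (op_stmts f)))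
      (m 0 * length (compile_prog (op_stmts f))) (exec (m 0) (op_stmts f) (load_args enc f m)) \<and>
      m 0 * length (compile_prog (op_stmts f)) \<le> W n"
    if i: "inv (map enc w) m" and n: "length w \<le> n" "1 \<le> n" and f: "valid_oper \<Sigma> w f" for w n m f
  proof -
    obtain D where D: "2 \<le> D" "m 0 = nprocs rd cap D" "D ^ rd \<le> M * n" "length w + 1 \<le> m 0"
      using inv_size[OF i, of n] n by auto
    let ?V = "m 0 + E + 2"
    have "load_args enc f m x \<le> ?V" for x
    proof -
      have "m x \<le> m 0 + E" using i by (auto simp: inv_def)
      moreover have "enc \<sigma> \<le> ?V" if "\<sigma> \<in> \<Sigma>" for \<sigma>
      proof -
        have "enc \<sigma> \<le> E" using E al that by auto
        then show ?thesis by simp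
      qed
      ultimately show ?thesis using f D(4) by (cases f) auto
    qed
    then have pr: "pram_run (compile_prog (op_stmts f)) (m 0) (load_args enc f m) (?V ^ k) (length (compile_prog (op_stmts f)))
      (m 0 * length (compile_prog (op_stmts f))) (exec (m 0) (op_stmts f) (load_args enc f m))"
      using run[OF op_SS, of ?V "m 0" "load_args enc f m" f] oper_step(1)[OF i f al] by simp
    have "?V \<le> cap ^ 3 * (M * n) ^ 4 + (E + 2)" using nprocs_poly[OF D(1,3)] D(2) by simp
    also have "\<dots> \<le> cap ^ 3 * (M * n) ^ 4 + (E + 2) * n ^ 4"
    proof -
      have "(E + 2) * 1 \<le> (E + 2) * n ^ 4" by (intro mult_le_mono2 one_le_power n(2))
      then show ?thesis by simp
    qed
    also have "\<dots> = A * n ^ 4" by (simp add: A_def power_mult_distrib algebra_simps)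
    finally have "?V ^ k \<le> Kb * n ^ Kb" by (rule bound[OF _ n(2)])
    from pram_run_mono[OF pr this] have "oper_run alg enc f m (Kb * n ^ Kb) (length (compile_prog (op_stmts f)))
      (m 0 * length (compile_prog (op_stmts f))) (exec (m 0) (op_stmts f) (load_args enc f m))"
      by (simp add: oper_run_def oper_prog_alg)
    moreover have "m 0 * length (compile_prog (op_stmts f)) \<le> W n"
    proof -
      have "real (m 0 * length (compile_prog (op_stmts f))) \<le> real (m 0) * real T"
        using T[OF op_SS, of f] by (simp add: mult_left_mono)
      also have "\<dots> \<le> real (cap ^ 3) * real (M * n) powr (3 + 1 / real rd) * real T"
        using nprocs_powr[OF D(1,3)] D(2) by (intro mult_right_mono) auto
      also have "\<dots> = r * real n powr (3 + 1 / real rd)" by (simp add: r_def powr_mult)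
      finally show ?thesis unfolding W_def by (rule le_nat_floor)
    qed
    ultimately show ?thesis by blast
  qed
  have init0: "init_run alg (Kb * 1 ^ Kb) (length (compile_prog init_stmts)) (length (compile_prog init_stmts))
    (exec 1 init_stmts ((\<lambda>_. 0)(0 := 1)))" "length (compile_prog init_stmts) \<le> W 1"
  proof -
    have iS: "init_stmts \<in> SS" by (simp add: SS_def)
    have "2 ^ k \<le> Kb * 1 ^ Kb" by (rule bound) (use A2 in auto)
    moreover have "pram_run (compile_prog init_stmts) 1 ((\<lambda>_. 0)(0 := 1)) (2 ^ k) (length (compile_prog init_stmts))
       (1 * length (compile_prog init_stmts)) (exec 1 init_stmts ((\<lambda>_. 0)(0 := 1)))"
      by (rule run[OF iS]) (use init_step(1) in auto)
    ultimately show "init_run alg (Kb * 1 ^ Kb) (length (compile_prog init_stmts)) (length (compile_prog init_stmts))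
      (exec 1 init_stmts ((\<lambda>_. 0)(0 := 1)))"
      unfolding init_run_def using pram_run_mono by (fastforce simp: alg_def)
    have "1 \<le> M" by (simp add: M_def)
    then have "1 \<le> real M powr (3 + 1 / real rd)" by (intro ge_one_powr_ge_zero) auto
    moreover have "1 \<le> real (cap ^ 3)" using cap by (simp add: Suc_leI)
    ultimately have "1 * 1 \<le> real (cap ^ 3) * real M powr (3 + 1 / real rd)" by (intro mult_mono) auto
    then have "real T * 1 \<le> r" unfolding r_def by (intro mult_left_mono) auto
    then have "real (length (compile_prog init_stmts)) \<le> r" using T[OF iS] by linarith
    then show "length (compile_prog init_stmts) \<le> W 1" unfolding W_def by (intro le_nat_floor) simp
  qed
  have reach: "inv (map enc w) m \<and> set w \<subseteq> \<Sigma>" if "reachable alg \<Sigma> enc (\<lambda>n. Kb * n ^ Kb) w n m" for w n m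
    using that
  proof induction
    case (init t j m)
    have "m = exec 1 init_stmts ((\<lambda>_. 0)(0 := 1))"
      using pram_run_mem_unique[OF init[unfolded init_run_def] init0(1)[unfolded init_run_def]] .
    then show ?case using init_step(2) by simp
  next
    case (oper w n m f t j m')
    have n: "1 \<le> n" "length w \<le> n" using reachable_size(1,2)[OF oper.hyps(1)] by auto
    have i: "inv (map enc w) m" using oper.IH by simp
    have "m' = exec (m 0) (op_stmts f) (load_args enc f m)"
      using pram_run_mem_unique[OF oper.hyps(3)[unfolded oper_run_def]
          step[OF i n(2,1) oper.hyps(2), THEN conjunct1, unfolded oper_run_def]] .
    moreover have "set (apply_oper f w) \<subseteq> \<Sigma>"
      using oper.IH oper.hyps(2)
      by (cases f) (auto dest!: in_set_takeD in_set_dropD set_update_subset_insert[THEN subsetD])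
    ultimately show ?case using oper_step(2)[OF i oper.hyps(2) al] by simp
  qed
  have "constant_time_dynamic_algorithm alg \<Sigma> enc Lang W"
    unfolding constant_time_dynamic_algorithm_def Let_def
  proof (rule exI[of _ T], rule exI[of _ Kb], intro conjI allI impI)
    show "\<exists>t k m. init_run alg (Kb * 1 ^ Kb) t k m \<and> t \<le> T \<and> k \<le> W 1"
      using init0 T[of init_stmts] by (auto simp: SS_def)
    fix w n m f
    assume h: "reachable alg \<Sigma> enc (\<lambda>n. Kb * n ^ Kb) w n m" "valid_oper \<Sigma> w f"
    have i: "inv (map enc w) m" "set w \<subseteq> \<Sigma>" using reach[OF h(1)] by auto
    have n: "1 \<le> n" "length w \<le> n" using reachable_size(1,2)[OF h(1)] by auto
    have q: "exec (m 0) (op_stmts f) (load_args enc f m) 3 = of_bool (substring w i' j \<in> Lang)" if "f = Query i' j" for i' j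
    proof -
      have "set (substring w i' j) \<subseteq> \<Sigma>"
        using i(2) set_take_subset[of j w] set_drop_subset[of "i' - 1" "take j w"] by (auto simp: substring_def)
      then show ?thesis using oper_step(3)[OF i(1) h(2) al that] Lang by simp
    qed
    show "\<exists>t k m'. oper_run alg enc f m (Kb * n ^ Kb) t k m' \<and> t \<le> T \<and> k \<le> W n \<and>
      (\<forall>i j. f = Query i j \<longrightarrow> m' 3 = of_bool (substring w i j \<in> Lang))"
      using step[OF i(1) n(2,1) h(2)] T[OF op_SS] q by blast
  qed
  moreover have "0 \<le> r" by (simp add: r_def)
  ultimately show ?thesis unfolding W_def by blast
qed

end

subsection \<open>Realtime automata as stack machines\<close>

lemma runs_delta_steps:
  "runs (\<lambda>\<sigma> q \<tau>. delta M q (Some \<sigma>) \<tau>) u (p, \<gamma>) = Some (q, \<gamma>') \<Longrightarrow>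
   (dpda_step M)\<^sup>*\<^sup>* (p, u @ v, \<gamma>) (q, v, \<gamma>')"
proof (induction u arbitrary: p \<gamma>)
  case (Cons a u)
  then obtain \<tau> \<gamma>0 where g: "\<gamma> = \<tau> # \<gamma>0" by (cases \<gamma>) auto
  then obtain q1 \<alpha> where s: "delta M p (Some a) \<tau> = Some (q1, \<alpha>)"
    using Cons.prems by (auto split: option.splits)
  have "dpda_step M (p, a # u @ v, \<tau> # \<gamma>0) (q1, u @ v, \<alpha> @ \<gamma>0)" using s by (rule dpda_step.read)
  moreover have "(dpda_step M)\<^sup>*\<^sup>* (q1, u @ v, \<alpha> @ \<gamma>0) (q, v, \<gamma>')"
    using Cons.IH[of q1 "\<alpha> @ \<gamma>0"] Cons.prems s g by simp
  ultimately show ?case using g by (simp add: converse_rtranclp_into_rtranclp)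
qed simp

lemma realtime_steps_runs:
  assumes "(dpda_step M)\<^sup>*\<^sup>* c (q, v, \<gamma>')" "realtime M" "c = (p, u, \<gamma>)"
  shows "\<exists>u1. u = u1 @ v \<and> runs (\<lambda>\<sigma> q \<tau>. delta M q (Some \<sigma>) \<tau>) u1 (p, \<gamma>) = Some (q, \<gamma>')"
  using assms(1,3)
proof (induction arbitrary: p u \<gamma> rule: converse_rtranclp_induct)
  case base
  then show ?case by simp
next
  case (step c c')
  from step.hyps(1) show ?case
  proof cases
    case (read p' \<sigma> \<tau> q' \<alpha> u' \<gamma>0)
    obtain u1 where "u' = u1 @ v" "runs (\<lambda>\<sigma> q \<tau>. delta M q (Some \<sigma>) \<tau>) u1 (q', \<alpha> @ \<gamma>0) = Some (q, \<gamma>')"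
      using step.IH[OF read(2)] by blast
    then show ?thesis using read step.prems by (intro exI[of _ "\<sigma> # u1"]) simp
  next
    case (lambda p' \<tau> q' \<alpha> u' \<gamma>0)
    then show ?thesis using assms(2) by (simp add: realtime_def)
  qed
qed

text \<open>Without lambda-transitions there is no step once the input is read, so the maximality
  demanded by \<open>dpda_language\<close> holds by itself.\<close>

lemma dpda_language_runs:
  assumes "realtime M"
  shows "w \<in> dpda_language M \<longleftrightarrow> (\<exists>q \<gamma>. runs (\<lambda>\<sigma> q \<tau>. delta M q (Some \<sigma>) \<tau>) w
    (start_state M, [start_symbol M]) = Some (q, \<gamma>) \<and> q \<in> final_states M)"
proof -
  have "\<not> dpda_step M (q, [], \<gamma>) c" for q \<gamma> c
    using assms by (auto simp: realtime_def elim: dpda_step.cases)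
  then show ?thesis
    using realtime_steps_runs[OF _ assms refl] runs_delta_steps[where v = "[]"]
    unfolding dpda_language_def by fastforce
qed

text \<open>A stack is cut into nonempty blocks: reading \<open>\<sigma>\<close> with top block \<open>\<tau> # \<beta>\<close> replaces this block
  by \<open>\<alpha>\<close> and \<open>\<beta>\<close>, so that at most two blocks are pushed. The blocks are suffixes of pushed
  strings, hence there are finitely many.\<close>

definition block_delta :: "('q, 'a, 'g) dpda \<Rightarrow> 'a \<Rightarrow> 'q \<Rightarrow> 'g list \<Rightarrow> ('q \<times> 'g list list) option" where
  "block_delta M \<sigma> q \<beta> = (case delta M q (Some \<sigma>) (hd \<beta>) of None \<Rightarrow> None
     | Some (q', \<alpha>) \<Rightarrow> Some (q', filter (\<lambda>x. x \<noteq> []) [\<alpha>, tl \<beta>]))"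

definition blocks :: "('q, 'a, 'g) dpda \<Rightarrow> nat \<Rightarrow> 'g list set" where
  "blocks M n = {\<beta>. \<beta> \<noteq> [] \<and> set \<beta> \<subseteq> stack_alphabet M \<and> length \<beta> \<le> n}"

text \<open>Well-formedness confines the defined entries of \<open>delta\<close> to a finite set of
  arguments.\<close>

lemma delta_length_bound:
  assumes "wf_dpda M"
  shows "\<exists>n. \<forall>p x \<tau> q \<alpha>. delta M p x \<tau> = Some (q, \<alpha>) \<longrightarrow> length \<alpha> \<le> n"
proof -
  let ?D = "states M \<times> insert None (Some ` alphabet M) \<times> stack_alphabet M"
  let ?f = "\<lambda>(p, x, \<tau>). length (snd (the (delta M p x \<tau>)))"
  have fin: "finite ?D" using assms by (auto simp: wf_dpda_def)
  have "length \<alpha> \<le> Max (?f ` ?D)" if d: "delta M p x \<tau> = Some (q, \<alpha>)" for p x \<tau> q \<alpha>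
  proof -
    have "p \<in> states M" "set_option x \<subseteq> alphabet M" "\<tau> \<in> stack_alphabet M"
      using assms d unfolding wf_dpda_def by blast+
    then have "(p, x, \<tau>) \<in> ?D" by (cases x) auto
    then have "?f (p, x, \<tau>) \<in> ?f ` ?D" by (rule imageI)
    then have "?f (p, x, \<tau>) \<le> Max (?f ` ?D)" using fin by (intro Max_ge finite_imageI)
    then show ?thesis using d by simp
  qed
  then show ?thesis by blast
qed

theorem realtime_stack_machine:
  fixes M :: "('q, 'a, 'g) dpda" and enc :: "'a \<Rightarrow> nat"
  assumes wf: "wf_dpda M" and rt: "realtime M" and inj: "inj_on enc (alphabet M)"
  obtains stp cap q0 g0 fin where "stack_machine stp cap" "q0 < cap" "g0 < cap"
    "\<And>w. set w \<subseteq> alphabet M \<Longrightarrow> w \<in> dpda_language M \<longleftrightarrow>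
       (\<exists>q \<gamma>. runs stp (map enc w) (q0, [g0]) = Some (q, \<gamma>) \<and> fin q)"
proof -
  obtain n where n: "\<And>p x \<tau> q \<alpha>. delta M p x \<tau> = Some (q, \<alpha>) \<Longrightarrow> length \<alpha> \<le> n"
    using delta_length_bound[OF wf] by blast
  \<comment> \<open>\<open>Suc n\<close> ensures that the start block, of length 1, is included even
    if all pushed strings are empty.\<close>
  define B where "B = blocks M (Suc n)"
  have "finite {\<beta>. set \<beta> \<subseteq> stack_alphabet M \<and> length \<beta> \<le> Suc n}"
    using wf by (intro finite_lists_length_le) (auto simp: wf_dpda_def)
  then have finB: "finite B" unfolding B_def blocks_def by (rule rev_finite_subset) auto
  have finQ: "finite (states M)" using wf by (simp add: wf_dpda_def)
  obtain fq nq where fq: "fq ` states M = {i. i < (nq::nat)}" "inj_on fq (states M)"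
    using finite_imp_inj_to_nat_seg[OF finQ] by metis
  obtain fb nb where fb: "fb ` B = {i. i < (nb::nat)}" "inj_on fb B"
    using finite_imp_inj_to_nat_seg[OF finB] by metis
  define cap where "cap = nq + nb"
  \<comment> \<open>It is undefined outside the codes, since the conditions of
    \<open>stack_machine\<close> range over all numbers.\<close>
  define stp where "stp a q g = (if a \<in> enc ` alphabet M \<and> q \<in> fq ` states M \<and> g \<in> fb ` B
     then map_option (\<lambda>(q', bs). (fq q', map fb bs))
       (block_delta M (inv_into (alphabet M) enc a) (inv_into (states M) fq q) (inv_into B fb g))
     else None)" for a q g
  have bl: "q' \<in> states M \<and> set bs \<subseteq> B \<and> length bs \<le> 2 \<and> concat bs = \<alpha> @ tl \<beta>"
    if \<beta>: "\<beta> \<in> B" and d: "delta M q (Some \<sigma>) (hd \<beta>) = Some (q', \<alpha>)"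
      and bs: "bs = filter (\<lambda>x. x \<noteq> []) [\<alpha>, tl \<beta>]" for q \<sigma> \<beta> q' \<alpha> bs
  proof -
    have "q' \<in> states M" "set \<alpha> \<subseteq> stack_alphabet M" using wf d unfolding wf_dpda_def by blast+
    moreover have "set (tl \<beta>) \<subseteq> stack_alphabet M" "length (tl \<beta>) \<le> Suc n"
      using \<beta> by (auto simp: B_def blocks_def dest: list.set_sel(2))
    ultimately show ?thesis using n[OF d] by (auto simp: B_def blocks_def bs)
  qed
  have fqc: "fq q < cap" if "q \<in> states M" for q
  proof -
    have "fq q \<in> {i. i < nq}" using that fq(1) by blast
    then show ?thesis by (simp add: cap_def)
  qed
  have fbc: "fb \<beta> < cap" if "\<beta> \<in> B" for \<beta>
  proof -
    have "fb \<beta> \<in> {i. i < nb}" using that fb(1) by blast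
    then show ?thesis by (simp add: cap_def)
  qed
  have sm: "length x \<le> 2 \<and> q' < cap \<and> set x \<subseteq> {..<cap}" if s: "stp a q g = Some (q', x)" for a q g q' x
  proof -
    obtain q1 bs where 1: "g \<in> fb ` B" "block_delta M (inv_into (alphabet M) enc a) (inv_into (states M) fq q)
      (inv_into B fb g) = Some (q1, bs)" "q' = fq q1" "x = map fb bs"
      using s by (auto simp: stp_def split: if_splits)
    obtain \<alpha> where \<alpha>: "delta M (inv_into (states M) fq q) (Some (inv_into (alphabet M) enc a)) (hd (inv_into B fb g)) = Some (q1, \<alpha>)"
      "bs = filter (\<lambda>x. x \<noteq> []) [\<alpha>, tl (inv_into B fb g)]"
      using 1(2) by (auto simp: block_delta_def split: option.splits)
    have "q1 \<in> states M \<and> set bs \<subseteq> B \<and> length bs \<le> 2"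
      using bl[OF inv_into_into[OF 1(1)] \<alpha>] by simp
    then show ?thesis using 1 fqc fbc by auto
  qed
  have machine: "stack_machine stp cap" by unfold_locales (use sm in auto)
  have start: "start_state M \<in> states M" "[start_symbol M] \<in> B"
    using wf by (auto simp: wf_dpda_def B_def blocks_def)
  \<comment> \<open>Nothing is said about the final stack \<open>x\<close>, since acceptance depends
    on the state alone; the correspondence of stacks is kept by quantifying over the initial blocks
    \<open>bs\<close>.\<close>
  have sim: "case runs (\<lambda>\<sigma> q \<tau>. delta M q (Some \<sigma>) \<tau>) w (q, concat bs) of
      None \<Rightarrow> runs stp (map enc w) (fq q, map fb bs) = None
    | Some (q', \<gamma>) \<Rightarrow> q' \<in> states M \<and> (\<exists>x. runs stp (map enc w) (fq q, map fb bs) = Some (fq q', x))"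
    if "set w \<subseteq> alphabet M" "q \<in> states M" "set bs \<subseteq> B" for w q bs
    using that
  proof (induction w arbitrary: q bs)
    case (Cons \<sigma> w)
    show ?case
    proof (cases bs)
      case (Cons \<beta> bs')
      have \<beta>: "\<beta> \<in> B" "\<beta> \<noteq> []" using Cons.prems Cons by (auto simp: B_def blocks_def)
      then obtain \<tau> \<beta>' where b: "\<beta> = \<tau> # \<beta>'" by (cases \<beta>) auto
      have s: "stp (enc \<sigma>) (fq q) (fb \<beta>) = map_option (\<lambda>(q', bs). (fq q', map fb bs)) (block_delta M \<sigma> q \<beta>)"
        using Cons.prems \<beta> inj fq(2) fb(2) by (simp add: stp_def)
      show ?thesis
      proof (cases "delta M q (Some \<sigma>) \<tau>")
        case None
        then show ?thesis using Cons b s by (simp add: block_delta_def)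
      next
        case (Some y)
        obtain q' \<alpha> where y: "delta M q (Some \<sigma>) \<tau> = Some (q', \<alpha>)" using Some by (cases y) auto
        define bs1 where "bs1 = filter (\<lambda>x. x \<noteq> []) [\<alpha>, tl \<beta>]"
        have B1: "q' \<in> states M \<and> set bs1 \<subseteq> B \<and> length bs1 \<le> 2 \<and> concat bs1 = \<alpha> @ tl \<beta>"
          by (rule bl[OF \<beta>(1) _ bs1_def]) (use y b in simp)
        have bd: "block_delta M \<sigma> q \<beta> = Some (q', bs1)" using y b by (simp add: block_delta_def bs1_def)
        have e1: "runs (\<lambda>\<sigma> q \<tau>. delta M q (Some \<sigma>) \<tau>) (\<sigma> # w) (q, concat bs) =
          runs (\<lambda>\<sigma> q \<tau>. delta M q (Some \<sigma>) \<tau>) w (q', concat (bs1 @ bs'))"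
          using y b B1 Cons by simp
        have e2: "runs stp (map enc (\<sigma> # w)) (fq q, map fb bs) = runs stp (map enc w) (fq q', map fb (bs1 @ bs'))"
          using s bd Cons by simp
        show ?thesis unfolding e1 e2
          by (rule Cons.IH) (use Cons.prems B1 Cons in auto)
      qed
    qed simp
  qed simp
  have acc: "w \<in> dpda_language M \<longleftrightarrow> (\<exists>q \<gamma>. runs stp (map enc w) (fq (start_state M), [fb [start_symbol M]]) = Some (q, \<gamma>)
      \<and> q \<in> fq ` final_states M)" if "set w \<subseteq> alphabet M" for w
  proof -
    have fs: "final_states M \<subseteq> states M" using wf by (simp add: wf_dpda_def)
    have im: "fq q \<in> fq ` final_states M \<longleftrightarrow> q \<in> final_states M" if "q \<in> states M" for q
      using inj_on_image_mem_iff[OF fq(2) that fs] .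
    let ?r = "runs (\<lambda>\<sigma> q \<tau>. delta M q (Some \<sigma>) \<tau>) w (start_state M, [start_symbol M])"
    have s: "case ?r of None \<Rightarrow> runs stp (map enc w) (fq (start_state M), [fb [start_symbol M]]) = None
      | Some (q', \<gamma>) \<Rightarrow> q' \<in> states M \<and>
          (\<exists>x. runs stp (map enc w) (fq (start_state M), [fb [start_symbol M]]) = Some (fq q', x))"
      using sim[OF that start(1), of "[[start_symbol M]]", unfolded list.map concat.simps append_Nil2] start(2)
      by simp
    show ?thesis
    proof (cases ?r)
      case None
      then show ?thesis using s by (simp add: dpda_language_runs[OF rt])
    next
      case (Some y)
      obtain q \<gamma> where y: "y = (q, \<gamma>)" by (cases y)
      then obtain x where x: "q \<in> states M"
        "runs stp (map enc w) (fq (start_state M), [fb [start_symbol M]]) = Some (fq q, x)"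
        using s Some by auto
      show ?thesis using Some y x(2) im[OF x(1)] by (simp add: dpda_language_runs[OF rt])
    qed
  qed
  show ?thesis
    by (rule that[OF machine fqc[OF start(1)] fbc[OF start(2)] acc])
qed

theorem theorem3:
  fixes M :: "('q, 'a, 'g) dpda" and L :: "'a list set"
    and enc :: "'a \<Rightarrow> nat" and \<epsilon> :: real
  assumes "wf_dpda M" and "realtime M" and "L = dpda_language M"
    and "inj_on enc (alphabet M)"
    and "\<epsilon> > 0"
  shows "\<exists>A W. constant_time_dynamic_algorithm A (alphabet M) enc L W \<and>
               (\<lambda>n. real (W n)) \<in> O(\<lambda>n. real n powr (3 + \<epsilon>))"
proof -
  obtain stp cap q0 g0 fin where m: "stack_machine stp cap" "q0 < cap" "g0 < cap"
    "\<And>w. set w \<subseteq> alphabet M \<Longrightarrow> w \<in> dpda_language M \<longleftrightarrow>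
       (\<exists>q \<gamma>. runs stp (map enc w) (q0, [g0]) = Some (q, \<gamma>) \<and> fin q)"
    using realtime_stack_machine[OF assms(1,2,4)] by blast
  have fin: "finite (enc ` alphabet M)" using assms(1) by (simp add: wf_dpda_def)
  obtain al where al: "set al = enc ` alphabet M" using finite_list[OF fin] by (elim exE)
  \<comment> \<open>The bound \<open>1 / \<epsilon>\<close> yields
    \<open>1 / rd <= \<epsilon>\<close>; at least 2 is demanded by \<open>dynamic\<close>.\<close>
  define rd where "rd = max 2 (nat \<lceil>1 / \<epsilon>\<rceil>)"
  have "1 / \<epsilon> \<le> real rd" unfolding rd_def by linarith
  moreover have "0 < real rd" by (simp add: rd_def)
  ultimately have e: "1 / real rd \<le> \<epsilon>" using assms(5) by (simp add: field_simps)
  \<comment> \<open>\<open>insert 0\<close> keeps \<open>Max\<close> meaningful for an empty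
    alphabet.\<close>
  interpret dynamic stp cap al rd q0 g0 "Max (insert 0 (set al))" fin
    by (intro dynamic.intro table_prog.intro m(1) table_prog_axioms.intro dynamic_axioms.intro)
      (use m in \<open>auto simp: rd_def\<close>)
  have "\<exists>r. constant_time_dynamic_algorithm alg (alphabet M) enc L
      (\<lambda>n. nat \<lfloor>r * real n powr (3 + 1 / real rd)\<rfloor>) \<and> 0 \<le> r"
    by (rule dynamic_algorithm) (use al m(4) assms(3) in \<open>auto simp: accept_def\<close>)
  then obtain r where r: "constant_time_dynamic_algorithm alg (alphabet M) enc L
      (\<lambda>n. nat \<lfloor>r * real n powr (3 + 1 / real rd)\<rfloor>)" "0 \<le> r" by blast
  have "(\<lambda>n. real (nat \<lfloor>r * real n powr (3 + 1 / real rd)\<rfloor>)) \<in> O(\<lambda>n. real n powr (3 + \<epsilon>))"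
  proof (rule bigoI[of _ r])
    show "eventually (\<lambda>n. norm (real (nat \<lfloor>r * real n powr (3 + 1 / real rd)\<rfloor>)) \<le> r * norm (real n powr (3 + \<epsilon>))) at_top"
      using eventually_ge_at_top[of 1]
    proof eventually_elim
      case (elim n)
      have "real (nat \<lfloor>r * real n powr (3 + 1 / real rd)\<rfloor>) \<le> r * real n powr (3 + 1 / real rd)"
        using r(2) by (intro of_nat_floor) simp
      also have "\<dots> \<le> r * real n powr (3 + \<epsilon>)"
        using elim e r(2) by (intro mult_left_mono powr_mono) auto
      finally show ?case by simp
    qed
  qed
  then show ?thesis using r(1) by blast
qed

end
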